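(* Let $G$ be a finite group, $H\le Z(G)$, and let $Y$ be a $G$-modular operator space. If $Y$ is $(G,H,\Gamma)$-aligned for some $\Gamma\le\mathrm{Aut}_H(G)$ that is balanced for $H\le G$, then there is a central $H$-modular operator space $X$ such that $Y=X_G$; that is, there is a surjective linear complete isometry $j:X_G\to Y$ intertwining the left $G$-actions and the right $G$-actions.
   Context: Everything is over a fixed field $\mathbb{F}\in\{\mathbb{R},\mathbb{C}\}$. A group action is ergodic if $0$ is its only fixed vector. $G$-modular operator space: an operator space $Y$ with a left and a right action of $G$ by linear complete isometries for which there are a Hilbert space $\mathcal{H}$, a linear complete isometry $\rho:Y\to B(\mathcal{H})$ and a unitary representation $\theta:G\to B(\mathcal{H})$ with $\rho(gy)=\theta(g)\rho(y)$ and $\rho(yg)=\rho(y)\theta(g)$ for $g\in G$, $y\in Y$. Central $H$-modular operator space: an operator space $X$ with a left action of $H$ by linear complete isometries for which there are a Hilbert space $\mathcal{H}$, a linear complete isometry $\rho:X\to B(\mathcal{H})$ and a unitary representation $\theta:H\to B(\mathcal{H})$ with $\rho(hx)=\theta(h)\rho(x)=\rho(x)\theta(h)$ for $h\in H$, $x\in X$ (a central representation). $\mathrm{Aut}_H(G)=\{\sigma\in\mathrm{Aut}(G):\sigma(h)=h\ \forall h\in H\}$; $(G,H)$ is $\Gamma$-admissible if $H\subseteq\{g^{-1}\sigma(g):\sigma\in\Gamma\}$ for every $g\in G\setminus H$. A subgroup $\Gamma\le\mathrm{Aut}_H(G)$ is balanced for $H\le G$ if $(G,H)$ is $\Gamma$-admissible,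 $\mathrm{Inn}(G)\subseteq\Gamma$, and for every $\sigma\in\Gamma$ the set $L_\sigma=\{g^{-1}\sigma(g):g\in G\}$ is a subgroup of $G$. For $\Gamma$ balanced, a $G$-modular operator space $Y$ is $(G,H,\Gamma)$-aligned if: (i) it is ergodic for the restriction of the (left) action to $H$ and to $L_\sigma$, for every non-trivial $\sigma\in\Gamma$; (ii) there is an action of $\Gamma$ on $Y$ by (linear) complete isometries such that $\sigma(gy)=\sigma(g)\sigma(y)$ for all $\sigma\in\Gamma$, $g\in G$, $y\in Y$; (iii) for every $g\in G$, $y\in Y$, $\sigma_g(y)=gyg^{-1}$, where $\sigma_g\in\mathrm{Inn}(G)\subseteq\Gamma$ is the inner automorphism defined by $g$ and $\sigma_g(y)$ is its action on $Y$ from (ii). $X_G=\{\varphi:G\to X\mid\varphi(gh)=h^{-1}\varphi(g)\ \forall g\in G,h\in H\}$, with left action $(g\varphi)(k)=\varphi(g^{-1}k)$ and right action $(\varphi g)(k)=\varphi(kg^{-1})$. Its operator space structure: for a central representation $(\theta,\rho,\mathcal{H})$ of $X$, let $\mathcal{H}_G$ (with $H$-action $h\xi=\theta(h)\xi$) have the Hilbert space structure inherited from $\ell^2(G,\mathcal{H})$, and for $\varphi\in X_G$ let $\mathfrak{I}(\rho\circ\varphi)\in B(\mathcal{H}_G)$ be $[\mathfrak{I}(\rho\circ\varphi)\xi](g)=\frac1{|H|}\sum_{k\in G}\rho(\varphi(k))(\xi(k^{-1}g))$; then $\varphi\mapsto\mathfrak{I}(\rho\circ\varphi)$ is required to be a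 complete isometry (the resulting matrix norms do not depend on the choice of representation). *)

theory Defs
  imports
    "HOL-Algebra.Bij"
    "HOL-Library.Function_Algebras"
    "Jordan_Normal_Form.Matrix"
begin

section \<open>The scalar field\<close>

text \<open>
  The axioms below single out the real and the complex field with their usual absolute value and
  conjugation; see the two instances and the classification lemma.
\<close>

class real_or_complex = real_normed_field + conjugatable_field +
  assumes mult_conjugate_scaleR: "x * conjugate x = (norm x)\<^sup>2 *\<^sub>R 1"

instance real :: real_or_complex
  by standard (simp add: power2_eq_square)

instance complex :: real_or_complex
  by standard (simp add: complex_norm_square[symmetric] scaleR_conv_of_real del: of_real_power)

lemma mult_conjugate_self:
  "x * conjugate x = of_real ((norm (x :: 'f :: real_or_complex))\<^sup>2)"
  by (simp add: mult_conjugate_scaleR of_real_def)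

lemma real_or_complex_quadratic:
  fixes x :: "'f :: real_or_complex"
  obtains a b :: real where "(x - of_real a)\<^sup>2 = of_real b"
proof -
  have one: "conjugate (1 :: 'f) = 1"
    using mult_conjugate_self[of "1 :: 'f"] by simp
  have "(1 + x) * conjugate (1 + x) = 1 + (x + conjugate x) + x * conjugate x"
    by (simp add: conjugate_dist_add one algebra_simps)
  hence "x + conjugate x = of_real ((norm (1 + x))\<^sup>2) - 1 - of_real ((norm x)\<^sup>2)"
    by (simp add: mult_conjugate_self algebra_simps)
  also have "\<dots> = of_real ((norm (1 + x))\<^sup>2 - 1 - (norm x)\<^sup>2)"
    by simp
  finally obtain t :: real where t: "x + conjugate x = of_real t" by blast
  define a where "a = t / 2"
  have t2: "of_real t = (2 :: 'f) * of_real a"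
    by (simp add: a_def)
  have c: "conjugate x = 2 * of_real a - x"
    using t t2 by (simp add: algebra_simps)
  have "(x - of_real a)\<^sup>2 = (of_real a)\<^sup>2 - x * conjugate x"
    unfolding c by (simp add: power2_eq_square algebra_simps)
  also have "\<dots> = of_real (a\<^sup>2 - (norm x)\<^sup>2)"
    by (simp add: mult_conjugate_self)
  finally show ?thesis by (rule that)
qed

lemma real_or_complex_cases:
  "(UNIV :: 'f :: real_or_complex set) = \<real> \<or>
   (\<exists>i :: 'f. i\<^sup>2 = -1 \<and> (\<forall>x. \<exists>a b. x = of_real a + of_real b * i))"
proof (cases "(UNIV :: 'f set) = \<real>")
  case False
  have root: "\<exists>a b. \<exists>j :: 'f. x = of_real a + of_real b * j \<and> j\<^sup>2 = -1"
    if "x \<notin> \<real>" for x :: 'f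
  proof -
    obtain a b :: real where ab: "(x - of_real a)\<^sup>2 = of_real b"
      by (rule real_or_complex_quadratic)
    have b: "b < 0"
    proof (rule ccontr)
      assume "\<not> b < 0"
      hence "(of_real b :: 'f) = (of_real (sqrt b))\<^sup>2"
        by (simp flip: of_real_power)
      with ab have "x - of_real a = of_real (sqrt b) \<or> x - of_real a = - of_real (sqrt b)"
        by (simp add: power2_eq_iff)
      hence "x = of_real (a + sqrt b) \<or> x = of_real (a - sqrt b)"
        by (auto simp: algebra_simps)
      with that show False by auto
    qed
    define s where "s = sqrt (- b)"
    have s: "s \<noteq> 0" "s\<^sup>2 = - b" using b by (auto simp: s_def)
    define j where "j = (x - of_real a) / of_real s"
    have "j\<^sup>2 = of_real b / of_real (s\<^sup>2)"
      by (simp add: j_def power_divide ab)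
    also have "\<dots> = -1" using b by (simp add: s)
    finally have "j\<^sup>2 = -1" .
    moreover have "x = of_real a + of_real s * j"
      using s by (simp add: j_def)
    ultimately show ?thesis by blast
  qed
  from False obtain x0 :: 'f where "x0 \<notin> \<real>" by blast
  from root[OF this] obtain i :: 'f where i: "i\<^sup>2 = -1" by blast
  have "\<exists>a b. x = of_real a + of_real b * i" for x :: 'f
  proof (cases "x \<in> \<real>")
    case True
    then obtain a where "x = of_real a + of_real 0 * i" by (auto elim: Reals_cases)
    thus ?thesis by blast
  next
    case False
    from root[OF this] obtain a b :: real and j :: 'f
      where j: "x = of_real a + of_real b * j" "j\<^sup>2 = -1" by blast
    hence "j\<^sup>2 = i\<^sup>2" by (simp add: i)
    hence "j = i \<or> j = - i" by (simp add: power2_eq_iff)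
    thus ?thesis
    proof
      assume "j = i" with j show ?thesis by blast
    next
      assume "j = - i"
      with j have "x = of_real a + of_real (- b) * i" by simp
      thus ?thesis by blast
    qed
  qed
  with i show ?thesis by blast
qed simp


section \<open>Vector spaces, Hilbert spaces and operators\<close>

text \<open>
  A space is a linear subspace \<open>carrier V\<close> of an ambient type, with the addition of that type and
  the scalar multiplication \<open>scl V\<close>.
\<close>

record ('f, 'v) fspace = "'v partial_object" +
  scl :: "'f \<Rightarrow> 'v \<Rightarrow> 'v"

record ('f, 'v) hilb = "('f, 'v) fspace" +
  ip :: "'v \<Rightarrow> 'v \<Rightarrow> 'f"

record ('f, 'v) opsp = "('f, 'v) fspace" +
  mnorm :: "'v mat \<Rightarrow> real"

definition linear_space :: "('f::field, 'v::ab_group_add, 'm) fspace_scheme \<Rightarrow> bool" where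
  "linear_space V \<longleftrightarrow> vector_space (scl V) \<and> module.subspace (scl V) (carrier V)"

definition linear_map ::
  "('f::field, 'v::ab_group_add, 'm) fspace_scheme \<Rightarrow> ('f, 'w::ab_group_add, 'n) fspace_scheme
    \<Rightarrow> ('v \<Rightarrow> 'w) \<Rightarrow> bool" where
  "linear_map V W f \<longleftrightarrow>
     f \<in> carrier V \<rightarrow> carrier W \<and>
     (\<forall>v\<in>carrier V. \<forall>w\<in>carrier V. f (v + w) = f v + f w) \<and>
     (\<forall>c. \<forall>v\<in>carrier V. f (scl V c v) = scl W c (f v))"

definition hnorm :: "('f::real_normed_field, 'v, 'm) hilb_scheme \<Rightarrow> 'v \<Rightarrow> real" where
  "hnorm \<H> \<xi> = sqrt (norm (ip \<H> \<xi> \<xi>))"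

definition hilbert_space :: "('f::real_or_complex, 'h::ab_group_add, 'm) hilb_scheme \<Rightarrow> bool" where
  "hilbert_space \<H> \<longleftrightarrow>
     linear_space \<H> \<and>
     (\<forall>\<xi>\<in>carrier \<H>. \<forall>\<eta>\<in>carrier \<H>. \<forall>\<zeta>\<in>carrier \<H>.
        ip \<H> (\<xi> + \<eta>) \<zeta> = ip \<H> \<xi> \<zeta> + ip \<H> \<eta> \<zeta>) \<and>
     (\<forall>c. \<forall>\<xi>\<in>carrier \<H>. \<forall>\<eta>\<in>carrier \<H>. ip \<H> (scl \<H> c \<xi>) \<eta> = c * ip \<H> \<xi> \<eta>) \<and>
     (\<forall>\<xi>\<in>carrier \<H>. \<forall>\<eta>\<in>carrier \<H>. ip \<H> \<eta> \<xi> = conjugate (ip \<H> \<xi> \<eta>)) \<and>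
     (\<forall>\<xi>\<in>carrier \<H>. \<exists>r\<ge>0. ip \<H> \<xi> \<xi> = of_real r) \<and>
     (\<forall>\<xi>\<in>carrier \<H>. ip \<H> \<xi> \<xi> = 0 \<longrightarrow> \<xi> = 0) \<and>
     (\<forall>x :: nat \<Rightarrow> 'h. range x \<subseteq> carrier \<H> \<longrightarrow>
        (\<forall>e>0. \<exists>N. \<forall>m\<ge>N. \<forall>n\<ge>N. hnorm \<H> (x m - x n) < e) \<longrightarrow>
        (\<exists>l\<in>carrier \<H>. (\<lambda>n. hnorm \<H> (x n - l)) \<longlonglongrightarrow> 0))"

text \<open>
  The norm of an operator matrix \<open>A\<close> acting from the \<open>dim_col A\<close>-fold to the \<open>dim_row A\<close>-fold
  Hilbert space direct sum of \<open>\<H>\<close> with itself.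
\<close>

definition opnorm ::
  "('f::real_normed_field, 'h::ab_group_add, 'm) hilb_scheme \<Rightarrow> ('h \<Rightarrow> 'h) mat \<Rightarrow> real" where
  "opnorm \<H> A =
     Sup {sqrt (\<Sum>i<dim_row A. (hnorm \<H> (\<Sum>j<dim_col A. (A $$ (i, j)) (\<xi> j)))\<^sup>2) | \<xi>.
            (\<forall>j<dim_col A. \<xi> j \<in> carrier \<H>) \<and> (\<Sum>j<dim_col A. (hnorm \<H> (\<xi> j))\<^sup>2) \<le> 1}"

text \<open>
  \<open>B(\<H>)\<close>. Operators are represented by functions vanishing outside \<open>carrier \<H>\<close>, so that equality
  of operators is equality of functions and the product of operators is \<open>(\<circ>)\<close>.
\<close>

definition bounded_ops ::
  "('f::real_normed_field, 'h::ab_group_add, 'm) hilb_scheme \<Rightarrow> ('f, 'h \<Rightarrow> 'h) opsp" where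
  "bounded_ops \<H> =
     \<lparr>carrier = {T. linear_map \<H> \<H> T \<and> (\<forall>\<xi>. \<xi> \<notin> carrier \<H> \<longrightarrow> T \<xi> = 0) \<and>
                    (\<exists>C. \<forall>\<xi>\<in>carrier \<H>. hnorm \<H> (T \<xi>) \<le> C * hnorm \<H> \<xi>)},
      scl = (\<lambda>c T \<xi>. scl \<H> c (T \<xi>)),
      mnorm = opnorm \<H>\<rparr>"

definition unitary_op ::
  "('f::real_normed_field, 'h::ab_group_add, 'm) hilb_scheme \<Rightarrow> ('h \<Rightarrow> 'h) \<Rightarrow> bool" where
  "unitary_op \<H> U \<longleftrightarrow>
     U \<in> carrier (bounded_ops \<H>) \<and> U ` carrier \<H> = carrier \<H> \<and>
     (\<forall>\<xi>\<in>carrier \<H>. \<forall>\<eta>\<in>carrier \<H>. ip \<H> (U \<xi>) (U \<eta>) = ip \<H> \<xi> \<eta>)"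

definition unitary_rep ::
  "('g, 'k) monoid_scheme \<Rightarrow> ('f::real_normed_field, 'h::ab_group_add, 'm) hilb_scheme
    \<Rightarrow> ('g \<Rightarrow> 'h \<Rightarrow> 'h) \<Rightarrow> bool" where
  "unitary_rep G \<H> \<theta> \<longleftrightarrow>
     (\<forall>g\<in>carrier G. unitary_op \<H> (\<theta> g)) \<and>
     (\<forall>g\<in>carrier G. \<forall>k\<in>carrier G. \<theta> (g \<otimes>\<^bsub>G\<^esub> k) = \<theta> g \<circ> \<theta> k)"


section \<open>Operator spaces\<close>

definition mats :: "('f, 'v, 'm) fspace_scheme \<Rightarrow> nat \<Rightarrow> 'v mat set" where
  "mats V n = {A \<in> carrier_mat n n. elements_mat A \<subseteq> carrier V}"

definition direct_sum_mat :: "'v::zero mat \<Rightarrow> 'v mat \<Rightarrow> 'v mat" where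
  "direct_sum_mat A B =
     four_block_mat A (0\<^sub>m (dim_row A) (dim_col B)) (0\<^sub>m (dim_row B) (dim_col A)) B"

definition sandwich_mat ::
  "('f::field, 'v::ab_group_add, 'm) fspace_scheme \<Rightarrow> 'f mat \<Rightarrow> 'v mat \<Rightarrow> 'f mat \<Rightarrow> 'v mat" where
  "sandwich_mat V \<alpha> A \<beta> =
     mat (dim_row \<alpha>) (dim_col \<beta>)
       (\<lambda>(i, j). \<Sum>k<dim_row A. \<Sum>l<dim_col A. scl V (\<alpha> $$ (i, k) * \<beta> $$ (l, j)) (A $$ (k, l)))"

definition scalar_mat_norm :: "'f::real_or_complex mat \<Rightarrow> real" where
  "scalar_mat_norm \<alpha> =
     opnorm \<lparr>carrier = UNIV, scl = (*), ip = (\<lambda>a b. a * conjugate b)\<rparr> (map_mat (*) \<alpha>)"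

text \<open>
  Abstract operator spaces, by Ruan's axioms (valid over both fields). Completeness is not part of
  the notion.
\<close>

definition operator_space :: "('f::real_or_complex, 'v::ab_group_add) opsp \<Rightarrow> bool" where
  "operator_space V \<longleftrightarrow>
     linear_space V \<and>
     (\<forall>n. \<forall>A\<in>mats V n.
        0 \<le> mnorm V A \<and>
        (mnorm V A = 0 \<longleftrightarrow> A = 0\<^sub>m n n) \<and>
        (\<forall>c. mnorm V (map_mat (scl V c) A) = norm c * mnorm V A) \<and>
        (\<forall>B\<in>mats V n. mnorm V (A + B) \<le> mnorm V A + mnorm V B)) \<and>
     (\<forall>m n. \<forall>A\<in>mats V m. \<forall>B\<in>mats V n.
        mnorm V (direct_sum_mat A B) = max (mnorm V A) (mnorm V B)) \<and>
     (\<forall>m n. \<forall>A\<in>mats V m. \<forall>\<alpha>\<in>carrier_mat n m. \<forall>\<beta>\<in>carrier_mat m n.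
        mnorm V (sandwich_mat V \<alpha> A \<beta>) \<le> scalar_mat_norm \<alpha> * mnorm V A * scalar_mat_norm \<beta>)"

text \<open>Complete isometries are linear and need not be surjective.\<close>

definition complete_isometry ::
  "('f::field, 'v::ab_group_add) opsp \<Rightarrow> ('f, 'w::ab_group_add) opsp \<Rightarrow> ('v \<Rightarrow> 'w) \<Rightarrow> bool" where
  "complete_isometry V W f \<longleftrightarrow>
     linear_map V W f \<and> (\<forall>n. \<forall>A\<in>mats V n. mnorm W (map_mat f A) = mnorm V A)"

definition left_action ::
  "('g, 'k) monoid_scheme \<Rightarrow> ('f::field, 'v::ab_group_add) opsp \<Rightarrow> ('g \<Rightarrow> 'v \<Rightarrow> 'v) \<Rightarrow> bool" where
  "left_action G V a \<longleftrightarrow>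
     (\<forall>g\<in>carrier G. complete_isometry V V (a g)) \<and>
     (\<forall>v\<in>carrier V. a \<one>\<^bsub>G\<^esub> v = v) \<and>
     (\<forall>g\<in>carrier G. \<forall>k\<in>carrier G. \<forall>v\<in>carrier V. a (g \<otimes>\<^bsub>G\<^esub> k) v = a g (a k v))"

text \<open>In a right action \<open>b\<close>, the vector \<open>b g v\<close> is \<open>v g\<close>.\<close>

definition right_action ::
  "('g, 'k) monoid_scheme \<Rightarrow> ('f::field, 'v::ab_group_add) opsp \<Rightarrow> ('g \<Rightarrow> 'v \<Rightarrow> 'v) \<Rightarrow> bool" where
  "right_action G V b \<longleftrightarrow>
     (\<forall>g\<in>carrier G. complete_isometry V V (b g)) \<and>
     (\<forall>v\<in>carrier V. b \<one>\<^bsub>G\<^esub> v = v) \<and>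
     (\<forall>g\<in>carrier G. \<forall>k\<in>carrier G. \<forall>v\<in>carrier V. b (g \<otimes>\<^bsub>G\<^esub> k) v = b k (b g v))"

definition ergodic_on :: "'g set \<Rightarrow> ('f, 'v::zero, 'm) fspace_scheme \<Rightarrow> ('g \<Rightarrow> 'v \<Rightarrow> 'v) \<Rightarrow> bool" where
  "ergodic_on K V a \<longleftrightarrow> (\<forall>v\<in>carrier V. (\<forall>k\<in>K. a k v = v) \<longrightarrow> v = 0)"

text \<open>
  HOL cannot quantify over types inside a formula: the type argument fixes the type in which the
  representing Hilbert space is sought.
\<close>

definition modular_operator_space ::
  "'h::ab_group_add itself \<Rightarrow> ('g, 'k) monoid_scheme \<Rightarrow> ('f::real_or_complex, 'y::ab_group_add) opsp
    \<Rightarrow> ('g \<Rightarrow> 'y \<Rightarrow> 'y) \<Rightarrow> ('g \<Rightarrow> 'y \<Rightarrow> 'y) \<Rightarrow> bool" where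
  "modular_operator_space _ G Y l r \<longleftrightarrow>
     operator_space Y \<and> left_action G Y l \<and> right_action G Y r \<and>
     (\<exists>(\<H> :: ('f, 'h) hilb) \<rho> \<theta>.
        hilbert_space \<H> \<and> complete_isometry Y (bounded_ops \<H>) \<rho> \<and> unitary_rep G \<H> \<theta> \<and>
        (\<forall>g\<in>carrier G. \<forall>y\<in>carrier Y. \<rho> (l g y) = \<theta> g \<circ> \<rho> y \<and> \<rho> (r g y) = \<rho> y \<circ> \<theta> g))"

definition central_representation ::
  "('g, 'k) monoid_scheme \<Rightarrow> ('f::real_or_complex, 'x::ab_group_add) opsp \<Rightarrow> ('g \<Rightarrow> 'x \<Rightarrow> 'x)
    \<Rightarrow> ('f, 'h::ab_group_add) hilb \<Rightarrow> ('x \<Rightarrow> 'h \<Rightarrow> 'h) \<Rightarrow> ('g \<Rightarrow> 'h \<Rightarrow> 'h) \<Rightarrow> bool" where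
  "central_representation H X a \<H> \<rho> \<theta> \<longleftrightarrow>
     hilbert_space \<H> \<and> complete_isometry X (bounded_ops \<H>) \<rho> \<and> unitary_rep H \<H> \<theta> \<and>
     (\<forall>h\<in>carrier H. \<forall>x\<in>carrier X. \<rho> (a h x) = \<theta> h \<circ> \<rho> x \<and> \<rho> (a h x) = \<rho> x \<circ> \<theta> h)"

definition central_modular_operator_space ::
  "'h::ab_group_add itself \<Rightarrow> ('g, 'k) monoid_scheme \<Rightarrow> ('f::real_or_complex, 'x::ab_group_add) opsp
    \<Rightarrow> ('g \<Rightarrow> 'x \<Rightarrow> 'x) \<Rightarrow> bool" where
  "central_modular_operator_space _ H X a \<longleftrightarrow>
     operator_space X \<and> left_action H X a \<and>
     (\<exists>(\<H> :: ('f, 'h) hilb) \<rho> \<theta>. central_representation H X a \<H> \<rho> \<theta>)"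


section \<open>Balanced groups of automorphisms and aligned spaces\<close>

definition group_center :: "('g, 'k) monoid_scheme \<Rightarrow> 'g set" where
  "group_center G = {z \<in> carrier G. \<forall>g\<in>carrier G. z \<otimes>\<^bsub>G\<^esub> g = g \<otimes>\<^bsub>G\<^esub> z}"

definition auto_fixing :: "('g, 'k) monoid_scheme \<Rightarrow> 'g set \<Rightarrow> ('g \<Rightarrow> 'g) set" where
  "auto_fixing G H = {\<sigma> \<in> auto G. \<forall>h\<in>H. \<sigma> h = h}"

definition inner_auto :: "('g, 'k) monoid_scheme \<Rightarrow> 'g \<Rightarrow> 'g \<Rightarrow> 'g" where
  "inner_auto G g = (\<lambda>k\<in>carrier G. g \<otimes>\<^bsub>G\<^esub> k \<otimes>\<^bsub>G\<^esub> inv\<^bsub>G\<^esub> g)"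

definition admissible :: "('g, 'k) monoid_scheme \<Rightarrow> 'g set \<Rightarrow> ('g \<Rightarrow> 'g) set \<Rightarrow> bool" where
  "admissible G H \<Gamma> \<longleftrightarrow> (\<forall>g\<in>carrier G - H. H \<subseteq> {inv\<^bsub>G\<^esub> g \<otimes>\<^bsub>G\<^esub> \<sigma> g | \<sigma>. \<sigma> \<in> \<Gamma>})"

definition displacement :: "('g, 'k) monoid_scheme \<Rightarrow> ('g \<Rightarrow> 'g) \<Rightarrow> 'g set" where
  "displacement G \<sigma> = {inv\<^bsub>G\<^esub> g \<otimes>\<^bsub>G\<^esub> \<sigma> g | g. g \<in> carrier G}"

definition balanced :: "('g, 'k) monoid_scheme \<Rightarrow> 'g set \<Rightarrow> ('g \<Rightarrow> 'g) set \<Rightarrow> bool" where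
  "balanced G H \<Gamma> \<longleftrightarrow>
     subgroup \<Gamma> (AutoGroup G) \<and> \<Gamma> \<subseteq> auto_fixing G H \<and>
     admissible G H \<Gamma> \<and>
     inner_auto G ` carrier G \<subseteq> \<Gamma> \<and>
     (\<forall>\<sigma>\<in>\<Gamma>. subgroup (displacement G \<sigma>) G)"

definition aligned ::
  "('g, 'k) monoid_scheme \<Rightarrow> 'g set \<Rightarrow> ('g \<Rightarrow> 'g) set \<Rightarrow> ('f::field, 'y::ab_group_add) opsp
    \<Rightarrow> ('g \<Rightarrow> 'y \<Rightarrow> 'y) \<Rightarrow> ('g \<Rightarrow> 'y \<Rightarrow> 'y) \<Rightarrow> bool" where
  "aligned G H \<Gamma> Y l r \<longleftrightarrow>
     ergodic_on H Y l \<and>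
     (\<forall>\<sigma>\<in>\<Gamma>. \<sigma> \<noteq> \<one>\<^bsub>AutoGroup G\<^esub> \<longrightarrow> ergodic_on (displacement G \<sigma>) Y l) \<and>
     (\<exists>s. left_action (AutoGroup G\<lparr>carrier := \<Gamma>\<rparr>) Y s \<and>
        (\<forall>\<sigma>\<in>\<Gamma>. \<forall>g\<in>carrier G. \<forall>y\<in>carrier Y. s \<sigma> (l g y) = l (\<sigma> g) (s \<sigma> y)) \<and>
        (\<forall>g\<in>carrier G. \<forall>y\<in>carrier Y. s (inner_auto G g) y = r (inv\<^bsub>G\<^esub> g) (l g y)))"


section \<open>The induced space\<close>

text \<open>
  Functions on \<open>carrier G\<close> are represented by functions on the type that vanish outside
  \<open>carrier G\<close>; these form a linear subspace of the function type.
\<close>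

definition equivariant_maps ::
  "('g, 'k) monoid_scheme \<Rightarrow> 'g set \<Rightarrow> 'v::zero set \<Rightarrow> ('g \<Rightarrow> 'v \<Rightarrow> 'v) \<Rightarrow> ('g \<Rightarrow> 'v) set" where
  "equivariant_maps G H S a =
     {\<phi>. (\<forall>g. g \<notin> carrier G \<longrightarrow> \<phi> g = 0) \<and> (\<forall>g\<in>carrier G. \<phi> g \<in> S) \<and>
         (\<forall>g\<in>carrier G. \<forall>h\<in>H. \<phi> (g \<otimes>\<^bsub>G\<^esub> h) = a (inv\<^bsub>G\<^esub> h) (\<phi> g))}"

definition induced_hilb ::
  "('g, 'k) monoid_scheme \<Rightarrow> 'g set \<Rightarrow> ('f::real_or_complex, 'h::ab_group_add) hilb
    \<Rightarrow> ('g \<Rightarrow> 'h \<Rightarrow> 'h) \<Rightarrow> ('f, 'g \<Rightarrow> 'h) hilb" where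
  "induced_hilb G H \<H> \<theta> =
     \<lparr>carrier = equivariant_maps G H (carrier \<H>) \<theta>,
      scl = (\<lambda>c \<xi> g. scl \<H> c (\<xi> g)),
      ip = (\<lambda>\<xi> \<eta>. \<Sum>g\<in>carrier G. ip \<H> (\<xi> g) (\<eta> g))\<rparr>"

text \<open>
  The operator \<open>\<II>(\<psi>)\<close> for \<open>\<psi> = \<rho> \<circ> \<phi>\<close>, extended by zero outside \<open>\<H>\<^sub>G\<close> as required by
  \<open>bounded_ops\<close>.
\<close>

definition conv_op ::
  "('g, 'k) monoid_scheme \<Rightarrow> 'g set \<Rightarrow> ('f::real_or_complex, 'h::ab_group_add) hilb
    \<Rightarrow> ('g \<Rightarrow> 'h \<Rightarrow> 'h) \<Rightarrow> ('g \<Rightarrow> 'h \<Rightarrow> 'h) \<Rightarrow> ('g \<Rightarrow> 'h) \<Rightarrow> ('g \<Rightarrow> 'h)" where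
  "conv_op G H \<H> \<theta> \<psi> \<xi> g =
     (if \<xi> \<in> carrier (induced_hilb G H \<H> \<theta>) \<and> g \<in> carrier G
      then scl \<H> (1 / of_nat (card H)) (\<Sum>k\<in>carrier G. \<psi> k (\<xi> (inv\<^bsub>G\<^esub> k \<otimes>\<^bsub>G\<^esub> g)))
      else 0)"

text \<open>
  \<open>X\<^sub>G\<close>, with the matrix norms pulled back from \<open>B(\<H>\<^sub>G)\<close> along \<open>\<phi> \<mapsto> \<II>(\<rho> \<circ> \<phi>)\<close> for the given
  central representation. Only the matrix norms refer to the representation.
\<close>

definition induced_space ::
  "('g, 'k) monoid_scheme \<Rightarrow> 'g set \<Rightarrow> ('f::real_or_complex, 'x::ab_group_add) opsp
    \<Rightarrow> ('g \<Rightarrow> 'x \<Rightarrow> 'x) \<Rightarrow> ('f, 'h::ab_group_add) hilb \<Rightarrow> ('x \<Rightarrow> 'h \<Rightarrow> 'h) \<Rightarrow> ('g \<Rightarrow> 'h \<Rightarrow> 'h)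
    \<Rightarrow> ('f, 'g \<Rightarrow> 'x) opsp" where
  "induced_space G H X a \<H> \<rho> \<theta> =
     \<lparr>carrier = equivariant_maps G H (carrier X) a,
      scl = (\<lambda>c \<phi> g. scl X c (\<phi> g)),
      mnorm = (\<lambda>A. mnorm (bounded_ops (induced_hilb G H \<H> \<theta>))
                     (map_mat (\<lambda>\<phi>. conv_op G H \<H> \<theta> (\<rho> \<circ> \<phi>)) A))\<rparr>"

definition induced_left :: "('g, 'k) monoid_scheme \<Rightarrow> 'g \<Rightarrow> ('g \<Rightarrow> 'x::zero) \<Rightarrow> 'g \<Rightarrow> 'x" where
  "induced_left G g \<phi> = (\<lambda>k. if k \<in> carrier G then \<phi> (inv\<^bsub>G\<^esub> g \<otimes>\<^bsub>G\<^esub> k) else 0)"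

definition induced_right :: "('g, 'k) monoid_scheme \<Rightarrow> 'g \<Rightarrow> ('g \<Rightarrow> 'x::zero) \<Rightarrow> 'g \<Rightarrow> 'x" where
  "induced_right G g \<phi> = (\<lambda>k. if k \<in> carrier G then \<phi> (k \<otimes>\<^bsub>G\<^esub> inv\<^bsub>G\<^esub> g) else 0)"

end

theory Submission
  imports Defs "HOL-Analysis.L2_Norm"
begin

text \<open>
  The space \<open>X\<close> is the space of fixed points of \<open>\<Gamma>\<close> in \<open>Y\<close>, with the action of \<open>H\<close> inherited
  from \<open>Y\<close>, and the isomorphism \<open>j\<close> (\<open>assemble\<close> below) sends \<open>\<phi>\<close> to
  \<open>(1 / |H|) (\<Sum>\<^sub>g g \<phi>(g))\<close>. Since \<open>\<Gamma>\<close> contains the inner automorphisms, the elements of \<open>X\<close>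
  commute with \<open>G\<close>, which makes \<open>j\<close> equivariant on both sides.

  Two vanishing sums carry the argument. For \<open>g \<notin> H\<close>, admissibility makes the orbit sum
  \<open>\<Sum>\<^sub>\<sigma> \<sigma>(g) y\<close> invariant under \<open>H\<close>, so it is zero by ergodicity (\<open>orbit_sum_zero\<close>); hence
  averaging over \<open>\<Gamma>\<close> recovers \<open>\<phi>\<close> from \<open>j \<phi>\<close> (\<open>orbit_average_assemble\<close>). For \<open>\<sigma> \<noteq> 1\<close>, the sum
  \<open>\<Sum>\<^sub>g g\<^sup>-\<^sup>1 \<sigma>(g) y\<close> is invariant under the displacement group \<open>L\<^sub>\<sigma>\<close>, so it is zero as well
  (\<open>displacement_sum_zero\<close>); hence every \<open>y\<close> is assembled from the averages of the
  \<open>g\<^sup>-\<^sup>1 y\<close> (\<open>assemble_surj\<close>).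

  For the norms, let \<open>\<rho>\<close> be a central representation of \<open>X\<close>. The convolution operator of
  \<open>\<rho> \<circ> \<phi>\<close> has, up to the factor \<open>|H|\<close>, the norm of the block matrix \<open>(\<phi>(g k\<^sup>-\<^sup>1))\<close>, indexed by
  \<open>g\<close> and \<open>k\<close> in \<open>G\<close>, over \<open>X\<close>
  (\<open>bounded_by_conv_op_iff\<close>). This no longer depends on \<open>\<rho>\<close>, so it can be computed in the
  Hilbert space \<open>\<K>\<close> on which \<open>Y\<close> is represented. There the block matrix compresses to \<open>j \<phi>\<close> along
  the vectors \<open>(k\<^sup>-\<^sup>1 \<xi>)\<^sub>k\<close>. Conversely,
  \<open>\<phi>(g k\<^sup>-\<^sup>1) = (1 / |\<Gamma>|) (\<Sum>\<^sub>\<sigma> \<sigma>(g)\<^sup>-\<^sup>1 \<sigma>(j \<phi>) \<sigma>(k))\<close> exhibits it as a compression of the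
  diagonal matrix of all \<open>\<sigma>(j \<phi>)\<close>, whose norm is that of \<open>j \<phi>\<close> because \<open>\<Gamma>\<close> acts by complete
  isometries; the compressing operator is bounded by \<open>orbit_transform_bound\<close>. All
  this holds for matrices of elements (\<open>bounded_by_assemble_iff\<close>, \<open>complete_isometry_assemble\<close>).
\<close>

section \<open>Linear spaces and linear maps\<close>

locale lin_space =
  fixes V :: "('f::field, 'v::ab_group_add, 'm) fspace_scheme"
  assumes linear_space: "linear_space V"
begin

sublocale vs: vector_space "scl V"
  using linear_space by (simp add: linear_space_def)

lemma subspace_carrier: "vs.subspace (carrier V)"
  using linear_space by (simp add: linear_space_def)

lemmas zero_mem [simp] = vs.subspace_0[OF subspace_carrier]
  and add_mem [simp] = vs.subspace_add[OF subspace_carrier]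
  and diff_mem [simp] = vs.subspace_diff[OF subspace_carrier]
  and scl_mem [simp] = vs.subspace_scale[OF subspace_carrier]
  and sum_mem = vs.subspace_sum[OF subspace_carrier]

lemma sum_const_scl: "finite A \<Longrightarrow> (\<Sum>i\<in>A. v) = scl V (of_nat (card A)) v"
  by (induction A rule: finite_induct) (simp_all add: vs.scale_left_distrib)

context
  fixes W :: "('f, 'w::ab_group_add, 'n) fspace_scheme" and f
  assumes f: "linear_map V W f"
begin

lemma linear_map_mem: "v \<in> carrier V \<Longrightarrow> f v \<in> carrier W"
  using f by (auto simp: linear_map_def)

lemma linear_map_add: "v \<in> carrier V \<Longrightarrow> w \<in> carrier V \<Longrightarrow> f (v + w) = f v + f w"
  using f by (auto simp: linear_map_def)

lemma linear_map_scl: "v \<in> carrier V \<Longrightarrow> f (scl V c v) = scl W c (f v)"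
  using f by (auto simp: linear_map_def)

lemma linear_map_0: "f 0 = 0"
  using linear_map_add[of 0 0] by simp

lemma linear_map_diff: "v \<in> carrier V \<Longrightarrow> w \<in> carrier V \<Longrightarrow> f (v - w) = f v - f w"
  using linear_map_add[of "v - w" w] by (simp add: algebra_simps)

lemma linear_map_sum:
  "(\<And>i. i \<in> I \<Longrightarrow> v i \<in> carrier V) \<Longrightarrow> f (\<Sum>i\<in>I. v i) = (\<Sum>i\<in>I. f (v i))"
  by (induction I rule: infinite_finite_induct) (simp_all add: linear_map_0 linear_map_add sum_mem)

end

end

lemma sum_fun_apply: "(\<Sum>i\<in>I. f i) x = (\<Sum>i\<in>I. (f i x :: 'b::comm_monoid_add))"
  by (induction I rule: infinite_finite_induct) auto


section \<open>Inner product spaces\<close>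

lemma norm_conjugate [simp]: "norm (conjugate x) = norm (x :: 'f::real_or_complex)"
proof (cases "x = 0")
  case False
  have "norm x * norm (conjugate x) = norm x * norm x"
    using arg_cong[OF mult_conjugate_self[of x], of norm]
    by (simp add: norm_mult power2_eq_square)
  with False show ?thesis by simp
qed simp

text \<open>The Hilbert space axioms without completeness, which plays no role for the norm estimates.\<close>

locale inner_space =
  fixes \<H> :: "('f::real_or_complex, 'h::ab_group_add) hilb"
  assumes linear: "linear_space \<H>"
    and ip_add: "\<lbrakk>\<xi> \<in> carrier \<H>; \<eta> \<in> carrier \<H>; \<zeta> \<in> carrier \<H>\<rbrakk>
                  \<Longrightarrow> ip \<H> (\<xi> + \<eta>) \<zeta> = ip \<H> \<xi> \<zeta> + ip \<H> \<eta> \<zeta>"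
    and ip_scl: "\<lbrakk>\<xi> \<in> carrier \<H>; \<eta> \<in> carrier \<H>\<rbrakk> \<Longrightarrow> ip \<H> (scl \<H> c \<xi>) \<eta> = c * ip \<H> \<xi> \<eta>"
    and ip_conj: "\<lbrakk>\<xi> \<in> carrier \<H>; \<eta> \<in> carrier \<H>\<rbrakk> \<Longrightarrow> ip \<H> \<eta> \<xi> = conjugate (ip \<H> \<xi> \<eta>)"
    and ip_pos: "\<xi> \<in> carrier \<H> \<Longrightarrow> \<exists>r\<ge>0. ip \<H> \<xi> \<xi> = of_real r"
    and ip_definite: "\<lbrakk>\<xi> \<in> carrier \<H>; ip \<H> \<xi> \<xi> = 0\<rbrakk> \<Longrightarrow> \<xi> = 0"

lemma hilbert_space_imp_inner_space:
  assumes "hilbert_space \<H>"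
  shows "inner_space \<H>"
proof
  note * = assms[unfolded hilbert_space_def]
  from conjunct1[OF *] show "linear_space \<H>" .
  note * = conjunct2[OF *]
  fix \<xi> \<eta> \<zeta> c assume m: "\<xi> \<in> carrier \<H>" "\<eta> \<in> carrier \<H>"
  show "ip \<H> (\<xi> + \<eta>) \<zeta> = ip \<H> \<xi> \<zeta> + ip \<H> \<eta> \<zeta>" if "\<zeta> \<in> carrier \<H>"
    by (rule conjunct1[OF *, rule_format]) (fact m that)+
  note * = conjunct2[OF *]
  show "ip \<H> (scl \<H> c \<xi>) \<eta> = c * ip \<H> \<xi> \<eta>"
    by (rule conjunct1[OF *, rule_format]) (fact m)+
  note * = conjunct2[OF *]
  show "ip \<H> \<eta> \<xi> = conjugate (ip \<H> \<xi> \<eta>)"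
    by (rule conjunct1[OF *, rule_format]) (fact m)+
  note * = conjunct2[OF *]
  show "\<exists>r\<ge>0. ip \<H> \<xi> \<xi> = of_real r"
    by (rule conjunct1[OF *, rule_format]) (fact m)+
  note * = conjunct2[OF *]
  show "\<xi> = 0" if "ip \<H> \<xi> \<xi> = 0"
    by (rule conjunct1[OF *, rule_format]) (fact m that)+
qed

context inner_space
begin

sublocale lin_space \<H>
  using linear by unfold_locales

lemma hnorm_nonneg [simp]: "0 \<le> hnorm \<H> \<xi>"
  by (simp add: hnorm_def)

lemma hnorm_sq: "(hnorm \<H> \<xi>)\<^sup>2 = norm (ip \<H> \<xi> \<xi>)"
  by (simp add: hnorm_def)

lemma ip_self: "\<xi> \<in> carrier \<H> \<Longrightarrow> ip \<H> \<xi> \<xi> = of_real ((hnorm \<H> \<xi>)\<^sup>2)"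
  using ip_pos[of \<xi>] by (auto simp: hnorm_sq)

lemma ip_zero_left [simp]: "\<xi> \<in> carrier \<H> \<Longrightarrow> ip \<H> 0 \<xi> = 0"
  using ip_add[of 0 0 \<xi>] by simp

lemma ip_sum_left:
  "\<lbrakk>\<And>i. i \<in> I \<Longrightarrow> v i \<in> carrier \<H>; \<xi> \<in> carrier \<H>\<rbrakk>
    \<Longrightarrow> ip \<H> (\<Sum>i\<in>I. v i) \<xi> = (\<Sum>i\<in>I. ip \<H> (v i) \<xi>)"
  by (induction I rule: infinite_finite_induct) (simp_all add: ip_add sum_mem)

lemma ip_sum_right:
  assumes "\<And>i. i \<in> I \<Longrightarrow> v i \<in> carrier \<H>" "\<xi> \<in> carrier \<H>"
  shows "ip \<H> \<xi> (\<Sum>i\<in>I. v i) = (\<Sum>i\<in>I. ip \<H> \<xi> (v i))"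
proof (cases "finite I")
  case True
  have "ip \<H> \<xi> (\<Sum>i\<in>I. v i) = conjugate (\<Sum>i\<in>I. ip \<H> (v i) \<xi>)"
    using assms ip_conj[of "\<Sum>i\<in>I. v i" \<xi>] by (simp add: sum_mem ip_sum_left)
  also have "\<dots> = (\<Sum>i\<in>I. ip \<H> \<xi> (v i))"
    using assms by (simp add: sum_conjugate[OF True] ip_conj[of _ \<xi>])
  finally show ?thesis .
qed (use assms ip_conj[of 0 \<xi>] in simp)

lemma hnorm_scl: "\<xi> \<in> carrier \<H> \<Longrightarrow> hnorm \<H> (scl \<H> c \<xi>) = norm c * hnorm \<H> \<xi>"
  using ip_conj[of "scl \<H> c \<xi>" \<xi>]
  by (simp add: hnorm_def ip_scl conjugate_dist_mul norm_mult real_sqrt_mult)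

text \<open>The Cauchy-Schwarz inequality.\<close>

lemma norm_ip_le:
  assumes x: "\<xi> \<in> carrier \<H>" and y: "\<eta> \<in> carrier \<H>"
  shows "norm (ip \<H> \<xi> \<eta>) \<le> hnorm \<H> \<xi> * hnorm \<H> \<eta>"
proof (cases "\<eta> = 0")
  case True
  with x ip_conj[of 0 \<xi>] show ?thesis by simp
next
  case False
  define a where "a = ip \<H> \<xi> \<eta>"
  define p where "p = (hnorm \<H> \<xi>)\<^sup>2"
  define r where "r = (hnorm \<H> \<eta>)\<^sup>2"
  have r: "r > 0"
    using False ip_definite[OF y] ip_self[OF y] by (auto simp: r_def)
  \<comment> \<open>A vector orthogonal to \<open>\<eta>\<close>, whose squared norm is \<open>r\<close> times the defect of the squared inequality.\<close>
  define z where "z = scl \<H> (of_real r) \<xi> + scl \<H> (- a) \<eta>"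
  have z: "z \<in> carrier \<H>" using x y by (simp add: z_def)
  have ipz: "ip \<H> z w = of_real r * ip \<H> \<xi> w - a * ip \<H> \<eta> w" if "w \<in> carrier \<H>" for w
    using that x y by (simp add: z_def ip_add ip_scl del: vs.scale_minus_left)
  have zy: "ip \<H> z \<eta> = 0"
    using ipz[OF y] ip_self[OF y] by (simp add: a_def r_def mult.commute)
  have zx: "ip \<H> z \<xi> = of_real (r * p - (norm a)\<^sup>2)"
    using ipz[OF x] ip_self[OF x] ip_conj[OF x y] mult_conjugate_self[of a]
    by (simp add: a_def p_def)
  have "ip \<H> z z = conjugate (of_real r * ip \<H> \<xi> z - a * ip \<H> \<eta> z)"
    using ipz[OF z] ip_conj[OF z z] by simp
  also have "\<dots> = conjugate (of_real r * ip \<H> \<xi> z)"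
    using ip_conj[OF z y] zy by simp
  also have "\<dots> = conjugate (of_real r) * of_real (r * p - (norm a)\<^sup>2)"
    using ip_conj[OF x z] zx by (simp add: conjugate_dist_mul)
  also have "conjugate (of_real r :: 'f) = of_real r"
    using ip_self[OF y] ip_conj[OF y y] by (simp add: r_def)
  finally have "of_real ((hnorm \<H> z)\<^sup>2) = (of_real (r * (r * p - (norm a)\<^sup>2)) :: 'f)"
    using ip_self[OF z] by simp
  hence "(hnorm \<H> z)\<^sup>2 = r * (r * p - (norm a)\<^sup>2)"
    by (simp only: of_real_eq_iff)
  hence "0 \<le> r * (r * p - (norm a)\<^sup>2)" by (metis zero_le_power2)
  with r have "(norm a)\<^sup>2 \<le> (hnorm \<H> \<xi> * hnorm \<H> \<eta>)\<^sup>2"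
    by (simp add: zero_le_mult_iff p_def r_def power_mult_distrib mult.commute)
  thus ?thesis by (simp add: a_def power2_le_iff_abs_le)
qed

lemma hnorm_zero [simp]: "hnorm \<H> 0 = 0"
  by (simp add: hnorm_def)

lemma hnorm_add_le:
  assumes x: "\<xi> \<in> carrier \<H>" and y: "\<eta> \<in> carrier \<H>"
  shows "hnorm \<H> (\<xi> + \<eta>) \<le> hnorm \<H> \<xi> + hnorm \<H> \<eta>"
proof -
  have "ip \<H> w (\<xi> + \<eta>) = ip \<H> w \<xi> + ip \<H> w \<eta>" if "w \<in> carrier \<H>" for w
    using that x y by (simp add: ip_conj[of _ w] ip_add conjugate_dist_add)
  hence "ip \<H> (\<xi> + \<eta>) (\<xi> + \<eta>) = (ip \<H> \<xi> \<xi> + ip \<H> \<xi> \<eta>) + (ip \<H> \<eta> \<xi> + ip \<H> \<eta> \<eta>)"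
    using x y by (simp add: ip_add)
  hence "norm (ip \<H> (\<xi> + \<eta>) (\<xi> + \<eta>)) \<le>
      (norm (ip \<H> \<xi> \<xi>) + norm (ip \<H> \<xi> \<eta>)) + (norm (ip \<H> \<eta> \<xi>) + norm (ip \<H> \<eta> \<eta>))"
    using norm_triangle_ineq[of "ip \<H> \<xi> \<xi> + ip \<H> \<xi> \<eta>" "ip \<H> \<eta> \<xi> + ip \<H> \<eta> \<eta>"]
      norm_triangle_ineq[of "ip \<H> \<xi> \<xi>" "ip \<H> \<xi> \<eta>"]
      norm_triangle_ineq[of "ip \<H> \<eta> \<xi>" "ip \<H> \<eta> \<eta>"] by simp
  also have "\<dots> \<le> (hnorm \<H> \<xi> + hnorm \<H> \<eta>)\<^sup>2"
    using norm_ip_le[OF x y] norm_ip_le[OF y x]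
    by (simp add: hnorm_sq[symmetric] power2_eq_square algebra_simps)
  finally have "(hnorm \<H> (\<xi> + \<eta>))\<^sup>2 \<le> (hnorm \<H> \<xi> + hnorm \<H> \<eta>)\<^sup>2"
    by (simp add: hnorm_sq)
  thus ?thesis by (rule power2_le_imp_le) simp
qed

lemma hnorm_sum_le:
  "(\<And>i. i \<in> I \<Longrightarrow> v i \<in> carrier \<H>) \<Longrightarrow> hnorm \<H> (\<Sum>i\<in>I. v i) \<le> (\<Sum>i\<in>I. hnorm \<H> (v i))"
proof (induction I rule: infinite_finite_induct)
  case (insert i I)
  have "hnorm \<H> (v i + (\<Sum>i\<in>I. v i)) \<le> hnorm \<H> (v i) + hnorm \<H> (\<Sum>i\<in>I. v i)"
    using insert by (intro hnorm_add_le) (auto intro: sum_mem)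
  thus ?case using insert by fastforce
qed auto

end

lemma sum_mult_sq_le:
  fixes f g :: "'a \<Rightarrow> real"
  shows "(\<Sum>i\<in>A. f i * g i)\<^sup>2 \<le> (\<Sum>i\<in>A. (f i)\<^sup>2) * (\<Sum>i\<in>A. (g i)\<^sup>2)"
proof -
  have "\<bar>\<Sum>i\<in>A. f i * g i\<bar> \<le> (\<Sum>i\<in>A. \<bar>f i\<bar> * \<bar>g i\<bar>)"
    using sum_abs[of "\<lambda>i. f i * g i" A] by (simp add: abs_mult)
  also have "\<dots> \<le> L2_set f A * L2_set g A" by (rule L2_set_mult_ineq)
  finally have "\<bar>\<Sum>i\<in>A. f i * g i\<bar>\<^sup>2 \<le> (L2_set f A * L2_set g A)\<^sup>2"
    by (intro power_mono) auto
  thus ?thesis by (simp add: power_mult_distrib L2_set_def sum_nonneg)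
qed

lemma sum_sq_le:
  fixes f :: "'a \<Rightarrow> real"
  shows "(\<Sum>i\<in>A. f i)\<^sup>2 \<le> of_nat (card A) * (\<Sum>i\<in>A. (f i)\<^sup>2)"
  using sum_mult_sq_le[of "\<lambda>_. 1" f A] by simp


section \<open>Bounds for operator matrices\<close>

text \<open>
  The operator matrix with entries \<open>F i j\<close>, indexed by arbitrary sets, is bounded by \<open>\<bar>C\<bar>\<close>.
  Arbitrary index sets keep block matrices unflattened in the estimates.
\<close>

definition bounded_by ::
  "('f::real_normed_field, 'h::ab_group_add) hilb \<Rightarrow> 'i set \<Rightarrow> 'j set \<Rightarrow> ('i \<Rightarrow> 'j \<Rightarrow> 'h \<Rightarrow> 'h) \<Rightarrow> real \<Rightarrow> bool"
  where
  "bounded_by \<H> I J F C \<longleftrightarrow>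
     (\<forall>\<xi>. (\<forall>j\<in>J. \<xi> j \<in> carrier \<H>) \<longrightarrow>
        (\<Sum>i\<in>I. (hnorm \<H> (\<Sum>j\<in>J. F i j (\<xi> j)))\<^sup>2) \<le> C\<^sup>2 * (\<Sum>j\<in>J. (hnorm \<H> (\<xi> j))\<^sup>2))"

lemma bounded_by_cong:
  assumes "\<And>i j \<xi>. \<lbrakk>i \<in> I; j \<in> J; \<xi> \<in> carrier \<H>\<rbrakk> \<Longrightarrow> F i j \<xi> = F' i j \<xi>"
  shows "bounded_by \<H> I J F C \<longleftrightarrow> bounded_by \<H> I J F' C"
proof -
  have "(\<Sum>i\<in>I. (hnorm \<H> (\<Sum>j\<in>J. F i j (\<xi> j)))\<^sup>2) = (\<Sum>i\<in>I. (hnorm \<H> (\<Sum>j\<in>J. F' i j (\<xi> j)))\<^sup>2)"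
    if "\<forall>j\<in>J. \<xi> j \<in> carrier \<H>" for \<xi>
    using that assms by (intro sum.cong arg_cong[where f = "\<lambda>x. (hnorm \<H> x)\<^sup>2"]) auto
  thus ?thesis by (auto simp: bounded_by_def)
qed

lemma bounded_by_reindex:
  assumes b: "bij_betw b I I'" and c: "bij_betw c J J'"
  shows "bounded_by \<H> I J (\<lambda>i j. F (b i) (c j)) C \<longleftrightarrow> bounded_by \<H> I' J' F C"
proof
  assume L: "bounded_by \<H> I J (\<lambda>i j. F (b i) (c j)) C"
  show "bounded_by \<H> I' J' F C"
    unfolding bounded_by_def
  proof (intro allI impI)
    fix \<xi> assume "\<forall>j\<in>J'. \<xi> j \<in> carrier \<H>"
    hence "\<forall>j\<in>J. \<xi> (c j) \<in> carrier \<H>" using c by (auto simp: bij_betw_def)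
    with L have "(\<Sum>i\<in>I. (hnorm \<H> (\<Sum>j\<in>J. F (b i) (c j) (\<xi> (c j))))\<^sup>2)
        \<le> C\<^sup>2 * (\<Sum>j\<in>J. (hnorm \<H> (\<xi> (c j)))\<^sup>2)"
      unfolding bounded_by_def by (auto dest: spec[of _ "\<lambda>j. \<xi> (c j)"])
    thus "(\<Sum>i\<in>I'. (hnorm \<H> (\<Sum>j\<in>J'. F i j (\<xi> j)))\<^sup>2) \<le> C\<^sup>2 * (\<Sum>j\<in>J'. (hnorm \<H> (\<xi> j))\<^sup>2)"
      by (simp only: sum.reindex_bij_betw[OF b, of "\<lambda>i. (hnorm \<H> (\<Sum>j\<in>J'. F i j (\<xi> j)))\<^sup>2"]
          sum.reindex_bij_betw[OF c, of "\<lambda>j. F _ j (\<xi> j)"]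
          sum.reindex_bij_betw[OF c, of "\<lambda>j. (hnorm \<H> (\<xi> j))\<^sup>2"])
  qed
next
  assume R: "bounded_by \<H> I' J' F C"
  show "bounded_by \<H> I J (\<lambda>i j. F (b i) (c j)) C"
    unfolding bounded_by_def
  proof (intro allI impI)
    fix \<xi> assume \<xi>: "\<forall>j\<in>J. \<xi> j \<in> carrier \<H>"
    define \<eta> where "\<eta> = (\<lambda>j. \<xi> (inv_into J c j))"
    have \<eta>: "\<eta> (c j) = \<xi> j" if "j \<in> J" for j
      using that c by (simp add: \<eta>_def bij_betw_def inv_into_f_f)
    have "\<forall>j\<in>J'. \<eta> j \<in> carrier \<H>"
      using c \<xi> \<eta> by (auto simp: bij_betw_def)
    with R have "(\<Sum>i\<in>I'. (hnorm \<H> (\<Sum>j\<in>J'. F i j (\<eta> j)))\<^sup>2) \<le> C\<^sup>2 * (\<Sum>j\<in>J'. (hnorm \<H> (\<eta> j))\<^sup>2)"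
      unfolding bounded_by_def by blast
    hence "(\<Sum>i\<in>I. (hnorm \<H> (\<Sum>j\<in>J. F (b i) (c j) (\<eta> (c j))))\<^sup>2)
        \<le> C\<^sup>2 * (\<Sum>j\<in>J. (hnorm \<H> (\<eta> (c j)))\<^sup>2)"
      by (simp only: sum.reindex_bij_betw[OF b, of "\<lambda>i. (hnorm \<H> (\<Sum>j\<in>J'. F i j (\<eta> j)))\<^sup>2"]
          sum.reindex_bij_betw[OF c, of "\<lambda>j. F _ j (\<eta> j)"]
          sum.reindex_bij_betw[OF c, of "\<lambda>j. (hnorm \<H> (\<eta> j))\<^sup>2"])
    thus "(\<Sum>i\<in>I. (hnorm \<H> (\<Sum>j\<in>J. F (b i) (c j) (\<xi> j)))\<^sup>2) \<le> C\<^sup>2 * (\<Sum>j\<in>J. (hnorm \<H> (\<xi> j))\<^sup>2)"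
      by (simp add: \<eta> cong: sum.cong)
  qed
qed

lemma complete_isometry_linear: "complete_isometry V W f \<Longrightarrow> linear_map V W f"
  by (simp add: complete_isometry_def)

lemma complete_isometryI:
  "\<lbrakk>linear_map V W f; \<And>n A. A \<in> mats V n \<Longrightarrow> mnorm W (map_mat f A) = mnorm V A\<rbrakk>
    \<Longrightarrow> complete_isometry V W f"
  unfolding complete_isometry_def by blast

lemma complete_isometry_mnorm:
  "\<lbrakk>complete_isometry V W f; A \<in> mats V n\<rbrakk> \<Longrightarrow> mnorm W (map_mat f A) = mnorm V A"
  unfolding complete_isometry_def by blast

lemma mats_iff:
  "A \<in> mats V n \<longleftrightarrow> A \<in> carrier_mat n n \<and> (\<forall>i<n. \<forall>j<n. A $$ (i, j) \<in> carrier V)"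
  unfolding mats_def using elements_matI[of A n n] by (fastforce dest!: elements_matD)

lemma mats_entry: "\<lbrakk>A \<in> mats V n; i < n; j < n\<rbrakk> \<Longrightarrow> A $$ (i, j) \<in> carrier V"
  by (simp add: mats_iff)

context inner_space
begin

text \<open>
  As a supremum of reals, \<open>opnorm\<close> is meaningful only for a matrix that is known to be bounded;
  hence the hypothesis with the bound \<open>B\<close>.
\<close>

lemma opnorm_le_iff:
  fixes A :: "('h \<Rightarrow> 'h) mat"
  defines "I \<equiv> {..<dim_row A}" and "J \<equiv> {..<dim_col A}"
  assumes lin: "\<And>i j. \<lbrakk>i \<in> I; j \<in> J\<rbrakk> \<Longrightarrow> linear_map \<H> \<H> (A $$ (i, j))"
    and ex: "bounded_by \<H> I J (\<lambda>i j. A $$ (i, j)) B"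
  shows "opnorm \<H> A \<le> C \<longleftrightarrow> 0 \<le> C \<and> bounded_by \<H> I J (\<lambda>i j. A $$ (i, j)) C"
proof -
  define S where "S \<xi> = (\<Sum>i\<in>I. (hnorm \<H> (\<Sum>j\<in>J. (A $$ (i, j)) (\<xi> j)))\<^sup>2)" for \<xi>
  define N where "N \<xi> = (\<Sum>j\<in>J. (hnorm \<H> (\<xi> j))\<^sup>2)" for \<xi> :: "nat \<Rightarrow> 'h"
  define T where "T = {sqrt (S \<xi>) | \<xi>. (\<forall>j\<in>J. \<xi> j \<in> carrier \<H>) \<and> N \<xi> \<le> 1}"
  have opn: "opnorm \<H> A = Sup T"
    by (simp add: opnorm_def T_def S_def N_def I_def J_def Ball_def)
  have bb: "bounded_by \<H> I J (\<lambda>i j. A $$ (i, j)) D \<longleftrightarrow>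
      (\<forall>\<xi>. (\<forall>j\<in>J. \<xi> j \<in> carrier \<H>) \<longrightarrow> S \<xi> \<le> D\<^sup>2 * N \<xi>)" for D
    by (simp add: bounded_by_def S_def N_def)
  have N0: "0 \<le> N \<xi>" for \<xi> by (simp add: N_def sum_nonneg)
  have S0: "0 \<le> S \<xi>" for \<xi> by (simp add: S_def sum_nonneg)
  have Tle: "t \<le> \<bar>D\<bar>" if "bounded_by \<H> I J (\<lambda>i j. A $$ (i, j)) D" "t \<in> T" for D t
  proof -
    from that(2) obtain \<xi> where \<xi>: "t = sqrt (S \<xi>)" "\<forall>j\<in>J. \<xi> j \<in> carrier \<H>" "N \<xi> \<le> 1"
      by (auto simp: T_def)
    have "S \<xi> \<le> D\<^sup>2 * N \<xi>" using that(1) \<xi> bb by blast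
    also have "\<dots> \<le> D\<^sup>2 * 1" using \<xi> by (intro mult_left_mono) auto
    finally have "S \<xi> \<le> D\<^sup>2" by simp
    hence "sqrt (S \<xi>) \<le> sqrt (D\<^sup>2)" by (rule real_sqrt_le_mono)
    thus ?thesis using \<xi> by simp
  qed
  have "sqrt (S (\<lambda>_. 0)) \<in> T"
    by (force simp: T_def N_def)
  hence ne: "T \<noteq> {}" by blast
  have bdd: "bdd_above T"
    using Tle[OF ex] by (auto simp: bdd_above_def)
  have "0 \<le> sqrt (S (\<lambda>_. 0))" using S0 by simp
  also have "\<dots> \<le> opnorm \<H> A"
    unfolding opn by (rule cSup_upper[OF \<open>sqrt (S (\<lambda>_. 0)) \<in> T\<close> bdd])
  finally have nonneg: "0 \<le> opnorm \<H> A" .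
  show ?thesis
  proof
    assume C: "0 \<le> C \<and> bounded_by \<H> I J (\<lambda>i j. A $$ (i, j)) C"
    from Tle[OF conjunct2[OF C]] C show "opnorm \<H> A \<le> C"
      unfolding opn by (intro cSup_least[OF ne]) auto
  next
    assume le: "opnorm \<H> A \<le> C"
    have "bounded_by \<H> I J (\<lambda>i j. A $$ (i, j)) C"
      unfolding bb
    proof (intro allI impI)
      fix \<xi> :: "nat \<Rightarrow> 'h" assume \<xi>: "\<forall>j\<in>J. \<xi> j \<in> carrier \<H>"
      show "S \<xi> \<le> C\<^sup>2 * N \<xi>"
      proof (cases "N \<xi> = 0")
        case True
        have "S \<xi> \<le> B\<^sup>2 * N \<xi>" using ex \<xi> unfolding bb by blast
        with True show ?thesis by simp
      next
        case False
        define t where "t = 1 / sqrt (N \<xi>)"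
        have t: "t > 0" "t\<^sup>2 = 1 / N \<xi>"
          using False N0[of \<xi>] by (auto simp: t_def power_divide)
        define \<eta> where "\<eta> = (\<lambda>j. scl \<H> (of_real t) (\<xi> j))"
        have \<eta>: "\<forall>j\<in>J. \<eta> j \<in> carrier \<H>" using \<xi> by (simp add: \<eta>_def)
        have "N \<eta> = t\<^sup>2 * N \<xi>"
          using \<xi> t by (simp add: N_def \<eta>_def hnorm_scl power_mult_distrib sum_distrib_left)
        hence "N \<eta> \<le> 1" using False t by simp
        with \<eta> have "sqrt (S \<eta>) \<in> T" by (auto simp: T_def)
        hence "sqrt (S \<eta>) \<le> C" using cSup_upper[OF _ bdd] le opn by (metis order_trans)
        hence "S \<eta> \<le> C\<^sup>2" by (rule sqrt_le_D)
        moreover have "S \<eta> = t\<^sup>2 * S \<xi>"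
        proof -
          have "(hnorm \<H> (\<Sum>j\<in>J. (A $$ (i, j)) (\<eta> j)))\<^sup>2
              = t\<^sup>2 * (hnorm \<H> (\<Sum>j\<in>J. (A $$ (i, j)) (\<xi> j)))\<^sup>2" if i: "i \<in> I" for i
          proof -
            have "(\<Sum>j\<in>J. (A $$ (i, j)) (\<eta> j)) = scl \<H> (of_real t) (\<Sum>j\<in>J. (A $$ (i, j)) (\<xi> j))"
              using \<xi> linear_map_scl[OF lin[OF i]]
              by (simp add: \<eta>_def vs.scale_sum_right)
            moreover have "(\<Sum>j\<in>J. (A $$ (i, j)) (\<xi> j)) \<in> carrier \<H>"
              using \<xi> linear_map_mem[OF lin[OF i]] by (intro sum_mem) auto
            ultimately show ?thesis using t by (simp add: hnorm_scl power_mult_distrib)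
          qed
          thus ?thesis by (simp add: S_def sum_distrib_left)
        qed
        ultimately show ?thesis using t False N0[of \<xi>] by (simp add: field_simps)
      qed
    qed
    with nonneg le show "0 \<le> C \<and> bounded_by \<H> I J (\<lambda>i j. A $$ (i, j)) C" by simp
  qed
qed

lemma bounded_ops_linear: "T \<in> carrier (bounded_ops \<H>) \<Longrightarrow> linear_map \<H> \<H> T"
  by (simp add: bounded_ops_def)

lemma bounded_ops_bounded_by:
  assumes "finite I" "finite J"
    and F: "\<And>i j. \<lbrakk>i \<in> I; j \<in> J\<rbrakk> \<Longrightarrow> F i j \<in> carrier (bounded_ops \<H>)"
  shows "\<exists>B. bounded_by \<H> I J F B"
proof -
  have "\<exists>C. \<forall>i\<in>I. \<forall>j\<in>J. \<forall>\<xi>\<in>carrier \<H>. hnorm \<H> (F i j \<xi>) \<le> C i j * hnorm \<H> \<xi>"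
  proof -
    have "\<forall>i\<in>I. \<forall>j\<in>J. \<exists>C. \<forall>\<xi>\<in>carrier \<H>. hnorm \<H> (F i j \<xi>) \<le> C * hnorm \<H> \<xi>"
      using F by (simp add: bounded_ops_def)
    thus ?thesis by metis
  qed
  then obtain C where C: "\<And>i j \<xi>. \<lbrakk>i \<in> I; j \<in> J; \<xi> \<in> carrier \<H>\<rbrakk> \<Longrightarrow> hnorm \<H> (F i j \<xi>) \<le> C i j * hnorm \<H> \<xi>"
    by blast
  define B where "B = sqrt (\<Sum>i\<in>I. \<Sum>j\<in>J. (C i j)\<^sup>2)"
  have "bounded_by \<H> I J F B"
    unfolding bounded_by_def
  proof (intro allI impI)
    fix \<xi> assume \<xi>: "\<forall>j\<in>J. \<xi> j \<in> carrier \<H>"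
    have "(hnorm \<H> (\<Sum>j\<in>J. F i j (\<xi> j)))\<^sup>2 \<le> (\<Sum>j\<in>J. (C i j)\<^sup>2) * (\<Sum>j\<in>J. (hnorm \<H> (\<xi> j))\<^sup>2)"
      if i: "i \<in> I" for i
    proof -
      have "hnorm \<H> (\<Sum>j\<in>J. F i j (\<xi> j)) \<le> (\<Sum>j\<in>J. hnorm \<H> (F i j (\<xi> j)))"
        using \<xi> linear_map_mem[OF bounded_ops_linear[OF F[OF i]]] by (intro hnorm_sum_le) auto
      also have "\<dots> \<le> (\<Sum>j\<in>J. C i j * hnorm \<H> (\<xi> j))"
        using \<xi> C[OF i] by (intro sum_mono) auto
      finally have "(hnorm \<H> (\<Sum>j\<in>J. F i j (\<xi> j)))\<^sup>2 \<le> (\<Sum>j\<in>J. C i j * hnorm \<H> (\<xi> j))\<^sup>2"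
        by (intro power_mono) auto
      also note sum_mult_sq_le
      finally show ?thesis .
    qed
    hence "(\<Sum>i\<in>I. (hnorm \<H> (\<Sum>j\<in>J. F i j (\<xi> j)))\<^sup>2)
        \<le> (\<Sum>i\<in>I. (\<Sum>j\<in>J. (C i j)\<^sup>2) * (\<Sum>j\<in>J. (hnorm \<H> (\<xi> j))\<^sup>2))"
      by (rule sum_mono)
    also have "\<dots> = B\<^sup>2 * (\<Sum>j\<in>J. (hnorm \<H> (\<xi> j))\<^sup>2)"
      by (simp add: B_def sum_nonneg flip: sum_distrib_right)
    finally show "(\<Sum>i\<in>I. (hnorm \<H> (\<Sum>j\<in>J. F i j (\<xi> j)))\<^sup>2) \<le> B\<^sup>2 * (\<Sum>j\<in>J. (hnorm \<H> (\<xi> j))\<^sup>2)" .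
  qed
  thus ?thesis ..
qed

text \<open>The matrix norms of a represented space, as least bounds.\<close>

lemma mnorm_le_iff:
  assumes \<pi>: "complete_isometry V (bounded_ops \<H>) \<pi>" and A: "A \<in> mats V n"
  shows "mnorm V A \<le> C \<longleftrightarrow> 0 \<le> C \<and> bounded_by \<H> {..<n} {..<n} (\<lambda>i j. \<pi> (A $$ (i, j))) C"
proof -
  from A have dim: "dim_row A = n" "dim_col A = n" by (auto simp: mats_def)
  have ops: "\<pi> (A $$ (i, j)) \<in> carrier (bounded_ops \<H>)" if "i < n" "j < n" for i j
    using mats_entry[OF A that] \<pi> by (auto simp: complete_isometry_def linear_map_def)
  obtain B where B: "bounded_by \<H> {..<n} {..<n} (\<lambda>i j. \<pi> (A $$ (i, j))) B"
    using bounded_ops_bounded_by[of "{..<n}" "{..<n}" "\<lambda>i j. \<pi> (A $$ (i, j))"] ops by auto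
  have "mnorm V A = opnorm \<H> (map_mat \<pi> A)"
    using \<pi> A by (simp add: complete_isometry_def bounded_ops_def)
  moreover have "bounded_by \<H> {..<n} {..<n} (\<lambda>i j. map_mat \<pi> A $$ (i, j)) D
      \<longleftrightarrow> bounded_by \<H> {..<n} {..<n} (\<lambda>i j. \<pi> (A $$ (i, j))) D" for D
    using dim by (intro bounded_by_cong) simp
  ultimately show ?thesis
    using opnorm_le_iff[of "map_mat \<pi> A" B C] B ops bounded_ops_linear dim by simp
qed

end

section \<open>Groups and unitary representations\<close>

locale central_subgroup = group G for G :: "('g, 'k) monoid_scheme" (structure) +
  fixes H :: "'g set"
  assumes finite_carrier: "finite (carrier G)"
    and subgroup_H: "subgroup H G"
    and H_central: "H \<subseteq> group_center G"
begin

lemma H_mem [simp]: "h \<in> H \<Longrightarrow> h \<in> carrier G"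
  using subgroup.mem_carrier[OF subgroup_H] .

lemma H_one [simp]: "\<one> \<in> H"
  using subgroup.one_closed[OF subgroup_H] .

lemma H_inv [simp]: "h \<in> H \<Longrightarrow> inv h \<in> H"
  using subgroup.m_inv_closed[OF subgroup_H] .

lemma H_mult [simp]: "h \<in> H \<Longrightarrow> k \<in> H \<Longrightarrow> h \<otimes> k \<in> H"
  using subgroup.m_closed[OF subgroup_H] .

lemma H_comm: "h \<in> H \<Longrightarrow> g \<in> carrier G \<Longrightarrow> h \<otimes> g = g \<otimes> h"
  using H_central by (auto simp: group_center_def)

lemma finite_H: "finite H"
  using finite_carrier finite_subset[OF subgroup.subset[OF subgroup_H]] by blast

lemma card_H_pos: "card H > 0"
  using finite_H H_one by (metis card_gt_0_iff empty_iff)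

lemma card_carrier_pos: "card (carrier G) > 0"
  using finite_carrier one_closed by (metis card_gt_0_iff empty_iff)

lemma inv_mult_cancel [simp]:
  assumes "g \<in> carrier G" "k \<in> carrier G"
  shows "inv g \<otimes> (g \<otimes> k) = k" "g \<otimes> (inv g \<otimes> k) = k" "k \<otimes> inv g \<otimes> g = k" "k \<otimes> g \<otimes> inv g = k"
  using assms by (simp_all add: m_assoc m_assoc[symmetric, of "inv g" g] m_assoc[symmetric, of g "inv g"])

lemma sum_mult_left: "g \<in> carrier G \<Longrightarrow> (\<Sum>k\<in>carrier G. f (g \<otimes> k)) = (\<Sum>k\<in>carrier G. f k)"
  by (rule sum.reindex_bij_witness[of _ "\<lambda>k. inv g \<otimes> k" "\<lambda>k. g \<otimes> k"]) auto

lemma sum_mult_right: "g \<in> carrier G \<Longrightarrow> (\<Sum>k\<in>carrier G. f (k \<otimes> g)) = (\<Sum>k\<in>carrier G. f k)"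
  by (rule sum.reindex_bij_witness[of _ "\<lambda>k. k \<otimes> inv g" "\<lambda>k. k \<otimes> g"]) auto

lemma sum_inv: "(\<Sum>k\<in>carrier G. f (inv k)) = (\<Sum>k\<in>carrier G. f k)"
  by (rule sum.reindex_bij_witness[of _ "\<lambda>k. inv k" "\<lambda>k. inv k"]) auto

lemma sum_H_mult_left: "h \<in> H \<Longrightarrow> (\<Sum>k\<in>H. f (h \<otimes> k)) = (\<Sum>k\<in>H. f k)"
  by (rule sum.reindex_bij_witness[of _ "\<lambda>k. inv h \<otimes> k" "\<lambda>k. h \<otimes> k"]) auto

lemma sum_H_inv: "(\<Sum>k\<in>H. f (inv k)) = (\<Sum>k\<in>H. f k)"
  by (rule sum.reindex_bij_witness[of _ "\<lambda>k. inv k" "\<lambda>k. inv k"]) auto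

end

locale unitary_representation = inner_space \<H>
  for \<H> :: "('f::real_or_complex, 'h::ab_group_add) hilb" +
  fixes K :: "('g, 'k) monoid_scheme" (structure) and \<theta> :: "'g \<Rightarrow> 'h \<Rightarrow> 'h"
  assumes group_K: "group K"
    and unitary_rep: "unitary_rep K \<H> \<theta>"
begin

lemma rep_linear: "g \<in> carrier K \<Longrightarrow> linear_map \<H> \<H> (\<theta> g)"
  using unitary_rep by (simp add: unitary_rep_def unitary_op_def bounded_ops_def)

lemma rep_mem [simp]: "g \<in> carrier K \<Longrightarrow> \<xi> \<in> carrier \<H> \<Longrightarrow> \<theta> g \<xi> \<in> carrier \<H>"
  using linear_map_mem[OF rep_linear] .

lemma rep_mult: "g \<in> carrier K \<Longrightarrow> k \<in> carrier K \<Longrightarrow> \<theta> (g \<otimes> k) \<xi> = \<theta> g (\<theta> k \<xi>)"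
  using unitary_rep by (simp add: unitary_rep_def)

lemma rep_ip: "\<lbrakk>g \<in> carrier K; \<xi> \<in> carrier \<H>; \<eta> \<in> carrier \<H>\<rbrakk> \<Longrightarrow> ip \<H> (\<theta> g \<xi>) (\<theta> g \<eta>) = ip \<H> \<xi> \<eta>"
  using unitary_rep by (simp add: unitary_rep_def unitary_op_def)

lemma rep_hnorm [simp]: "g \<in> carrier K \<Longrightarrow> \<xi> \<in> carrier \<H> \<Longrightarrow> hnorm \<H> (\<theta> g \<xi>) = hnorm \<H> \<xi>"
  by (simp add: hnorm_def rep_ip)

text \<open>
  That \<open>\<theta> \<one>\<close> is the identity is not part of the definition of a unitary representation: it
  holds because \<open>\<theta> \<one>\<close> is idempotent and surjective.
\<close>

lemma rep_one [simp]:
  assumes "\<xi> \<in> carrier \<H>"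
  shows "\<theta> \<one> \<xi> = \<xi>"
proof -
  interpret group K by (rule group_K)
  have "\<xi> \<in> \<theta> \<one> ` carrier \<H>"
    using unitary_rep assms by (simp add: unitary_rep_def unitary_op_def)
  then obtain \<eta> where "\<xi> = \<theta> \<one> \<eta>" by blast
  with rep_mult[of \<one> \<one> \<eta>] show ?thesis by simp
qed

end


section \<open>The induced Hilbert space and convolution operators\<close>

locale induced_representation =
  central_subgroup G H + unitary_representation \<H> "G\<lparr>carrier := H\<rparr>" \<theta>
  for G :: "('g, 'k) monoid_scheme" (structure) and H
    and \<H> :: "('f::real_or_complex, 'h::ab_group_add) hilb" and \<theta> :: "'g \<Rightarrow> 'h \<Rightarrow> 'h"
begin

text \<open>The induced Hilbert space \<open>\<H>\<^sub>G\<close>.\<close>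

abbreviation ind where "ind \<equiv> induced_hilb G H \<H> \<theta>"

lemma rep_lin_H: "h \<in> H \<Longrightarrow> linear_map \<H> \<H> (\<theta> h)"
  using rep_linear[of h] by simp

lemma rep_mem_H [simp]: "h \<in> H \<Longrightarrow> \<xi> \<in> carrier \<H> \<Longrightarrow> \<theta> h \<xi> \<in> carrier \<H>"
  using rep_mem[of h] by simp

lemma rep_mult_H: "g \<in> H \<Longrightarrow> k \<in> H \<Longrightarrow> \<theta> (g \<otimes> k) \<xi> = \<theta> g (\<theta> k \<xi>)"
  using rep_mult[of g k] by simp

lemma rep_hnorm_H [simp]: "h \<in> H \<Longrightarrow> \<xi> \<in> carrier \<H> \<Longrightarrow> hnorm \<H> (\<theta> h \<xi>) = hnorm \<H> \<xi>"
  using rep_hnorm[of h] by simp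

lemma ind_carrier_iff:
  "\<xi> \<in> carrier ind \<longleftrightarrow> (\<forall>g. g \<notin> carrier G \<longrightarrow> \<xi> g = 0) \<and> (\<forall>g\<in>carrier G. \<xi> g \<in> carrier \<H>) \<and>
     (\<forall>g\<in>carrier G. \<forall>h\<in>H. \<xi> (g \<otimes> h) = \<theta> (inv h) (\<xi> g))"
  by (simp add: induced_hilb_def equivariant_maps_def)

lemma ind_mem [simp]: "\<xi> \<in> carrier ind \<Longrightarrow> g \<in> carrier G \<Longrightarrow> \<xi> g \<in> carrier \<H>"
  by (simp add: ind_carrier_iff)

lemma ind_scl: "scl ind c \<xi> g = scl \<H> c (\<xi> g)"
  by (simp add: induced_hilb_def)

lemma ind_ip: "ip ind \<xi> \<eta> = (\<Sum>g\<in>carrier G. ip \<H> (\<xi> g) (\<eta> g))"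
  by (simp add: induced_hilb_def)

lemma inner_space_ind: "inner_space ind"
proof
  have "vector_space (scl ind)"
    by unfold_locales
      (simp_all add: fun_eq_iff ind_scl vs.scale_right_distrib vs.scale_left_distrib)
  moreover have "module.subspace (scl ind) (carrier ind)"
  proof -
    interpret ind: vector_space "scl ind" by fact
    show ?thesis
      unfolding ind.subspace_def
      by (auto simp: ind_carrier_iff ind_scl linear_map_0[OF rep_lin_H] linear_map_add[OF rep_lin_H]
          linear_map_scl[OF rep_lin_H])
  qed
  ultimately show "linear_space ind" by (simp add: linear_space_def)
next
  fix \<xi> \<eta> \<zeta> assume "\<xi> \<in> carrier ind" "\<eta> \<in> carrier ind" "\<zeta> \<in> carrier ind"
  thus "ip ind (\<xi> + \<eta>) \<zeta> = ip ind \<xi> \<zeta> + ip ind \<eta> \<zeta>"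
    by (simp add: ind_ip ip_add sum.distrib)
next
  fix \<xi> \<eta> c assume "\<xi> \<in> carrier ind" "\<eta> \<in> carrier ind"
  thus "ip ind (scl ind c \<xi>) \<eta> = c * ip ind \<xi> \<eta>"
    by (simp add: ind_ip ind_scl ip_scl sum_distrib_left)
next
  fix \<xi> \<eta> assume "\<xi> \<in> carrier ind" "\<eta> \<in> carrier ind"
  hence "ip \<H> (\<eta> g) (\<xi> g) = conjugate (ip \<H> (\<xi> g) (\<eta> g))" if "g \<in> carrier G" for g
    using that by (intro ip_conj) simp_all
  thus "ip ind \<eta> \<xi> = conjugate (ip ind \<xi> \<eta>)"
    by (simp add: ind_ip sum_conjugate[OF finite_carrier])
next
  fix \<xi> assume \<xi>: "\<xi> \<in> carrier ind"
  hence *: "ip ind \<xi> \<xi> = of_real (\<Sum>g\<in>carrier G. (hnorm \<H> (\<xi> g))\<^sup>2)"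
    by (simp add: ind_ip ip_self)
  show "\<exists>r\<ge>0. ip ind \<xi> \<xi> = of_real r"
    unfolding * by (rule exI[of _ "\<Sum>g\<in>carrier G. (hnorm \<H> (\<xi> g))\<^sup>2"]) (simp add: sum_nonneg)
  assume "ip ind \<xi> \<xi> = 0"
  hence "(\<Sum>g\<in>carrier G. (hnorm \<H> (\<xi> g))\<^sup>2) = 0" using * by (metis of_real_eq_0_iff)
  hence "\<forall>g\<in>carrier G. (hnorm \<H> (\<xi> g))\<^sup>2 = 0"
    using finite_carrier by (simp add: sum_nonneg_eq_0_iff)
  hence "\<xi> g = 0" if "g \<in> carrier G" for g
    using that ip_definite[OF ind_mem[OF \<xi> that]] ip_self[OF ind_mem[OF \<xi> that]] by simp
  moreover have "\<xi> g = 0" if "g \<notin> carrier G" for g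
    using \<xi> that unfolding ind_carrier_iff by blast
  ultimately show "\<xi> = 0" by (intro ext) (metis zero_fun_apply)
qed

lemma hnorm_ind:
  assumes "\<xi> \<in> carrier ind"
  shows "(hnorm ind \<xi>)\<^sup>2 = (\<Sum>g\<in>carrier G. (hnorm \<H> (\<xi> g))\<^sup>2)"
proof -
  have "ip ind \<xi> \<xi> = of_real (\<Sum>g\<in>carrier G. (hnorm \<H> (\<xi> g))\<^sup>2)"
    using assms by (simp add: ind_ip ip_self)
  thus ?thesis by (simp only: inner_space.hnorm_sq[OF inner_space_ind] norm_of_real) (simp add: sum_nonneg)
qed

text \<open>Operator-valued functions of the form \<open>\<rho> \<circ> \<phi>\<close> for an equivariant \<open>\<phi>\<close>.\<close>

definition equivariant_ops :: "('g \<Rightarrow> 'h \<Rightarrow> 'h) \<Rightarrow> bool" where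
  "equivariant_ops \<psi> \<longleftrightarrow>
     (\<forall>g\<in>carrier G. linear_map \<H> \<H> (\<psi> g)) \<and>
     (\<forall>g\<in>carrier G. \<forall>h\<in>H. \<forall>\<xi>\<in>carrier \<H>.
        \<psi> (g \<otimes> h) \<xi> = \<psi> g (\<theta> (inv h) \<xi>) \<and> \<theta> (inv h) (\<psi> g \<xi>) = \<psi> g (\<theta> (inv h) \<xi>))"

context
  fixes \<psi> assumes \<psi>: "equivariant_ops \<psi>"
begin

lemma equivariant_ops_linear: "g \<in> carrier G \<Longrightarrow> linear_map \<H> \<H> (\<psi> g)"
  using \<psi> by (simp add: equivariant_ops_def)

lemma equivariant_ops_mem [simp]: "g \<in> carrier G \<Longrightarrow> \<xi> \<in> carrier \<H> \<Longrightarrow> \<psi> g \<xi> \<in> carrier \<H>"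
  using linear_map_mem[OF equivariant_ops_linear] .

lemma equivariant_ops_commute:
  assumes "g \<in> carrier G" "h \<in> H" "\<xi> \<in> carrier \<H>"
  shows "\<theta> h (\<psi> g \<xi>) = \<psi> g (\<theta> h \<xi>)"
proof -
  have "\<theta> (inv (inv h)) (\<psi> g \<xi>) = \<psi> g (\<theta> (inv (inv h)) \<xi>)"
    using \<psi> assms H_inv[of h] unfolding equivariant_ops_def by blast
  thus ?thesis using assms by simp
qed

lemma equivariant_ops_shift:
  assumes "g \<in> carrier G" "h \<in> H" "\<xi> \<in> carrier \<H>"
  shows "\<psi> g (\<theta> h \<xi>) = \<psi> (g \<otimes> inv h) \<xi>"
proof -
  have "\<psi> (g \<otimes> inv h) \<xi> = \<psi> g (\<theta> (inv (inv h)) \<xi>)"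
    using \<psi> assms H_inv[of h] unfolding equivariant_ops_def by blast
  thus ?thesis using assms by simp
qed

lemma conv_op_eq:
  assumes "\<xi> \<in> carrier ind" "g \<in> carrier G"
  shows "conv_op G H \<H> \<theta> \<psi> \<xi> g
    = scl \<H> (1 / of_nat (card H)) (\<Sum>k\<in>carrier G. \<psi> (g \<otimes> inv k) (\<xi> k))"
proof -
  have "(\<Sum>k\<in>carrier G. \<psi> k (\<xi> (inv k \<otimes> g))) = (\<Sum>k\<in>carrier G. \<psi> (g \<otimes> inv k) (\<xi> k))"
    using assms(2)
    by (intro sum.reindex_bij_witness[of _ "\<lambda>k. g \<otimes> inv k" "\<lambda>k. inv k \<otimes> g"])
      (auto simp: inv_mult_group m_assoc)
  thus ?thesis using assms by (simp add: conv_op_def)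
qed

lemma conv_op_linear: "linear_map ind ind (conv_op G H \<H> \<theta> \<psi>)"
proof -
  interpret ind: inner_space ind by (rule inner_space_ind)
  let ?T = "conv_op G H \<H> \<theta> \<psi>"
  have "?T \<xi> \<in> carrier ind" if \<xi>: "\<xi> \<in> carrier ind" for \<xi>
  proof -
    have "?T \<xi> (g \<otimes> h) = \<theta> (inv h) (?T \<xi> g)" if g: "g \<in> carrier G" and h: "h \<in> H" for g h
    proof -
      have "\<psi> k (\<xi> (inv k \<otimes> (g \<otimes> h))) = \<theta> (inv h) (\<psi> k (\<xi> (inv k \<otimes> g)))" if k: "k \<in> carrier G" for k
      proof -
        have "\<xi> (inv k \<otimes> (g \<otimes> h)) = \<theta> (inv h) (\<xi> (inv k \<otimes> g))"
          using \<xi> g h k by (simp add: ind_carrier_iff m_assoc[symmetric])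
        thus ?thesis using \<xi> g h k by (simp add: equivariant_ops_commute)
      qed
      thus ?thesis
        using \<xi> g h
        by (simp add: conv_op_def linear_map_scl[OF rep_lin_H] linear_map_sum[OF rep_lin_H] sum_mem)
    qed
    thus ?thesis using \<xi> by (auto simp: ind_carrier_iff conv_op_eq sum_mem) (simp add: conv_op_def)
  qed
  moreover have "?T (\<xi> + \<eta>) = ?T \<xi> + ?T \<eta>" if "\<xi> \<in> carrier ind" "\<eta> \<in> carrier ind" for \<xi> \<eta>
  proof
    fix g
    show "?T (\<xi> + \<eta>) g = (?T \<xi> + ?T \<eta>) g"
      using that ind.add_mem[OF that]
      by (cases "g \<in> carrier G")
       (simp_all add: conv_op_eq linear_map_add[OF equivariant_ops_linear] sum.distrib
          vs.scale_right_distrib, simp add: conv_op_def)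
  qed
  moreover have "?T (scl ind c \<xi>) = scl ind c (?T \<xi>)" if "\<xi> \<in> carrier ind" for \<xi> c
  proof
    fix g
    show "?T (scl ind c \<xi>) g = scl ind c (?T \<xi>) g"
      using that ind.scl_mem[OF that, of c]
      by (cases "g \<in> carrier G")
       (simp_all add: conv_op_eq ind_scl linear_map_scl[OF equivariant_ops_linear]
          vs.scale_sum_right mult.commute, simp add: conv_op_def)
  qed
  ultimately show ?thesis by (auto simp: linear_map_def)
qed

end

text \<open>
  A matrix of convolution operators on \<open>\<H>\<^sub>G\<close> has, up to the factor \<open>card H\<close>, the norm of the block
  matrix with entries \<open>\<psi> i j (g k\<^sup>-\<^sup>1)\<close>. The latter acts on all families indexed by \<open>G\<close>, and
  it factors through the averages \<open>\<eta>\<close> below, which make up the equivariant families.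
\<close>

lemma bounded_by_conv_op_iff:
  fixes \<psi> :: "'i \<Rightarrow> 'j \<Rightarrow> 'g \<Rightarrow> 'h \<Rightarrow> 'h"
  assumes fin: "finite I" "finite J"
    and \<psi>: "\<And>i j. \<lbrakk>i \<in> I; j \<in> J\<rbrakk> \<Longrightarrow> equivariant_ops (\<psi> i j)"
  shows "bounded_by ind I J (\<lambda>i j. conv_op G H \<H> \<theta> (\<psi> i j)) C \<longleftrightarrow>
    bounded_by \<H> (I \<times> carrier G) (J \<times> carrier G)
      (\<lambda>p q. \<psi> (fst p) (fst q) (snd p \<otimes> inv (snd q))) (of_nat (card H) * C)"
    (is "?L \<longleftrightarrow> ?R")
proof -
  interpret ind: inner_space ind by (rule inner_space_ind)
  define m :: real where "m = of_nat (card H)"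
  have m: "m > 0" using card_H_pos by (simp add: m_def)
  define T where "T \<xi> i g = (\<Sum>q\<in>J \<times> carrier G. \<psi> i (fst q) (g \<otimes> inv (snd q)) (\<xi> q))" for \<xi> i g
  have T_mem: "T \<xi> i g \<in> carrier \<H>"
    if "\<forall>q\<in>J \<times> carrier G. \<xi> q \<in> carrier \<H>" "i \<in> I" "g \<in> carrier G" for \<xi> i g
    unfolding T_def using that by (intro sum_mem) (auto intro!: equivariant_ops_mem[OF \<psi>])
  have T_eq: "T \<xi> i g = (\<Sum>j\<in>J. \<Sum>k\<in>carrier G. \<psi> i j (g \<otimes> inv k) (\<xi> (j, k)))" for \<xi> i g
    by (simp add: T_def sum.cartesian_product')
  \<comment> \<open>On equivariant families, the block matrix is \<open>m\<close> times the matrix of convolution operators.\<close>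
  have conv: "m\<^sup>2 * (\<Sum>i\<in>I. (hnorm ind (\<Sum>j\<in>J. conv_op G H \<H> \<theta> (\<psi> i j) (\<xi> j)))\<^sup>2)
      = (\<Sum>i\<in>I. \<Sum>g\<in>carrier G. (hnorm \<H> (T (\<lambda>q. \<xi> (fst q) (snd q)) i g))\<^sup>2)"
    if \<xi>: "\<forall>j\<in>J. \<xi> j \<in> carrier ind" for \<xi>
  proof -
    have "m\<^sup>2 * (hnorm ind (\<Sum>j\<in>J. conv_op G H \<H> \<theta> (\<psi> i j) (\<xi> j)))\<^sup>2
        = (\<Sum>g\<in>carrier G. (hnorm \<H> (T (\<lambda>q. \<xi> (fst q) (snd q)) i g))\<^sup>2)" if i: "i \<in> I" for i
    proof -
      have mem: "(\<Sum>j\<in>J. conv_op G H \<H> \<theta> (\<psi> i j) (\<xi> j)) \<in> carrier ind"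
        using \<xi> ind.linear_map_mem[OF conv_op_linear[OF \<psi>[OF i]]] by (intro ind.sum_mem) auto
      have "m\<^sup>2 * (hnorm \<H> ((\<Sum>j\<in>J. conv_op G H \<H> \<theta> (\<psi> i j) (\<xi> j)) g))\<^sup>2
          = (hnorm \<H> (T (\<lambda>q. \<xi> (fst q) (snd q)) i g))\<^sup>2" if g: "g \<in> carrier G" for g
      proof -
        have "(\<Sum>j\<in>J. conv_op G H \<H> \<theta> (\<psi> i j) (\<xi> j)) g
            = scl \<H> (1 / of_nat (card H)) (T (\<lambda>q. \<xi> (fst q) (snd q)) i g)"
          using \<xi> i g by (simp add: sum_fun_apply conv_op_eq[OF \<psi>] T_eq vs.scale_sum_right)
        thus ?thesis
          using T_mem[of "\<lambda>q. \<xi> (fst q) (snd q)" i g] \<xi> i g m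
          by (auto simp: hnorm_scl norm_divide power_mult_distrib power_divide m_def)
      qed
      thus ?thesis by (simp add: hnorm_ind[OF mem] sum_distrib_left)
    qed
    thus ?thesis by (simp add: sum_distrib_left)
  qed
  have ind_sum: "(\<Sum>j\<in>J. (hnorm ind (\<xi> j))\<^sup>2) = (\<Sum>j\<in>J. \<Sum>k\<in>carrier G. (hnorm \<H> (\<xi> j k))\<^sup>2)"
    if "\<forall>j\<in>J. \<xi> j \<in> carrier ind" for \<xi>
    using that by (simp add: hnorm_ind)
  have R_iff: "?R \<longleftrightarrow> (\<forall>\<xi>. (\<forall>q\<in>J \<times> carrier G. \<xi> q \<in> carrier \<H>) \<longrightarrow>
      (\<Sum>i\<in>I. \<Sum>g\<in>carrier G. (hnorm \<H> (T \<xi> i g))\<^sup>2)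
        \<le> (m * C)\<^sup>2 * (\<Sum>j\<in>J. \<Sum>k\<in>carrier G. (hnorm \<H> (\<xi> (j, k)))\<^sup>2))"
    unfolding bounded_by_def T_def m_def by (simp add: sum.cartesian_product')
  show ?thesis
  proof
    assume R: ?R
    show ?L
      unfolding bounded_by_def
    proof (intro allI impI)
      fix \<xi> assume \<xi>: "\<forall>j\<in>J. \<xi> j \<in> carrier ind"
      hence "\<forall>q\<in>J \<times> carrier G. \<xi> (fst q) (snd q) \<in> carrier \<H>" by auto
      with R have "m\<^sup>2 * (\<Sum>i\<in>I. (hnorm ind (\<Sum>j\<in>J. conv_op G H \<H> \<theta> (\<psi> i j) (\<xi> j)))\<^sup>2)
          \<le> m\<^sup>2 * (C\<^sup>2 * (\<Sum>j\<in>J. (hnorm ind (\<xi> j))\<^sup>2))"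
        unfolding R_iff conv[OF \<xi>] ind_sum[OF \<xi>]
        by (auto dest!: spec[of _ "\<lambda>q. \<xi> (fst q) (snd q)"] simp: power_mult_distrib mult.assoc)
      thus "(\<Sum>i\<in>I. (hnorm ind (\<Sum>j\<in>J. conv_op G H \<H> \<theta> (\<psi> i j) (\<xi> j)))\<^sup>2)
          \<le> C\<^sup>2 * (\<Sum>j\<in>J. (hnorm ind (\<xi> j))\<^sup>2)"
        using m by simp
    qed
  next
    assume L: ?L
    show ?R
      unfolding R_iff
    proof (intro allI impI)
      fix \<xi> assume \<xi>: "\<forall>q\<in>J \<times> carrier G. \<xi> q \<in> carrier \<H>"
      \<comment> \<open>Up to a factor, the projection onto the equivariant families; \<open>T\<close> factors through it.\<close>
      define \<eta> where "\<eta> j k = (if k \<in> carrier G then \<Sum>h\<in>H. \<theta> h (\<xi> (j, k \<otimes> h)) else 0)" for j k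
      have \<eta>: "\<eta> j \<in> carrier ind" if j: "j \<in> J" for j
      proof -
        have "\<eta> j (g \<otimes> h) = \<theta> (inv h) (\<eta> j g)" if g: "g \<in> carrier G" and h: "h \<in> H" for g h
        proof -
          have "\<eta> j (g \<otimes> h) = (\<Sum>k\<in>H. \<theta> (inv h \<otimes> (h \<otimes> k)) (\<xi> (j, g \<otimes> (h \<otimes> k))))"
            using g h by (simp add: \<eta>_def m_assoc)
          also have "\<dots> = (\<Sum>k\<in>H. \<theta> (inv h \<otimes> k) (\<xi> (j, g \<otimes> k)))"
            using h by (rule sum_H_mult_left)
          also have "\<dots> = \<theta> (inv h) (\<eta> j g)"
            using g h j \<xi> by (simp add: \<eta>_def rep_mult_H linear_map_sum[OF rep_lin_H])
          finally show ?thesis .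
        qed
        thus ?thesis using j \<xi> by (auto simp: ind_carrier_iff \<eta>_def intro!: sum_mem)
      qed
      have T\<eta>: "T (\<lambda>q. \<eta> (fst q) (snd q)) i g = scl \<H> (of_nat (card H)) (T \<xi> i g)"
        if i: "i \<in> I" and g: "g \<in> carrier G" for i g
      proof -
        have "(\<Sum>k\<in>carrier G. \<psi> i j (g \<otimes> inv k) (\<eta> j k))
            = scl \<H> (of_nat (card H)) (\<Sum>k\<in>carrier G. \<psi> i j (g \<otimes> inv k) (\<xi> (j, k)))"
          if j: "j \<in> J" for j
        proof -
          have "\<psi> i j (g \<otimes> inv k) (\<eta> j k)
              = (\<Sum>h\<in>H. \<psi> i j (g \<otimes> inv (k \<otimes> h)) (\<xi> (j, k \<otimes> h)))" if k: "k \<in> carrier G" for k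
          proof -
            have "\<psi> i j (g \<otimes> inv k) (\<eta> j k) = (\<Sum>h\<in>H. \<psi> i j (g \<otimes> inv k) (\<theta> h (\<xi> (j, k \<otimes> h))))"
              using i j g k \<xi>
              by (simp add: \<eta>_def linear_map_sum[OF equivariant_ops_linear[OF \<psi>]])
            also have "\<dots> = (\<Sum>h\<in>H. \<psi> i j (g \<otimes> inv (k \<otimes> h)) (\<xi> (j, k \<otimes> h)))"
            proof (rule sum.cong[OF refl])
              fix h assume h: "h \<in> H"
              have "inv (k \<otimes> h) = inv k \<otimes> inv h"
                using h k H_comm[of "inv h" "inv k"] by (simp add: inv_mult_group)
              thus "\<psi> i j (g \<otimes> inv k) (\<theta> h (\<xi> (j, k \<otimes> h))) = \<psi> i j (g \<otimes> inv (k \<otimes> h)) (\<xi> (j, k \<otimes> h))"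
                using i j g k h \<xi> by (simp add: equivariant_ops_shift[OF \<psi>] m_assoc)
            qed
            finally show ?thesis .
          qed
          hence "(\<Sum>k\<in>carrier G. \<psi> i j (g \<otimes> inv k) (\<eta> j k))
              = (\<Sum>h\<in>H. \<Sum>k\<in>carrier G. \<psi> i j (g \<otimes> inv (k \<otimes> h)) (\<xi> (j, k \<otimes> h)))"
            by (simp add: sum.swap[of _ H])
          also have "\<dots> = (\<Sum>h\<in>H. \<Sum>k\<in>carrier G. \<psi> i j (g \<otimes> inv k) (\<xi> (j, k)))"
            by (intro sum.cong sum_mult_right[where f = "\<lambda>k. \<psi> i j (g \<otimes> inv k) (\<xi> (j, k))"]) simp_all
          finally show ?thesis by (simp add: sum_const_scl[OF finite_H])
        qed
        thus ?thesis by (simp add: T_eq vs.scale_sum_right)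
      qed
      have "(\<Sum>j\<in>J. (hnorm ind (\<eta> j))\<^sup>2) = (\<Sum>j\<in>J. \<Sum>k\<in>carrier G. (hnorm \<H> (\<eta> j k))\<^sup>2)"
        using \<eta> by (simp add: ind_sum)
      also have "\<dots> \<le> (\<Sum>j\<in>J. m\<^sup>2 * (\<Sum>k\<in>carrier G. (hnorm \<H> (\<xi> (j, k)))\<^sup>2))"
      proof (rule sum_mono)
        fix j assume j: "j \<in> J"
        have "(hnorm \<H> (\<eta> j k))\<^sup>2 \<le> m * (\<Sum>h\<in>H. (hnorm \<H> (\<xi> (j, k \<otimes> h)))\<^sup>2)"
          if k: "k \<in> carrier G" for k
        proof -
          have "hnorm \<H> (\<eta> j k) \<le> (\<Sum>h\<in>H. hnorm \<H> (\<theta> h (\<xi> (j, k \<otimes> h))))"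
            unfolding \<eta>_def if_P[OF k] using k j \<xi> by (intro hnorm_sum_le) auto
          also have "\<dots> = (\<Sum>h\<in>H. hnorm \<H> (\<xi> (j, k \<otimes> h)))"
            using k j \<xi> by simp
          finally have "(hnorm \<H> (\<eta> j k))\<^sup>2 \<le> (\<Sum>h\<in>H. hnorm \<H> (\<xi> (j, k \<otimes> h)))\<^sup>2"
            by (intro power_mono) auto
          also note sum_sq_le
          finally show ?thesis by (simp add: m_def)
        qed
        hence "(\<Sum>k\<in>carrier G. (hnorm \<H> (\<eta> j k))\<^sup>2)
            \<le> (\<Sum>k\<in>carrier G. m * (\<Sum>h\<in>H. (hnorm \<H> (\<xi> (j, k \<otimes> h)))\<^sup>2))"
          by (rule sum_mono)
        also have "\<dots> = m * (\<Sum>h\<in>H. \<Sum>k\<in>carrier G. (hnorm \<H> (\<xi> (j, k \<otimes> h)))\<^sup>2)"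
          by (simp add: sum.swap[of _ H] flip: sum_distrib_left)
        also have "(\<Sum>h\<in>H. \<Sum>k\<in>carrier G. (hnorm \<H> (\<xi> (j, k \<otimes> h)))\<^sup>2)
            = (\<Sum>h\<in>H. \<Sum>k\<in>carrier G. (hnorm \<H> (\<xi> (j, k)))\<^sup>2)"
          by (intro sum.cong sum_mult_right[where f = "\<lambda>k. (hnorm \<H> (\<xi> (j, k)))\<^sup>2"]) simp_all
        finally show "(\<Sum>k\<in>carrier G. (hnorm \<H> (\<eta> j k))\<^sup>2)
            \<le> m\<^sup>2 * (\<Sum>k\<in>carrier G. (hnorm \<H> (\<xi> (j, k)))\<^sup>2)"
          by (simp add: m_def power2_eq_square)
      qed
      finally have \<eta>_le: "(\<Sum>j\<in>J. (hnorm ind (\<eta> j))\<^sup>2)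
          \<le> m\<^sup>2 * (\<Sum>j\<in>J. \<Sum>k\<in>carrier G. (hnorm \<H> (\<xi> (j, k)))\<^sup>2)"
        by (simp only: sum_distrib_left)
      have "m\<^sup>2 * (\<Sum>i\<in>I. \<Sum>g\<in>carrier G. (hnorm \<H> (T \<xi> i g))\<^sup>2)
          = (\<Sum>i\<in>I. \<Sum>g\<in>carrier G. (hnorm \<H> (T (\<lambda>q. \<eta> (fst q) (snd q)) i g))\<^sup>2)"
        using \<xi> T_mem by (simp add: T\<eta> hnorm_scl power_mult_distrib m_def sum_distrib_left)
      also have "\<dots> = m\<^sup>2 * (\<Sum>i\<in>I. (hnorm ind (\<Sum>j\<in>J. conv_op G H \<H> \<theta> (\<psi> i j) (\<eta> j)))\<^sup>2)"
        using conv[of \<eta>] \<eta> by simp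
      also have "\<dots> \<le> m\<^sup>2 * (C\<^sup>2 * (\<Sum>j\<in>J. (hnorm ind (\<eta> j))\<^sup>2))"
        using L \<eta> unfolding bounded_by_def by (intro mult_left_mono) auto
      also have "\<dots> \<le> m\<^sup>2 * (C\<^sup>2 * (m\<^sup>2 * (\<Sum>j\<in>J. \<Sum>k\<in>carrier G. (hnorm \<H> (\<xi> (j, k)))\<^sup>2)))"
        by (intro mult_left_mono \<eta>_le) auto
      also have "\<dots> = m\<^sup>2 * ((m * C)\<^sup>2 * (\<Sum>j\<in>J. \<Sum>k\<in>carrier G. (hnorm \<H> (\<xi> (j, k)))\<^sup>2))"
        by (simp only: power_mult_distrib mult_ac)
      finally show "(\<Sum>i\<in>I. \<Sum>g\<in>carrier G. (hnorm \<H> (T \<xi> i g))\<^sup>2)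
          \<le> (m * C)\<^sup>2 * (\<Sum>j\<in>J. \<Sum>k\<in>carrier G. (hnorm \<H> (\<xi> (j, k)))\<^sup>2)"
        using m by simp
    qed
  qed
qed

end

section \<open>Balanced groups of automorphisms\<close>

locale balanced_pair = central_subgroup G H for G :: "('g, 'k) monoid_scheme" (structure) and H +
  fixes \<Gamma> :: "('g \<Rightarrow> 'g) set"
  assumes balanced: "balanced G H \<Gamma>"
begin

lemma subgroup_\<Gamma>: "subgroup \<Gamma> (AutoGroup G)"
  using balanced by (simp add: balanced_def)

lemma \<Gamma>_auto: "\<sigma> \<in> \<Gamma> \<Longrightarrow> \<sigma> \<in> auto G"
  using balanced by (auto simp: balanced_def auto_fixing_def)

lemma \<Gamma>_Bij: "\<sigma> \<in> \<Gamma> \<Longrightarrow> \<sigma> \<in> Bij (carrier G)"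
  using \<Gamma>_auto by (auto simp: auto_def)

lemma \<Gamma>_mem [simp]: "\<sigma> \<in> \<Gamma> \<Longrightarrow> g \<in> carrier G \<Longrightarrow> \<sigma> g \<in> carrier G"
  using Bij_imp_funcset[OF \<Gamma>_Bij] by auto

lemma \<Gamma>_mult: "\<sigma> \<in> \<Gamma> \<Longrightarrow> g \<in> carrier G \<Longrightarrow> k \<in> carrier G \<Longrightarrow> \<sigma> (g \<otimes> k) = \<sigma> g \<otimes> \<sigma> k"
  using \<Gamma>_auto by (auto simp: auto_def hom_def)

lemma \<Gamma>_inv: "\<sigma> \<in> \<Gamma> \<Longrightarrow> g \<in> carrier G \<Longrightarrow> \<sigma> (inv g) = inv (\<sigma> g)"
  using \<Gamma>_auto[of \<sigma>] group_hom.hom_inv[of G G \<sigma> g] is_group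
  by (simp add: auto_def group_hom_def group_hom_axioms_def)

lemma \<Gamma>_H [simp]: "\<sigma> \<in> \<Gamma> \<Longrightarrow> h \<in> H \<Longrightarrow> \<sigma> h = h"
  using balanced by (auto simp: balanced_def auto_fixing_def)

lemma inner_auto_\<Gamma> [simp]: "g \<in> carrier G \<Longrightarrow> inner_auto G g \<in> \<Gamma>"
  using balanced by (auto simp: balanced_def)

lemma finite_\<Gamma>: "finite \<Gamma>"
proof (rule finite_subset)
  show "\<Gamma> \<subseteq> carrier G \<rightarrow>\<^sub>E carrier G"
    using Bij_imp_extensional[OF \<Gamma>_Bij] Bij_imp_funcset[OF \<Gamma>_Bij] by (auto simp: PiE_def)
  show "finite (carrier G \<rightarrow>\<^sub>E carrier G)"
    using finite_carrier by (intro finite_PiE) auto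
qed

lemma group_Auto: "group (AutoGroup G)"
  by (rule AutoGroup)

lemma one_\<Gamma> [simp]: "\<one>\<^bsub>AutoGroup G\<^esub> \<in> \<Gamma>"
  using subgroup.one_closed[OF subgroup_\<Gamma>] .

lemma card_\<Gamma>_pos: "card \<Gamma> > 0"
  using finite_\<Gamma> one_\<Gamma> by (metis card_gt_0_iff empty_iff)

lemma one_Auto: "\<one>\<^bsub>AutoGroup G\<^esub> = (\<lambda>g\<in>carrier G. g)"
  by (simp add: AutoGroup_def BijGroup_def)

lemma mult_\<Gamma> [simp]: "\<sigma> \<in> \<Gamma> \<Longrightarrow> \<tau> \<in> \<Gamma> \<Longrightarrow> \<sigma> \<otimes>\<^bsub>AutoGroup G\<^esub> \<tau> \<in> \<Gamma>"
  using subgroup.m_closed[OF subgroup_\<Gamma>] .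

lemma inv_\<Gamma>: "\<sigma> \<in> \<Gamma> \<Longrightarrow> inv\<^bsub>AutoGroup G\<^esub> \<sigma> \<in> \<Gamma>"
  using subgroup.m_inv_closed[OF subgroup_\<Gamma>] .

lemma mult_\<Gamma>_apply: "\<lbrakk>\<sigma> \<in> \<Gamma>; \<tau> \<in> \<Gamma>; g \<in> carrier G\<rbrakk> \<Longrightarrow> (\<sigma> \<otimes>\<^bsub>AutoGroup G\<^esub> \<tau>) g = \<sigma> (\<tau> g)"
  by (simp add: AutoGroup_def BijGroup_def \<Gamma>_Bij compose_def)

lemma carrier_\<Gamma>: "\<sigma> \<in> \<Gamma> \<Longrightarrow> \<sigma> \<in> carrier (AutoGroup G)"
  using \<Gamma>_auto by (simp add: AutoGroup_def)

lemma sum_\<Gamma>_mult_right: 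
  assumes "\<tau> \<in> \<Gamma>"
  shows "(\<Sum>\<sigma>\<in>\<Gamma>. f (\<sigma> \<otimes>\<^bsub>AutoGroup G\<^esub> \<tau>)) = (\<Sum>\<sigma>\<in>\<Gamma>. f \<sigma>)"
proof -
  interpret A: group "AutoGroup G" by (rule group_Auto)
  show ?thesis
    using assms inv_\<Gamma>[OF assms] carrier_\<Gamma>
    by (intro sum.reindex_bij_witness[of _ "\<lambda>\<sigma>. \<sigma> \<otimes>\<^bsub>AutoGroup G\<^esub> inv\<^bsub>AutoGroup G\<^esub> \<tau>"
          "\<lambda>\<sigma>. \<sigma> \<otimes>\<^bsub>AutoGroup G\<^esub> \<tau>"]) (auto simp: A.m_assoc)
qed

lemma sum_\<Gamma>_mult_left: 
  assumes "\<tau> \<in> \<Gamma>"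
  shows "(\<Sum>\<sigma>\<in>\<Gamma>. f (\<tau> \<otimes>\<^bsub>AutoGroup G\<^esub> \<sigma>)) = (\<Sum>\<sigma>\<in>\<Gamma>. f \<sigma>)"
proof -
  interpret A: group "AutoGroup G" by (rule group_Auto)
  show ?thesis
    using assms inv_\<Gamma>[OF assms] carrier_\<Gamma>
    by (intro sum.reindex_bij_witness[of _ "\<lambda>\<sigma>. inv\<^bsub>AutoGroup G\<^esub> \<tau> \<otimes>\<^bsub>AutoGroup G\<^esub> \<sigma>"
          "\<lambda>\<sigma>. \<tau> \<otimes>\<^bsub>AutoGroup G\<^esub> \<sigma>"]) (auto simp: A.m_assoc[symmetric])
qed

text \<open>
  By admissibility some \<open>\<tau> \<in> \<Gamma>\<close> maps \<open>g\<close> to \<open>g h\<close>, so the orbit sum of \<open>g\<close> is invariant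
  under \<open>H\<close>.
\<close>

lemma sum_\<Gamma>_H_shift:
  assumes g: "g \<in> carrier G - H" and h: "h \<in> H"
  shows "(\<Sum>\<sigma>\<in>\<Gamma>. f (h \<otimes> \<sigma> g)) = (\<Sum>\<sigma>\<in>\<Gamma>. f (\<sigma> g))"
proof -
  have "admissible G H \<Gamma>" using balanced by (simp add: balanced_def)
  with g h have "h \<in> {inv g \<otimes> \<sigma> g | \<sigma>. \<sigma> \<in> \<Gamma>}"
    unfolding admissible_def by (meson subsetD)
  then obtain \<tau> where \<tau>: "\<tau> \<in> \<Gamma>" "h = inv g \<otimes> \<tau> g" by blast
  hence \<tau>g: "\<tau> g = g \<otimes> h" using g by simp
  have "h \<otimes> \<sigma> g = (\<sigma> \<otimes>\<^bsub>AutoGroup G\<^esub> \<tau>) g" if \<sigma>: "\<sigma> \<in> \<Gamma>" for \<sigma>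
    using \<sigma> \<tau>(1) \<tau>g g h H_comm[OF h, of "\<sigma> g"] by (simp add: mult_\<Gamma>_apply \<Gamma>_mult)
  hence "(\<Sum>\<sigma>\<in>\<Gamma>. f (h \<otimes> \<sigma> g)) = (\<Sum>\<sigma>\<in>\<Gamma>. f ((\<sigma> \<otimes>\<^bsub>AutoGroup G\<^esub> \<tau>) g))"
    by simp
  also have "\<dots> = (\<Sum>\<sigma>\<in>\<Gamma>. f (\<sigma> g))"
    using \<tau>(1) by (rule sum_\<Gamma>_mult_right[where f = "\<lambda>\<sigma>. f (\<sigma> g)"])
  finally show ?thesis .
qed

text \<open>
  The map \<open>g \<mapsto> g\<^sup>-\<^sup>1 \<sigma>(g)\<close> onto the displacement subgroup has fibres of equal size, the cosets of
  the fixed points of \<open>\<sigma>\<close>; hence sums along it are translation invariant.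
\<close>

lemma sum_displacement_shift:
  assumes \<sigma>: "\<sigma> \<in> \<Gamma>" and d: "d \<in> displacement G \<sigma>"
  shows "(\<Sum>g\<in>carrier G. f (d \<otimes> (inv g \<otimes> \<sigma> g))) = (\<Sum>g\<in>carrier G. (f (inv g \<otimes> \<sigma> g) :: 'b::comm_monoid_add))"
proof -
  define D where "D = displacement G \<sigma>"
  define q where "q g = inv g \<otimes> \<sigma> g" for g
  have D: "subgroup D G" using balanced \<sigma> by (simp add: balanced_def D_def)
  have qD: "q ` carrier G = D" by (auto simp: D_def displacement_def q_def)
  have finD: "finite D" using qD finite_carrier by auto
  define m where "m = card {g \<in> carrier G. \<sigma> g = g}"
  have fib: "card {g \<in> carrier G. q g = e} = m" if "e \<in> D" for e
  proof -
    from that qD obtain k where k: "k \<in> carrier G" "e = q k" by blast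
    have "bij_betw (\<lambda>g. g \<otimes> k) {g \<in> carrier G. \<sigma> g = g} {g \<in> carrier G. q g = e}"
    proof (rule bij_betwI[of _ _ _ "\<lambda>g. g \<otimes> inv k"])
      show "(\<lambda>g. g \<otimes> k) \<in> {g \<in> carrier G. \<sigma> g = g} \<rightarrow> {g \<in> carrier G. q g = e}"
        using k \<sigma> by (auto simp: q_def \<Gamma>_mult inv_mult_group m_assoc)
      show "(\<lambda>g. g \<otimes> inv k) \<in> {g \<in> carrier G. q g = e} \<rightarrow> {g \<in> carrier G. \<sigma> g = g}"
      proof safe
        fix g assume g: "g \<in> carrier G" "e = q g"
        have "\<sigma> g = g \<otimes> (inv g \<otimes> \<sigma> g)" using g \<sigma> by simp
        also have "\<dots> = g \<otimes> (inv k \<otimes> \<sigma> k)" using g k by (simp add: q_def)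
        finally have "\<sigma> g = g \<otimes> (inv k \<otimes> \<sigma> k)" .
        thus "\<sigma> (g \<otimes> inv k) = g \<otimes> inv k"
          using g k \<sigma> by (simp add: \<Gamma>_mult \<Gamma>_inv m_assoc)
      qed (use k in simp)
    qed (use k in auto)
    thus ?thesis by (simp add: m_def bij_betw_same_card)
  qed
  have sums: "(\<Sum>g\<in>carrier G. F (q g)) = (\<Sum>e\<in>D. (\<Sum>g | g \<in> carrier G \<and> q g = e. F e))"
    for F :: "'g \<Rightarrow> 'b"
  proof -
    have "(\<Sum>g\<in>carrier G. F (q g)) = (\<Sum>e\<in>D. \<Sum>g | g \<in> carrier G \<and> q g = e. F (q g))"
      using sum.group[OF finite_carrier finD, of q "\<lambda>g. F (q g)"] qD by simp
    also have "\<dots> = (\<Sum>e\<in>D. \<Sum>g | g \<in> carrier G \<and> q g = e. F e)"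
      by (intro sum.cong) auto
    finally show ?thesis .
  qed
  have const: "(\<Sum>x\<in>A. c) = (\<Sum>i<card A. c)" if "finite A" for A :: "'g set" and c :: 'b
    using that by (induction A rule: finite_induct) (simp_all add: add.commute)
  have sumD: "(\<Sum>g\<in>carrier G. F (q g)) = (\<Sum>e\<in>D. \<Sum>i<m. F e)" for F :: "'g \<Rightarrow> 'b"
    unfolding sums using finite_carrier by (intro sum.cong refl) (simp add: const fib)
  have d: "d \<in> D" using d by (simp add: D_def)
  have "(\<Sum>e\<in>D. \<Sum>i<m. f (d \<otimes> e)) = (\<Sum>e\<in>D. \<Sum>i<m. f e)"
    using d subgroup.mem_carrier[OF D] subgroup.m_closed[OF D] subgroup.m_inv_closed[OF D]
    by (intro sum.reindex_bij_witness[of _ "\<lambda>e. inv d \<otimes> e" "\<lambda>e. d \<otimes> e"]) auto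
  thus ?thesis
    using sumD[of "\<lambda>e. f (d \<otimes> e)"] sumD[of f] by (simp add: q_def)
qed

end

section \<open>Aligned operator spaces\<close>

text \<open>
  An aligned space \<open>Y\<close> together with all its witnesses: a representation \<open>\<pi>\<close> of \<open>Y\<close> on the inner
  product space \<open>\<K>\<close>, which carries the unitary representation \<open>\<Theta>\<close> of \<open>G\<close>, and the action \<open>s\<close> of
  \<open>\<Gamma>\<close> on \<open>Y\<close>.
\<close>

locale aligned_space =
  balanced_pair G H \<Gamma> + K: unitary_representation \<K> G \<Theta>
  for G :: "('g, 'k) monoid_scheme" (structure) and H \<Gamma>
    and \<K> :: "('f::real_or_complex, 'h::ab_group_add) hilb" and \<Theta> :: "'g \<Rightarrow> 'h \<Rightarrow> 'h" +
  fixes Y :: "('f, 'y::ab_group_add) opsp" and l r :: "'g \<Rightarrow> 'y \<Rightarrow> 'y"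
    and \<pi> :: "'y \<Rightarrow> 'h \<Rightarrow> 'h" and s :: "('g \<Rightarrow> 'g) \<Rightarrow> 'y \<Rightarrow> 'y"
  assumes operator_space_Y: "operator_space Y"
    and left: "left_action G Y l" and right: "right_action G Y r"
    and \<pi>: "complete_isometry Y (bounded_ops \<K>) \<pi>"
    and \<pi>_l: "g \<in> carrier G \<Longrightarrow> y \<in> carrier Y \<Longrightarrow> \<pi> (l g y) = \<Theta> g \<circ> \<pi> y"
    and \<pi>_r: "g \<in> carrier G \<Longrightarrow> y \<in> carrier Y \<Longrightarrow> \<pi> (r g y) = \<pi> y \<circ> \<Theta> g"
    and ergodic_H: "ergodic_on H Y l"
    and ergodic_displacement:
      "\<sigma> \<in> \<Gamma> \<Longrightarrow> \<sigma> \<noteq> \<one>\<^bsub>AutoGroup G\<^esub> \<Longrightarrow> ergodic_on (displacement G \<sigma>) Y l"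
    and s_action: "left_action (AutoGroup G\<lparr>carrier := \<Gamma>\<rparr>) Y s"
    and s_l: "\<lbrakk>\<sigma> \<in> \<Gamma>; g \<in> carrier G; y \<in> carrier Y\<rbrakk> \<Longrightarrow> s \<sigma> (l g y) = l (\<sigma> g) (s \<sigma> y)"
    and s_inner: "g \<in> carrier G \<Longrightarrow> y \<in> carrier Y \<Longrightarrow> s (inner_auto G g) y = r (inv g) (l g y)"
begin

sublocale Y: lin_space Y
  using operator_space_Y by unfold_locales (simp add: operator_space_def)

lemma l_linear: "g \<in> carrier G \<Longrightarrow> linear_map Y Y (l g)"
  using left by (simp add: left_action_def complete_isometry_linear)

lemma r_linear: "g \<in> carrier G \<Longrightarrow> linear_map Y Y (r g)"
  using right by (simp add: right_action_def complete_isometry_linear)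

lemma s_isometry: "\<sigma> \<in> \<Gamma> \<Longrightarrow> complete_isometry Y Y (s \<sigma>)"
  using s_action by (simp add: left_action_def)

lemma s_linear: "\<sigma> \<in> \<Gamma> \<Longrightarrow> linear_map Y Y (s \<sigma>)"
  using s_isometry by (rule complete_isometry_linear)

lemma l_mem [simp]: "g \<in> carrier G \<Longrightarrow> y \<in> carrier Y \<Longrightarrow> l g y \<in> carrier Y"
  using Y.linear_map_mem[OF l_linear] .

lemma r_mem [simp]: "g \<in> carrier G \<Longrightarrow> y \<in> carrier Y \<Longrightarrow> r g y \<in> carrier Y"
  using Y.linear_map_mem[OF r_linear] .

lemma s_mem [simp]: "\<sigma> \<in> \<Gamma> \<Longrightarrow> y \<in> carrier Y \<Longrightarrow> s \<sigma> y \<in> carrier Y"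
  using Y.linear_map_mem[OF s_linear] .

lemma l_one [simp]: "y \<in> carrier Y \<Longrightarrow> l \<one> y = y"
  using left by (simp add: left_action_def)

lemma l_mult: "\<lbrakk>g \<in> carrier G; k \<in> carrier G; y \<in> carrier Y\<rbrakk> \<Longrightarrow> l (g \<otimes> k) y = l g (l k y)"
  using left by (simp add: left_action_def)

lemma r_mult: "\<lbrakk>g \<in> carrier G; k \<in> carrier G; y \<in> carrier Y\<rbrakk> \<Longrightarrow> r (g \<otimes> k) y = r k (r g y)"
  using right by (simp add: right_action_def)

lemma r_one [simp]: "y \<in> carrier Y \<Longrightarrow> r \<one> y = y"
  using right by (simp add: right_action_def)

lemma s_mult: "\<lbrakk>\<sigma> \<in> \<Gamma>; \<tau> \<in> \<Gamma>; y \<in> carrier Y\<rbrakk> \<Longrightarrow> s (\<sigma> \<otimes>\<^bsub>AutoGroup G\<^esub> \<tau>) y = s \<sigma> (s \<tau> y)"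
  using s_action by (simp add: left_action_def)

lemma s_one: "y \<in> carrier Y \<Longrightarrow> s \<one>\<^bsub>AutoGroup G\<^esub> y = y"
  using s_action by (simp add: left_action_def)

lemma \<pi>_linear: "linear_map Y (bounded_ops \<K>) \<pi>"
  using \<pi> by (rule complete_isometry_linear)

lemma \<pi>_ops: "y \<in> carrier Y \<Longrightarrow> \<pi> y \<in> carrier (bounded_ops \<K>)"
  using Y.linear_map_mem[OF \<pi>_linear] .

lemma \<pi>_op_linear: "y \<in> carrier Y \<Longrightarrow> linear_map \<K> \<K> (\<pi> y)"
  using K.bounded_ops_linear[OF \<pi>_ops] .

lemma \<pi>_mem [simp]: "y \<in> carrier Y \<Longrightarrow> \<xi> \<in> carrier \<K> \<Longrightarrow> \<pi> y \<xi> \<in> carrier \<K>"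
  using K.linear_map_mem[OF \<pi>_op_linear] .

lemma \<pi>_sum: "(\<And>i. i \<in> I \<Longrightarrow> v i \<in> carrier Y) \<Longrightarrow> \<pi> (\<Sum>i\<in>I. v i) \<xi> = (\<Sum>i\<in>I. \<pi> (v i) \<xi>)"
  using Y.linear_map_sum[OF \<pi>_linear, of I v] by (simp add: sum_fun_apply)

lemma \<pi>_scl: "y \<in> carrier Y \<Longrightarrow> \<pi> (scl Y c y) \<xi> = scl \<K> c (\<pi> y \<xi>)"
  using Y.linear_map_scl[OF \<pi>_linear] by (simp add: bounded_ops_def)

lemma \<pi>_zero: "\<pi> 0 \<xi> = 0"
  using Y.linear_map_0[OF \<pi>_linear] by simp

text \<open>Injectivity follows from the norms of \<open>1 \<times> 1\<close> matrices.\<close>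

lemma \<pi>_inj:
  assumes y: "y \<in> carrier Y" "z \<in> carrier Y" and eq: "\<pi> y = \<pi> z"
  shows "y = z"
proof -
  define A where "A = mat 1 1 (\<lambda>_. y - z)"
  have A: "A \<in> mats Y 1" and Z: "(0\<^sub>m 1 1 :: 'y mat) \<in> mats Y 1"
    using y by (auto simp: A_def mats_iff)
  have norms: "mnorm Y B = 0 \<longleftrightarrow> B = 0\<^sub>m 1 1" if "B \<in> mats Y 1" for B
    using operator_space_Y that by (simp add: operator_space_def)
  have "\<pi> (y - z) = \<pi> 0"
    using Y.linear_map_diff[OF \<pi>_linear y] Y.linear_map_0[OF \<pi>_linear] eq by simp
  hence "map_mat \<pi> A = map_mat \<pi> (0\<^sub>m 1 1)" by (intro eq_matI) (auto simp: A_def)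
  moreover have "mnorm Y A = mnorm (bounded_ops \<K>) (map_mat \<pi> A)"
    "mnorm Y (0\<^sub>m 1 1) = mnorm (bounded_ops \<K>) (map_mat \<pi> (0\<^sub>m 1 1))"
    using \<pi> A Z by (simp_all add: complete_isometry_def)
  ultimately have "A = 0\<^sub>m 1 1" using norms[OF A] norms[OF Z] by simp
  hence "A $$ (0, 0) = 0" by simp
  thus ?thesis by (simp add: A_def)
qed

lemma l_r_commute: 
  assumes "g \<in> carrier G" "k \<in> carrier G" "y \<in> carrier Y"
  shows "l k (r g y) = r g (l k y)"
  using assms by (intro \<pi>_inj) (simp_all add: \<pi>_l \<pi>_r comp_assoc)

lemma r_eq_l_if_inner_fixed:
  assumes "g \<in> carrier G" "y \<in> carrier Y" "s (inner_auto G g) y = y"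
  shows "r g y = l g y"
proof -
  have "r g y = r g (r (inv g) (l g y))" using assms s_inner by simp
  also have "\<dots> = l g y" using assms r_mult[of "inv g" g "l g y"] by simp
  finally show ?thesis .
qed

lemma r_eq_l_H: "h \<in> H \<Longrightarrow> y \<in> carrier Y \<Longrightarrow> r h y = l h y"
proof (rule r_eq_l_if_inner_fixed)
  assume h: "h \<in> H" and y: "y \<in> carrier Y"
  have "inner_auto G h = \<one>\<^bsub>AutoGroup G\<^esub>"
    unfolding inner_auto_def one_Auto using h by (intro restrict_ext) (simp add: H_comm)
  thus "s (inner_auto G h) y = y" using y by (simp add: s_one)
qed simp_all


section \<open>Consequences of ergodicity\<close>

lemma H_sum_zero:
  assumes y: "y \<in> carrier Y"
  shows "(\<Sum>h\<in>H. l h y) = 0"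
proof -
  have "l k (\<Sum>h\<in>H. l h y) = (\<Sum>h\<in>H. l h y)" if k: "k \<in> H" for k
  proof -
    have "l k (\<Sum>h\<in>H. l h y) = (\<Sum>h\<in>H. l (k \<otimes> h) y)"
      using y k by (simp add: Y.linear_map_sum[OF l_linear] l_mult)
    also have "\<dots> = (\<Sum>h\<in>H. l h y)"
      using k by (rule sum_H_mult_left[where f = "\<lambda>h. l h y"])
    finally show ?thesis .
  qed
  moreover have "(\<Sum>h\<in>H. l h y) \<in> carrier Y" using y by (intro Y.sum_mem) simp
  ultimately show ?thesis using ergodic_H by (simp add: ergodic_on_def)
qed

lemma orbit_sum_zero:
  assumes g: "g \<in> carrier G - H" and y: "y \<in> carrier Y"
  shows "(\<Sum>\<sigma>\<in>\<Gamma>. l (\<sigma> g) y) = 0"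
proof -
  have "l h (\<Sum>\<sigma>\<in>\<Gamma>. l (\<sigma> g) y) = (\<Sum>\<sigma>\<in>\<Gamma>. l (\<sigma> g) y)" if h: "h \<in> H" for h
  proof -
    have "l h (\<Sum>\<sigma>\<in>\<Gamma>. l (\<sigma> g) y) = (\<Sum>\<sigma>\<in>\<Gamma>. l (h \<otimes> \<sigma> g) y)"
      using y h g by (simp add: Y.linear_map_sum[OF l_linear] l_mult)
    also have "\<dots> = (\<Sum>\<sigma>\<in>\<Gamma>. l (\<sigma> g) y)"
      by (rule sum_\<Gamma>_H_shift[OF g h, where f = "\<lambda>u. l u y"])
    finally show ?thesis .
  qed
  moreover have "(\<Sum>\<sigma>\<in>\<Gamma>. l (\<sigma> g) y) \<in> carrier Y" using g y by (intro Y.sum_mem) simp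
  ultimately show ?thesis using ergodic_H by (simp add: ergodic_on_def)
qed

lemma displacement_sum_zero:
  assumes \<sigma>: "\<sigma> \<in> \<Gamma>" "\<sigma> \<noteq> \<one>\<^bsub>AutoGroup G\<^esub>" and y: "y \<in> carrier Y"
  shows "(\<Sum>g\<in>carrier G. l (inv g \<otimes> \<sigma> g) y) = 0"
proof -
  let ?v = "\<Sum>g\<in>carrier G. l (inv g \<otimes> \<sigma> g) y"
  have "l d ?v = ?v" if d: "d \<in> displacement G \<sigma>" for d
  proof -
    have dG: "d \<in> carrier G" using d \<sigma> by (auto simp: displacement_def)
    have "l d ?v = (\<Sum>g\<in>carrier G. l (d \<otimes> (inv g \<otimes> \<sigma> g)) y)"
      using y dG \<sigma> by (simp add: Y.linear_map_sum[OF l_linear] l_mult)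
    also have "\<dots> = ?v"
      by (rule sum_displacement_shift[OF \<sigma>(1) d, where f = "\<lambda>u. l u y"])
    finally show ?thesis .
  qed
  moreover have "?v \<in> carrier Y" using \<sigma> y by (intro Y.sum_mem) simp
  ultimately show ?thesis
    using ergodic_displacement[OF \<sigma>] by (simp add: ergodic_on_def)
qed

text \<open>
  On \<open>\<K>\<close> itself the group need not act ergodically, but the operators from \<open>Y\<close> live on the
  orthogonal complement of the \<open>H\<close>-fixed vectors; \<open>reduced\<close> is the projection onto it.
\<close>

definition reduced :: "'h \<Rightarrow> 'h" where
  "reduced \<xi> = \<xi> - scl \<K> (1 / of_nat (card H)) (\<Sum>h\<in>H. \<Theta> h \<xi>)"

lemma of_nat_card_H: "of_nat (card H) \<noteq> (0 :: 'f)"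
  using card_H_pos by simp

lemma \<Theta>_sum: "g \<in> carrier G \<Longrightarrow> (\<And>i. i \<in> I \<Longrightarrow> v i \<in> carrier \<K>) \<Longrightarrow> \<Theta> g (\<Sum>i\<in>I. v i) = (\<Sum>i\<in>I. \<Theta> g (v i))"
  using K.linear_map_sum[OF K.rep_linear] .

lemma \<Theta>_adjoint:
  assumes "g \<in> carrier G" "\<xi> \<in> carrier \<K>" "\<eta> \<in> carrier \<K>"
  shows "ip \<K> (\<Theta> (inv g) \<xi>) \<eta> = ip \<K> \<xi> (\<Theta> g \<eta>)"
  using assms K.rep_ip[of g "\<Theta> (inv g) \<xi>" \<eta>] K.rep_mult[of g "inv g" \<xi>] by simp

lemma reduced_mem [simp]: "\<xi> \<in> carrier \<K> \<Longrightarrow> reduced \<xi> \<in> carrier \<K>"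
  unfolding reduced_def by (intro K.diff_mem K.scl_mem K.sum_mem) simp_all

lemma reduced_H_sum:
  assumes \<xi>: "\<xi> \<in> carrier \<K>"
  shows "(\<Sum>h\<in>H. \<Theta> h (reduced \<xi>)) = 0"
proof -
  define S where "S = (\<Sum>h\<in>H. \<Theta> h \<xi>)"
  have S: "S \<in> carrier \<K>" unfolding S_def using \<xi> by (intro K.sum_mem) simp
  have "\<Theta> h S = S" if h: "h \<in> H" for h
  proof -
    have "\<Theta> h S = (\<Sum>k\<in>H. \<Theta> (h \<otimes> k) \<xi>)"
      using \<xi> h by (simp add: S_def \<Theta>_sum K.rep_mult)
    also have "\<dots> = S"
      unfolding S_def using h by (rule sum_H_mult_left[where f = "\<lambda>h. \<Theta> h \<xi>"])
    finally show ?thesis .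
  qed
  hence "\<Theta> h (reduced \<xi>) = \<Theta> h \<xi> - scl \<K> (1 / of_nat (card H)) S" if "h \<in> H" for h
    using that \<xi> S
    by (simp add: reduced_def S_def[symmetric] K.linear_map_diff[OF K.rep_linear]
        K.linear_map_scl[OF K.rep_linear])
  thus ?thesis
    using of_nat_card_H
    by (simp add: sum_subtractf S_def[symmetric] K.sum_const_scl[OF finite_H])
qed

lemma hnorm_reduced_le:
  assumes \<xi>: "\<xi> \<in> carrier \<K>"
  shows "hnorm \<K> (reduced \<xi>) \<le> hnorm \<K> \<xi>"
proof -
  define S where "S = (\<Sum>h\<in>H. \<Theta> h \<xi>)"
  define \<eta> where "\<eta> = reduced \<xi>"
  have S: "S \<in> carrier \<K>" unfolding S_def using \<xi> by (intro K.sum_mem) simp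
  have \<eta>: "\<eta> \<in> carrier \<K>" using \<xi> by (simp add: \<eta>_def)
  have "ip \<K> S \<eta> = (\<Sum>h\<in>H. ip \<K> (\<Theta> (inv h) \<xi>) \<eta>)"
    using \<xi> \<eta> sum_H_inv[of "\<lambda>h. ip \<K> (\<Theta> h \<xi>) \<eta>"] by (simp add: S_def K.ip_sum_left)
  also have "\<dots> = ip \<K> \<xi> (\<Sum>h\<in>H. \<Theta> h \<eta>)"
    using \<xi> \<eta> by (simp add: \<Theta>_adjoint K.ip_sum_right)
  also have "\<dots> = 0"
    using \<xi> K.ip_conj[of 0 \<xi>] by (simp add: \<eta>_def reduced_H_sum)
  finally have S\<eta>: "ip \<K> S \<eta> = 0" .
  have "\<xi> = \<eta> + scl \<K> (1 / of_nat (card H)) S"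
    by (simp add: \<eta>_def reduced_def S_def)
  hence "ip \<K> \<xi> \<eta> = ip \<K> (\<eta> + scl \<K> (1 / of_nat (card H)) S) \<eta>" by simp
  also have "\<dots> = ip \<K> \<eta> \<eta>"
    using \<eta> S S\<eta> by (simp add: K.ip_add K.ip_scl)
  finally have "(hnorm \<K> \<eta>)\<^sup>2 \<le> hnorm \<K> \<xi> * hnorm \<K> \<eta>"
    using K.norm_ip_le[OF \<xi> \<eta>] by (simp add: K.hnorm_sq)
  thus ?thesis
    using K.hnorm_nonneg[of \<eta>] K.hnorm_nonneg[of \<xi>]
    by (cases "hnorm \<K> \<eta> = 0") (auto simp: power2_eq_square \<eta>_def[symmetric])
qed

lemma \<pi>_reduced:
  assumes y: "y \<in> carrier Y" and \<xi>: "\<xi> \<in> carrier \<K>"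
  shows "\<pi> y (reduced \<xi>) = \<pi> y \<xi>"
proof -
  have "\<pi> y (\<Sum>h\<in>H. \<Theta> h \<xi>) = (\<Sum>h\<in>H. \<pi> (l h y) \<xi>)"
    using y \<xi> by (simp add: K.linear_map_sum[OF \<pi>_op_linear] \<pi>_r flip: r_eq_l_H)
  also have "\<dots> = \<pi> (\<Sum>h\<in>H. l h y) \<xi>"
    using y by (simp add: \<pi>_sum)
  also have "\<dots> = 0" using y by (simp add: H_sum_zero \<pi>_zero)
  finally have "\<pi> y (\<Sum>h\<in>H. \<Theta> h \<xi>) = 0" .
  moreover have "(\<Sum>h\<in>H. \<Theta> h \<xi>) \<in> carrier \<K>" using \<xi> by (intro K.sum_mem) simp
  ultimately show ?thesis
    using y \<xi>
    by (simp add: reduced_def K.linear_map_diff[OF \<pi>_op_linear] K.linear_map_scl[OF \<pi>_op_linear])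
qed

lemma \<pi>_H_sum: "y \<in> carrier Y \<Longrightarrow> (\<Sum>h\<in>H. \<Theta> h (\<pi> y \<xi>)) = 0"
  using \<pi>_sum[of H "\<lambda>h. l h y" \<xi>] by (simp add: \<pi>_l H_sum_zero \<pi>_zero)

lemma \<Theta>_orbit_sum_zero:
  assumes g: "g \<in> carrier G - H" and \<xi>: "\<xi> \<in> carrier \<K>" "(\<Sum>h\<in>H. \<Theta> h \<xi>) = 0"
  shows "(\<Sum>\<sigma>\<in>\<Gamma>. \<Theta> (\<sigma> g) \<xi>) = 0"
proof -
  define u where "u = (\<Sum>\<sigma>\<in>\<Gamma>. \<Theta> (\<sigma> g) \<xi>)"
  have h_u: "\<Theta> h u = (\<Sum>\<sigma>\<in>\<Gamma>. \<Theta> (h \<otimes> \<sigma> g) \<xi>)" if "h \<in> H" for h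
    using \<xi> that g by (simp add: u_def \<Theta>_sum K.rep_mult)
  have "\<Theta> h u = u" if h: "h \<in> H" for h
    using sum_\<Gamma>_H_shift[OF g h, of "\<lambda>u. \<Theta> u \<xi>"] by (simp add: h_u[OF h]) (simp add: u_def)
  hence "scl \<K> (of_nat (card H)) u = (\<Sum>h\<in>H. \<Theta> h u)"
    by (simp add: K.sum_const_scl[OF finite_H])
  also have "\<dots> = (\<Sum>\<sigma>\<in>\<Gamma>. \<Sum>h\<in>H. \<Theta> (h \<otimes> \<sigma> g) \<xi>)"
    by (simp add: h_u sum.swap[of _ H])
  also have "\<dots> = (\<Sum>\<sigma>\<in>\<Gamma>. \<Theta> (\<sigma> g) (\<Sum>h\<in>H. \<Theta> h \<xi>))"
  proof (rule sum.cong[OF refl])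
    fix \<sigma> assume \<sigma>: "\<sigma> \<in> \<Gamma>"
    have "\<Theta> (h \<otimes> \<sigma> g) \<xi> = \<Theta> (\<sigma> g) (\<Theta> h \<xi>)" if "h \<in> H" for h
      using \<xi> g \<sigma> that K.rep_mult[of "\<sigma> g" h \<xi>] H_comm[of h "\<sigma> g"] by simp
    thus "(\<Sum>h\<in>H. \<Theta> (h \<otimes> \<sigma> g) \<xi>) = \<Theta> (\<sigma> g) (\<Sum>h\<in>H. \<Theta> h \<xi>)"
      using \<xi>(1) g \<sigma> by (simp add: \<Theta>_sum)
  qed
  also have "\<dots> = 0" using \<xi>(2) g K.linear_map_0[OF K.rep_linear] by simp
  finally show ?thesis using of_nat_card_H by (simp add: u_def[symmetric])
qed

text \<open>
  Up to scaling, \<open>\<xi> \<mapsto> (\<Sum>\<^sub>k \<sigma>(k) \<xi> k)\<^sub>\<sigma>\<close> is a contraction on families of reduced vectors: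
  expanding the squared norms, orbit sums kill every term whose two indices lie in different
  cosets of \<open>H\<close>.
\<close>

lemma orbit_transform_bound:
  assumes \<xi>: "\<And>k. k \<in> carrier G \<Longrightarrow> \<xi> k \<in> carrier \<K>"
    and red: "\<And>k. k \<in> carrier G \<Longrightarrow> (\<Sum>h\<in>H. \<Theta> h (\<xi> k)) = 0"
  shows "(\<Sum>\<sigma>\<in>\<Gamma>. (hnorm \<K> (\<Sum>k\<in>carrier G. \<Theta> (\<sigma> k) (\<xi> k)))\<^sup>2)
    \<le> of_nat (card \<Gamma>) * of_nat (card H) * (\<Sum>k\<in>carrier G. (hnorm \<K> (\<xi> k))\<^sup>2)"
proof -
  define v where "v \<sigma> = (\<Sum>k\<in>carrier G. \<Theta> (\<sigma> k) (\<xi> k))" for \<sigma>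
  define N where "N = (\<Sum>k\<in>carrier G. (hnorm \<K> (\<xi> k))\<^sup>2)"
  have v: "v \<sigma> \<in> carrier \<K>" if "\<sigma> \<in> \<Gamma>" for \<sigma>
    unfolding v_def using that \<xi> by (intro K.sum_mem) simp
  have ip_v: "ip \<K> (v \<sigma>) (v \<sigma>)
      = (\<Sum>p\<in>carrier G. \<Sum>m\<in>carrier G. ip \<K> (\<Theta> (\<sigma> m) (\<xi> (p \<otimes> m))) (\<xi> p))"
    if \<sigma>: "\<sigma> \<in> \<Gamma>" for \<sigma>
  proof -
    have "ip \<K> (v \<sigma>) (v \<sigma>) = (\<Sum>p\<in>carrier G. ip \<K> (v \<sigma>) (\<Theta> (\<sigma> p) (\<xi> p)))"
      using v[OF \<sigma>] \<sigma> \<xi> by (simp add: v_def[of \<sigma>] K.ip_sum_right)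
    also have "\<dots> = (\<Sum>p\<in>carrier G. \<Sum>k\<in>carrier G. ip \<K> (\<Theta> (\<sigma> k) (\<xi> k)) (\<Theta> (\<sigma> p) (\<xi> p)))"
      using \<sigma> \<xi> by (simp add: v_def K.ip_sum_left)
    also have "\<dots> = (\<Sum>p\<in>carrier G. \<Sum>m\<in>carrier G. ip \<K> (\<Theta> (\<sigma> (p \<otimes> m)) (\<xi> (p \<otimes> m))) (\<Theta> (\<sigma> p) (\<xi> p)))"
      by (intro sum.cong sum_mult_left[symmetric,
            where f = "\<lambda>k. ip \<K> (\<Theta> (\<sigma> k) (\<xi> k)) (\<Theta> (\<sigma> _) (\<xi> _))"]) simp_all
    also have "\<dots> = (\<Sum>p\<in>carrier G. \<Sum>m\<in>carrier G. ip \<K> (\<Theta> (\<sigma> m) (\<xi> (p \<otimes> m))) (\<xi> p))"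
      using \<sigma> \<xi> by (simp add: \<Gamma>_mult K.rep_mult K.rep_ip)
    finally show ?thesis .
  qed
  have "(of_real (\<Sum>\<sigma>\<in>\<Gamma>. (hnorm \<K> (v \<sigma>))\<^sup>2) :: 'f) = (\<Sum>\<sigma>\<in>\<Gamma>. ip \<K> (v \<sigma>) (v \<sigma>))"
    using v by (simp add: K.ip_self)
  also have "\<dots> = (\<Sum>\<sigma>\<in>\<Gamma>. \<Sum>p\<in>carrier G. \<Sum>m\<in>carrier G. ip \<K> (\<Theta> (\<sigma> m) (\<xi> (p \<otimes> m))) (\<xi> p))"
    using ip_v by simp
  also have "\<dots> = (\<Sum>p\<in>carrier G. \<Sum>m\<in>carrier G. \<Sum>\<sigma>\<in>\<Gamma>. ip \<K> (\<Theta> (\<sigma> m) (\<xi> (p \<otimes> m))) (\<xi> p))"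
    by (simp only: sum.swap[of _ "carrier G" \<Gamma>])
  also have "\<dots> = (\<Sum>p\<in>carrier G. \<Sum>m\<in>H. \<Sum>\<sigma>\<in>\<Gamma>. ip \<K> (\<Theta> (\<sigma> m) (\<xi> (p \<otimes> m))) (\<xi> p))"
  proof (rule sum.cong[OF refl])
    fix p assume p: "p \<in> carrier G"
    show "(\<Sum>m\<in>carrier G. \<Sum>\<sigma>\<in>\<Gamma>. ip \<K> (\<Theta> (\<sigma> m) (\<xi> (p \<otimes> m))) (\<xi> p))
        = (\<Sum>m\<in>H. \<Sum>\<sigma>\<in>\<Gamma>. ip \<K> (\<Theta> (\<sigma> m) (\<xi> (p \<otimes> m))) (\<xi> p))"
    proof (rule sum.mono_neutral_right)
      show "\<forall>m\<in>carrier G - H. (\<Sum>\<sigma>\<in>\<Gamma>. ip \<K> (\<Theta> (\<sigma> m) (\<xi> (p \<otimes> m))) (\<xi> p)) = 0"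
      proof
        fix m assume m: "m \<in> carrier G - H"
        have "(\<Sum>\<sigma>\<in>\<Gamma>. ip \<K> (\<Theta> (\<sigma> m) (\<xi> (p \<otimes> m))) (\<xi> p))
            = ip \<K> (\<Sum>\<sigma>\<in>\<Gamma>. \<Theta> (\<sigma> m) (\<xi> (p \<otimes> m))) (\<xi> p)"
          using p m \<xi> by (simp add: K.ip_sum_left)
        also have "\<dots> = 0"
          using p m \<xi> red by (simp add: \<Theta>_orbit_sum_zero)
        finally show "(\<Sum>\<sigma>\<in>\<Gamma>. ip \<K> (\<Theta> (\<sigma> m) (\<xi> (p \<otimes> m))) (\<xi> p)) = 0" .
      qed
    qed (auto simp: finite_carrier)
  qed
  also have "\<dots> = of_nat (card \<Gamma>) * (\<Sum>p\<in>carrier G. \<Sum>m\<in>H. ip \<K> (\<Theta> m (\<xi> (p \<otimes> m))) (\<xi> p))"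
    by (simp add: sum_distrib_left)
  finally have "(of_real (\<Sum>\<sigma>\<in>\<Gamma>. (hnorm \<K> (v \<sigma>))\<^sup>2) :: 'f)
      = of_nat (card \<Gamma>) * (\<Sum>p\<in>carrier G. \<Sum>m\<in>H. ip \<K> (\<Theta> m (\<xi> (p \<otimes> m))) (\<xi> p))" .
  from arg_cong[OF this, of norm]
  have "(\<Sum>\<sigma>\<in>\<Gamma>. (hnorm \<K> (v \<sigma>))\<^sup>2)
      = of_nat (card \<Gamma>) * norm (\<Sum>p\<in>carrier G. \<Sum>m\<in>H. ip \<K> (\<Theta> m (\<xi> (p \<otimes> m))) (\<xi> p))"
    by (simp only: norm_of_real norm_mult norm_of_nat abs_of_nonneg sum_nonneg zero_le_power2)
  also have "\<dots> \<le> of_nat (card \<Gamma>) * (of_nat (card H) * N)"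
  proof (rule mult_left_mono)
    have le: "norm (ip \<K> (\<Theta> m (\<xi> (p \<otimes> m))) (\<xi> p))
        \<le> ((hnorm \<K> (\<xi> (p \<otimes> m)))\<^sup>2 + (hnorm \<K> (\<xi> p))\<^sup>2) / 2"
      if "p \<in> carrier G" "m \<in> H" for p m
    proof -
      have "norm (ip \<K> (\<Theta> m (\<xi> (p \<otimes> m))) (\<xi> p)) \<le> hnorm \<K> (\<xi> (p \<otimes> m)) * hnorm \<K> (\<xi> p)"
        using that \<xi> K.norm_ip_le[of "\<Theta> m (\<xi> (p \<otimes> m))" "\<xi> p"] by simp
      also have "\<dots> \<le> ((hnorm \<K> (\<xi> (p \<otimes> m)))\<^sup>2 + (hnorm \<K> (\<xi> p))\<^sup>2) / 2"
        using sum_squares_bound[of "hnorm \<K> (\<xi> (p \<otimes> m))" "hnorm \<K> (\<xi> p)"] by simp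
      finally show ?thesis .
    qed
    have "norm (\<Sum>p\<in>carrier G. \<Sum>m\<in>H. ip \<K> (\<Theta> m (\<xi> (p \<otimes> m))) (\<xi> p))
        \<le> (\<Sum>p\<in>carrier G. \<Sum>m\<in>H. ((hnorm \<K> (\<xi> (p \<otimes> m)))\<^sup>2 + (hnorm \<K> (\<xi> p))\<^sup>2) / 2)"
      by (intro sum_norm_le le)
    also have "\<dots> = ((\<Sum>m\<in>H. \<Sum>p\<in>carrier G. (hnorm \<K> (\<xi> (p \<otimes> m)))\<^sup>2) + of_nat (card H) * N) / 2"
      by (simp add: sum.distrib sum.swap[of _ H] N_def flip: sum_divide_distrib sum_distrib_left)
    also have "(\<Sum>m\<in>H. \<Sum>p\<in>carrier G. (hnorm \<K> (\<xi> (p \<otimes> m)))\<^sup>2) = (\<Sum>m\<in>H. N)"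
      unfolding N_def
      by (intro sum.cong sum_mult_right[where f = "\<lambda>k. (hnorm \<K> (\<xi> k))\<^sup>2"]) simp_all
    finally show "norm (\<Sum>p\<in>carrier G. \<Sum>m\<in>H. ip \<K> (\<Theta> m (\<xi> (p \<otimes> m))) (\<xi> p)) \<le> of_nat (card H) * N"
      by (simp add: mult.commute)
  qed simp
  finally show ?thesis by (simp add: v_def N_def mult.assoc)
qed


section \<open>The fixed space and its induced space\<close>

text \<open>The space \<open>X\<close>: the fixed points of \<open>\<Gamma>\<close> in \<open>Y\<close>, with the matrix norms of \<open>Y\<close>.\<close>

definition fixed :: "('f, 'y) opsp" where
  "fixed = Y\<lparr>carrier := {y \<in> carrier Y. \<forall>\<sigma>\<in>\<Gamma>. s \<sigma> y = y}\<rparr>"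

lemma fixed_simps [simp]: "scl fixed = scl Y" "mnorm fixed = mnorm Y"
  by (simp_all add: fixed_def)

lemma fixed_iff: "x \<in> carrier fixed \<longleftrightarrow> x \<in> carrier Y \<and> (\<forall>\<sigma>\<in>\<Gamma>. s \<sigma> x = x)"
  by (simp add: fixed_def)

lemma fixed_mem: "x \<in> carrier fixed \<Longrightarrow> x \<in> carrier Y"
  by (simp add: fixed_iff)

lemma fixed_s: "x \<in> carrier fixed \<Longrightarrow> \<sigma> \<in> \<Gamma> \<Longrightarrow> s \<sigma> x = x"
  by (simp add: fixed_iff)

lemma fixed_r: "x \<in> carrier fixed \<Longrightarrow> g \<in> carrier G \<Longrightarrow> r g x = l g x"
  by (simp add: r_eq_l_if_inner_fixed fixed_iff)

lemma fixed_l_H: "x \<in> carrier fixed \<Longrightarrow> h \<in> H \<Longrightarrow> l h x \<in> carrier fixed"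
  by (simp add: fixed_iff s_l)

lemma mats_fixed: "A \<in> mats fixed n \<Longrightarrow> A \<in> mats Y n"
  by (auto simp: mats_iff fixed_iff)

lemma linear_space_fixed: "linear_space fixed"
  unfolding linear_space_def fixed_simps
proof
  show "vector_space (scl Y)" by (rule Y.vs.vector_space_axioms)
  show "Y.vs.subspace (carrier fixed)"
    unfolding Y.vs.subspace_def
    by (auto simp: fixed_iff Y.linear_map_0[OF s_linear] Y.linear_map_add[OF s_linear]
        Y.linear_map_scl[OF s_linear])
qed

lemma operator_space_fixed: "operator_space fixed"
proof -
  have "sandwich_mat fixed \<alpha> A \<beta> = sandwich_mat Y \<alpha> A \<beta>" for \<alpha> A \<beta>
    by (simp add: sandwich_mat_def)
  thus ?thesis
    using operator_space_Y linear_space_fixed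
    unfolding operator_space_def fixed_simps by (simp only:) (blast dest: mats_fixed)
qed

lemma left_action_fixed: "left_action (G\<lparr>carrier := H\<rparr>) fixed l"
proof -
  have "complete_isometry fixed fixed (l h)" if h: "h \<in> H" for h
  proof -
    have ci: "complete_isometry Y Y (l h)" using left h by (simp add: left_action_def)
    show ?thesis
    proof (rule complete_isometryI)
      show "linear_map fixed fixed (l h)"
        using l_linear[of h] h fixed_l_H by (auto simp: linear_map_def fixed_mem)
    qed (simp add: complete_isometry_mnorm[OF ci mats_fixed])
  qed
  thus ?thesis by (simp add: left_action_def fixed_mem l_mult)
qed

lemma central_representation_fixed:
  assumes "hilbert_space \<K>"
  shows "central_representation (G\<lparr>carrier := H\<rparr>) fixed l \<K> \<pi> \<Theta>"
proof -
  have "complete_isometry fixed (bounded_ops \<K>) \<pi>"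
  proof (rule complete_isometryI)
    show "linear_map fixed (bounded_ops \<K>) \<pi>"
      using \<pi>_linear by (auto simp: linear_map_def fixed_mem)
  qed (simp add: complete_isometry_mnorm[OF \<pi> mats_fixed])
  moreover have "unitary_rep (G\<lparr>carrier := H\<rparr>) \<K> \<Theta>"
    using K.unitary_rep by (simp add: unitary_rep_def)
  moreover have "\<pi> (l h x) = \<Theta> h \<circ> \<pi> x \<and> \<Theta> h \<circ> \<pi> x = \<pi> x \<circ> \<Theta> h"
    if "h \<in> H" "x \<in> carrier fixed" for h x
    using that \<pi>_l[of h x] \<pi>_r[of h x] by (simp add: fixed_mem fixed_r)
  ultimately show ?thesis using assms by (simp add: central_representation_def)
qed

text \<open>The carrier of the induced space \<open>X\<^sub>G\<close>.\<close>

abbreviation maps :: "('g \<Rightarrow> 'y) set" where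
  "maps \<equiv> equivariant_maps G H (carrier fixed) l"

lemma maps_fixed: "\<phi> \<in> maps \<Longrightarrow> g \<in> carrier G \<Longrightarrow> \<phi> g \<in> carrier fixed"
  by (simp add: equivariant_maps_def)

lemma maps_mem [simp]: "\<phi> \<in> maps \<Longrightarrow> g \<in> carrier G \<Longrightarrow> \<phi> g \<in> carrier Y"
  using fixed_mem[OF maps_fixed] .

lemma maps_H: "\<phi> \<in> maps \<Longrightarrow> g \<in> carrier G \<Longrightarrow> h \<in> H \<Longrightarrow> \<phi> (g \<otimes> h) = l (inv h) (\<phi> g)"
  by (simp add: equivariant_maps_def)

text \<open>The isomorphism from the induced space: the sum of \<open>g \<phi>(g)\<close> over the cosets of \<open>H\<close>, on which
  the summand is constant, written as a normalised sum over \<open>G\<close>.\<close>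

definition assemble :: "('g \<Rightarrow> 'y) \<Rightarrow> 'y" where
  "assemble \<phi> = scl Y (1 / of_nat (card H)) (\<Sum>g\<in>carrier G. l g (\<phi> g))"

lemma assemble_mem [simp]: "\<phi> \<in> maps \<Longrightarrow> assemble \<phi> \<in> carrier Y"
  unfolding assemble_def by (intro Y.scl_mem Y.sum_mem) simp

lemma scl_assemble: "scl Y (of_nat (card H)) (assemble \<phi>) = (\<Sum>g\<in>carrier G. l g (\<phi> g))"
  using of_nat_card_H by (simp add: assemble_def)

lemma assemble_left:
  assumes \<phi>: "\<phi> \<in> maps" and g: "g \<in> carrier G"
  shows "assemble (induced_left G g \<phi>) = l g (assemble \<phi>)"
proof -
  have "(\<Sum>k\<in>carrier G. l k (induced_left G g \<phi> k))
      = (\<Sum>k\<in>carrier G. l (g \<otimes> k) (induced_left G g \<phi> (g \<otimes> k)))"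
    using g by (rule sum_mult_left[symmetric])
  also have "\<dots> = (\<Sum>k\<in>carrier G. l g (l k (\<phi> k)))"
    using \<phi> g by (simp add: induced_left_def l_mult)
  also have "\<dots> = l g (\<Sum>k\<in>carrier G. l k (\<phi> k))"
    using \<phi> g by (simp add: Y.linear_map_sum[OF l_linear])
  finally show ?thesis
    using \<phi> g by (simp add: assemble_def Y.linear_map_scl[OF l_linear] Y.sum_mem)
qed

lemma assemble_right:
  assumes \<phi>: "\<phi> \<in> maps" and g: "g \<in> carrier G"
  shows "assemble (induced_right G g \<phi>) = r g (assemble \<phi>)"
proof -
  have "(\<Sum>k\<in>carrier G. l k (induced_right G g \<phi> k))
      = (\<Sum>k\<in>carrier G. l (k \<otimes> g) (induced_right G g \<phi> (k \<otimes> g)))"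
    using g by (rule sum_mult_right[symmetric])
  also have "\<dots> = (\<Sum>k\<in>carrier G. l k (r g (\<phi> k)))"
    using \<phi> g by (simp add: induced_right_def l_mult fixed_r[OF maps_fixed])
  also have "\<dots> = r g (\<Sum>k\<in>carrier G. l k (\<phi> k))"
    using \<phi> g by (simp add: Y.linear_map_sum[OF r_linear] l_r_commute)
  finally show ?thesis
    using \<phi> g by (simp add: assemble_def Y.linear_map_scl[OF r_linear] Y.sum_mem)
qed

lemma linear_map_assemble:
  "linear_map (induced_space G H fixed l \<H> \<rho> \<theta>) Y assemble"
proof -
  have "assemble (\<phi> + \<psi>) = assemble \<phi> + assemble \<psi>" if "\<phi> \<in> maps" "\<psi> \<in> maps" for \<phi> \<psi>
    using that
    by (simp add: assemble_def Y.linear_map_add[OF l_linear] sum.distrib Y.vs.scale_right_distrib)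
  moreover have "assemble (\<lambda>g. scl Y c (\<phi> g)) = scl Y c (assemble \<phi>)" if "\<phi> \<in> maps" for c \<phi>
    using that
    by (simp add: assemble_def Y.linear_map_scl[OF l_linear] Y.vs.scale_sum_right mult.commute)
  ultimately show ?thesis by (simp add: linear_map_def induced_space_def)
qed

text \<open>
  The Fourier inversion behind the norm estimate: averaging over \<open>\<Gamma>\<close>
  recovers \<open>\<phi>\<close> from its assembled value, since every coset of \<open>H\<close> but one averages to zero.
\<close>

lemma orbit_average_assemble:
  assumes \<phi>: "\<phi> \<in> maps" and g: "g \<in> carrier G" and k: "k \<in> carrier G"
  shows "scl Y (of_nat (card \<Gamma>)) (\<phi> (g \<otimes> inv k))
    = (\<Sum>\<sigma>\<in>\<Gamma>. l (inv (\<sigma> g)) (r (\<sigma> k) (s \<sigma> (assemble \<phi>))))"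
proof -
  define c :: 'f where "c = 1 / of_nat (card H)"
  have orbit_term: "l (inv (\<sigma> g)) (r (\<sigma> k) (s \<sigma> (assemble \<phi>)))
      = scl Y c (\<Sum>m\<in>carrier G. l (\<sigma> m) (\<phi> (g \<otimes> m \<otimes> inv k)))" if \<sigma>: "\<sigma> \<in> \<Gamma>" for \<sigma>
  proof -
    have "s \<sigma> (assemble \<phi>) = scl Y c (\<Sum>p\<in>carrier G. l (\<sigma> p) (\<phi> p))"
      using \<phi> \<sigma>
      by (simp add: assemble_def c_def Y.linear_map_scl[OF s_linear] Y.linear_map_sum[OF s_linear]
          Y.sum_mem s_l fixed_s[OF maps_fixed])
    hence "r (\<sigma> k) (s \<sigma> (assemble \<phi>)) = scl Y c (\<Sum>p\<in>carrier G. l (\<sigma> p) (l (\<sigma> k) (\<phi> p)))"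
      using \<phi> \<sigma> k
      by (simp add: Y.linear_map_scl[OF r_linear] Y.linear_map_sum[OF r_linear] Y.sum_mem
          fixed_r[OF maps_fixed] flip: l_r_commute)
    hence "l (inv (\<sigma> g)) (r (\<sigma> k) (s \<sigma> (assemble \<phi>)))
        = scl Y c (\<Sum>p\<in>carrier G. l (\<sigma> (inv g \<otimes> p \<otimes> k)) (\<phi> p))"
      using \<phi> \<sigma> g k
      by (simp add: Y.linear_map_scl[OF l_linear] Y.linear_map_sum[OF l_linear] Y.sum_mem
          \<Gamma>_mult \<Gamma>_inv l_mult)
    also have "(\<Sum>p\<in>carrier G. l (\<sigma> (inv g \<otimes> p \<otimes> k)) (\<phi> p))
        = (\<Sum>m\<in>carrier G. l (\<sigma> m) (\<phi> (g \<otimes> m \<otimes> inv k)))"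
      using g k
      by (intro sum.reindex_bij_witness[of _ "\<lambda>m. g \<otimes> m \<otimes> inv k" "\<lambda>p. inv g \<otimes> p \<otimes> k"])
        (simp_all add: m_assoc)
    finally show ?thesis .
  qed
  have "(\<Sum>\<sigma>\<in>\<Gamma>. l (inv (\<sigma> g)) (r (\<sigma> k) (s \<sigma> (assemble \<phi>))))
      = scl Y c (\<Sum>m\<in>carrier G. \<Sum>\<sigma>\<in>\<Gamma>. l (\<sigma> m) (\<phi> (g \<otimes> m \<otimes> inv k)))"
    by (simp add: orbit_term sum.swap[of _ \<Gamma>] flip: Y.vs.scale_sum_right)
  also have "(\<Sum>m\<in>carrier G. \<Sum>\<sigma>\<in>\<Gamma>. l (\<sigma> m) (\<phi> (g \<otimes> m \<otimes> inv k)))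
      = (\<Sum>m\<in>H. \<Sum>\<sigma>\<in>\<Gamma>. l (\<sigma> m) (\<phi> (g \<otimes> m \<otimes> inv k)))"
  proof (rule sum.mono_neutral_right)
    show "\<forall>m\<in>carrier G - H. (\<Sum>\<sigma>\<in>\<Gamma>. l (\<sigma> m) (\<phi> (g \<otimes> m \<otimes> inv k))) = 0"
      using \<phi> g k by (simp add: orbit_sum_zero)
  qed (auto simp: finite_carrier)
  also have "\<dots> = (\<Sum>m\<in>H. \<Sum>\<sigma>\<in>\<Gamma>. \<phi> (g \<otimes> inv k))"
  proof (intro sum.cong refl)
    fix m \<sigma> assume m: "m \<in> H" and \<sigma>: "\<sigma> \<in> \<Gamma>"
    have "g \<otimes> m \<otimes> inv k = g \<otimes> inv k \<otimes> m"
      using g k m H_comm[of m "inv k"] by (simp add: m_assoc)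
    thus "l (\<sigma> m) (\<phi> (g \<otimes> m \<otimes> inv k)) = \<phi> (g \<otimes> inv k)"
      using \<phi> g k m \<sigma> l_mult[of m "inv m" "\<phi> (g \<otimes> inv k)"] by (simp add: maps_H)
  qed
  also have "scl Y c \<dots> = scl Y (of_nat (card \<Gamma>)) (\<phi> (g \<otimes> inv k))"
    using of_nat_card_H by (simp add: Y.sum_const_scl finite_\<Gamma> finite_H c_def)
  finally show ?thesis by simp
qed

lemma assemble_surj:
  assumes y: "y \<in> carrier Y"
  shows "y \<in> assemble ` maps"
proof -
  define c :: 'f where "c = of_nat (card H) / of_nat (card (carrier G))"
  define \<phi> where "\<phi> g = (if g \<in> carrier G then scl Y c (\<Sum>\<sigma>\<in>\<Gamma>. s \<sigma> (l (inv g) y)) else 0)" for g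
  have avg: "s \<tau> (\<Sum>\<sigma>\<in>\<Gamma>. s \<sigma> z) = (\<Sum>\<sigma>\<in>\<Gamma>. s \<sigma> z)" if "z \<in> carrier Y" "\<tau> \<in> \<Gamma>" for z \<tau>
    using that sum_\<Gamma>_mult_left[of \<tau> "\<lambda>\<sigma>. s \<sigma> z"]
    by (simp add: Y.linear_map_sum[OF s_linear] flip: s_mult)
  have "\<phi> \<in> maps"
    unfolding equivariant_maps_def
  proof (intro CollectI conjI ballI allI impI)
    fix g assume "g \<notin> carrier G" thus "\<phi> g = 0" by (simp add: \<phi>_def)
  next
    fix g assume g: "g \<in> carrier G"
    show "\<phi> g \<in> carrier fixed"
      using g y by (simp add: \<phi>_def fixed_iff avg Y.sum_mem Y.linear_map_scl[OF s_linear])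
    fix h assume h: "h \<in> H"
    have "s \<sigma> (l (inv (g \<otimes> h)) y) = l (inv h) (s \<sigma> (l (inv g) y))" if "\<sigma> \<in> \<Gamma>" for \<sigma>
      using that g h y by (simp add: inv_mult_group l_mult s_l)
    thus "\<phi> (g \<otimes> h) = l (inv h) (\<phi> g)"
      using g h y
      by (simp add: \<phi>_def Y.sum_mem Y.linear_map_scl[OF l_linear] Y.linear_map_sum[OF l_linear])
  qed
  moreover have "assemble \<phi> = y"
  proof -
    have "(\<Sum>g\<in>carrier G. l g (\<phi> g)) = (\<Sum>g\<in>carrier G. scl Y c (\<Sum>\<sigma>\<in>\<Gamma>. l (g \<otimes> \<sigma> (inv g)) (s \<sigma> y)))"
      using y
      by (simp add: \<phi>_def Y.linear_map_scl[OF l_linear] Y.linear_map_sum[OF l_linear] Y.sum_mem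
          l_mult s_l)
    also have "\<dots> = scl Y c (\<Sum>\<sigma>\<in>\<Gamma>. \<Sum>g\<in>carrier G. l (g \<otimes> \<sigma> (inv g)) (s \<sigma> y))"
      by (simp add: sum.swap[of _ \<Gamma>] flip: Y.vs.scale_sum_right)
    also have "(\<Sum>\<sigma>\<in>\<Gamma>. \<Sum>g\<in>carrier G. l (g \<otimes> \<sigma> (inv g)) (s \<sigma> y))
        = (\<Sum>\<sigma>\<in>\<Gamma>. \<Sum>g\<in>carrier G. l (inv g \<otimes> \<sigma> g) (s \<sigma> y))"
      using sum_inv[of "\<lambda>g. l (g \<otimes> \<sigma> (inv g)) (s \<sigma> y)" for \<sigma>] by (simp cong: sum.cong)
    also have "\<dots> = (\<Sum>\<sigma>\<in>{\<one>\<^bsub>AutoGroup G\<^esub>}. \<Sum>g\<in>carrier G. l (inv g \<otimes> \<sigma> g) (s \<sigma> y))"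
      using y by (intro sum.mono_neutral_right finite_\<Gamma>) (auto simp: displacement_sum_zero)
    also have "\<dots> = scl Y (of_nat (card (carrier G))) y"
    proof -
      have "\<one>\<^bsub>AutoGroup G\<^esub> g = g" if "g \<in> carrier G" for g
        using that by (simp add: one_Auto)
      thus ?thesis using y by (simp add: s_one Y.sum_const_scl[OF finite_carrier])
    qed
    also have "scl Y c \<dots> = scl Y (of_nat (card H)) y"
      using card_carrier_pos by (simp add: c_def)
    finally show ?thesis
      using of_nat_card_H by (simp add: assemble_def)
  qed
  ultimately show ?thesis by blast
qed

end

section \<open>The isometry\<close>

context aligned_space
begin

text \<open>
  Under the representation on \<open>\<K>\<close>, the block matrices \<open>(\<phi> (g k\<^sup>-\<^sup>1))\<close> and the assembled elements
  have the same norm up to the factor \<open>card H\<close>. Compressing the block matrix to the families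
  \<open>k \<mapsto> k\<^sup>-\<^sup>1 \<xi>\<close> yields the assembled element. Conversely, by Fourier inversion the orbit transform
  compresses the diagonal matrix of all \<open>\<sigma>(y)\<close>, whose norm is that of \<open>y\<close>, to the block matrix.
\<close>

lemma bounded_by_assemble_iff:
  fixes \<phi> :: "nat \<Rightarrow> nat \<Rightarrow> 'g \<Rightarrow> 'y"
  assumes \<phi>: "\<And>i j. \<lbrakk>i < n; j < n\<rbrakk> \<Longrightarrow> \<phi> i j \<in> maps" and C: "0 \<le> C"
  shows "bounded_by \<K> ({..<n} \<times> carrier G) ({..<n} \<times> carrier G)
      (\<lambda>p q. \<pi> (\<phi> (fst p) (fst q) (snd p \<otimes> inv (snd q)))) (of_nat (card H) * C) \<longleftrightarrow>
    bounded_by \<K> {..<n} {..<n} (\<lambda>i j. \<pi> (assemble (\<phi> i j))) C"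
    (is "?L \<longleftrightarrow> ?R")
proof -
  define m :: real where "m = of_nat (card H)"
  have m: "m > 0" using card_H_pos by (simp add: m_def)
  define y where "y i j = assemble (\<phi> i j)" for i j
  have y: "y i j \<in> carrier Y" if "i < n" "j < n" for i j
    using that \<phi> by (simp add: y_def)
  define T where
    "T \<xi> i g = (\<Sum>j<n. \<Sum>k\<in>carrier G. \<pi> (\<phi> i j (g \<otimes> inv k)) (\<xi> (j, k)))" for \<xi> i g
  have L_iff: "?L \<longleftrightarrow> (\<forall>\<xi>. (\<forall>q\<in>{..<n} \<times> carrier G. \<xi> q \<in> carrier \<K>) \<longrightarrow>
      (\<Sum>i<n. \<Sum>g\<in>carrier G. (hnorm \<K> (T \<xi> i g))\<^sup>2)
        \<le> (m * C)\<^sup>2 * (\<Sum>j<n. \<Sum>k\<in>carrier G. (hnorm \<K> (\<xi> (j, k)))\<^sup>2))"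
    unfolding bounded_by_def T_def m_def by (simp add: sum.cartesian_product')
  show ?thesis
  proof
    assume L: ?L
    show ?R
      unfolding bounded_by_def y_def[symmetric]
    proof (intro allI impI)
      fix \<xi> :: "nat \<Rightarrow> 'h" assume \<xi>: "\<forall>j\<in>{..<n}. \<xi> j \<in> carrier \<K>"
      define \<eta> where "\<eta> = (\<lambda>q. \<Theta> (inv (snd q)) (\<xi> (fst q)))"
      define R where "R i = (\<Sum>j<n. \<pi> (y i j) (\<xi> j))" for i
      have R_mem: "R i \<in> carrier \<K>" if "i < n" for i
        unfolding R_def using that \<xi> y by (intro K.sum_mem) auto
      have T\<eta>: "T \<eta> i g = scl \<K> (of_nat (card H)) (\<Theta> (inv g) (R i))"
        if i: "i < n" and g: "g \<in> carrier G" for i g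
      proof -
        have "(\<Sum>k\<in>carrier G. \<pi> (\<phi> i j (g \<otimes> inv k)) (\<eta> (j, k)))
            = scl \<K> (of_nat (card H)) (\<Theta> (inv g) (\<pi> (y i j) (\<xi> j)))" if j: "j < n" for j
        proof -
          define F where "F u = \<pi> (l (inv g) (l u (\<phi> i j u))) (\<xi> j)" for u
          note \<phi>' = \<phi>[OF i j]
          have "\<pi> (\<phi> i j (g \<otimes> inv k)) (\<eta> (j, k)) = F (g \<otimes> inv k)" if k: "k \<in> carrier G" for k
          proof -
            let ?x = "\<phi> i j (g \<otimes> inv k)"
            have "\<pi> ?x (\<eta> (j, k)) = \<pi> (r (inv k) ?x) (\<xi> j)"
              using \<phi>' g k by (simp add: \<pi>_r \<eta>_def)
            also have "r (inv k) ?x = l (inv g \<otimes> (g \<otimes> inv k)) ?x"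
              using \<phi>' g k by (simp add: fixed_r[OF maps_fixed])
            also have "\<dots> = l (inv g) (l (g \<otimes> inv k) ?x)"
              using \<phi>' g k by (intro l_mult) simp_all
            finally show ?thesis by (simp add: F_def)
          qed
          hence "(\<Sum>k\<in>carrier G. \<pi> (\<phi> i j (g \<otimes> inv k)) (\<eta> (j, k))) = (\<Sum>k\<in>carrier G. F (g \<otimes> inv k))"
            by simp
          also have "\<dots> = (\<Sum>u\<in>carrier G. F u)"
            using sum_inv[of "\<lambda>k. F (g \<otimes> k)"] sum_mult_left[OF g, of F] by simp
          also have "\<dots> = \<pi> (l (inv g) (\<Sum>u\<in>carrier G. l u (\<phi> i j u))) (\<xi> j)"
            using \<phi>' g by (simp add: F_def Y.linear_map_sum[OF l_linear] \<pi>_sum)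
          also have "\<dots> = scl \<K> (of_nat (card H)) (\<Theta> (inv g) (\<pi> (y i j) (\<xi> j)))"
            using \<phi>' g y[OF i j]
            by (simp add: y_def \<pi>_l \<pi>_scl Y.linear_map_scl[OF l_linear] flip: scl_assemble)
          finally show ?thesis .
        qed
        moreover have "\<pi> (y i j) (\<xi> j) \<in> carrier \<K>" if "j \<in> {..<n}" for j
          using that i \<xi> y by auto
        ultimately show ?thesis
          using g \<Theta>_sum[of "inv g" "{..<n}" "\<lambda>j. \<pi> (y i j) (\<xi> j)"]
          by (simp add: T_def R_def K.vs.scale_sum_right)
      qed
      have "(\<Sum>i<n. \<Sum>g\<in>carrier G. (hnorm \<K> (T \<eta> i g))\<^sup>2)
          \<le> (m * C)\<^sup>2 * (\<Sum>j<n. \<Sum>k\<in>carrier G. (hnorm \<K> (\<eta> (j, k)))\<^sup>2)"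
        using L[unfolded L_iff, rule_format, of \<eta>] \<xi> by (auto simp: \<eta>_def)
      moreover have "(\<Sum>i<n. \<Sum>g\<in>carrier G. (hnorm \<K> (T \<eta> i g))\<^sup>2)
          = of_nat (card (carrier G)) * m\<^sup>2 * (\<Sum>i<n. (hnorm \<K> (R i))\<^sup>2)"
        using R_mem by (simp add: T\<eta> K.hnorm_scl power_mult_distrib m_def sum_distrib_left mult_ac)
      moreover have "(\<Sum>j<n. \<Sum>k\<in>carrier G. (hnorm \<K> (\<eta> (j, k)))\<^sup>2)
          = of_nat (card (carrier G)) * (\<Sum>j<n. (hnorm \<K> (\<xi> j))\<^sup>2)"
        using \<xi> by (simp add: \<eta>_def sum_distrib_left)
      ultimately have "of_nat (card (carrier G)) * m\<^sup>2 * (\<Sum>i<n. (hnorm \<K> (R i))\<^sup>2)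
          \<le> of_nat (card (carrier G)) * m\<^sup>2 * (C\<^sup>2 * (\<Sum>j<n. (hnorm \<K> (\<xi> j))\<^sup>2))"
        by (simp only: power_mult_distrib mult_ac)
      thus "(\<Sum>i<n. (hnorm \<K> (\<Sum>j<n. \<pi> (y i j) (\<xi> j)))\<^sup>2) \<le> C\<^sup>2 * (\<Sum>j<n. (hnorm \<K> (\<xi> j))\<^sup>2)"
        using card_carrier_pos m unfolding R_def
        by (subst (asm) mult_le_cancel_left_pos) simp_all
    qed
  next
    assume R: ?R
    have Rs: "bounded_by \<K> {..<n} {..<n} (\<lambda>i j. \<pi> (s \<sigma> (y i j))) C" if \<sigma>: "\<sigma> \<in> \<Gamma>" for \<sigma>
    proof -
      define A where "A = mat n n (\<lambda>(i, j). y i j)"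
      have A: "A \<in> mats Y n" "map_mat (s \<sigma>) A \<in> mats Y n"
        using y \<sigma> by (auto simp: A_def mats_iff)
      have "mnorm Y A \<le> C"
        using R C unfolding K.mnorm_le_iff[OF \<pi> A(1)]
        by (subst bounded_by_cong[where F' = "\<lambda>i j. \<pi> (y i j)"]) (simp_all add: A_def y_def)
      hence "mnorm Y (map_mat (s \<sigma>) A) \<le> C"
        using complete_isometry_mnorm[OF s_isometry[OF \<sigma>] A(1)] by simp
      hence "bounded_by \<K> {..<n} {..<n} (\<lambda>i j. \<pi> (map_mat (s \<sigma>) A $$ (i, j))) C"
        unfolding K.mnorm_le_iff[OF \<pi> A(2)] by simp
      thus ?thesis
        by (subst (asm) bounded_by_cong[where F' = "\<lambda>i j. \<pi> (s \<sigma> (y i j))"]) (simp_all add: A_def)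
    qed
    show ?L
      unfolding L_iff
    proof (intro allI impI)
      fix \<xi> assume \<xi>: "\<forall>q\<in>{..<n} \<times> carrier G. \<xi> q \<in> carrier \<K>"
      define \<zeta> where "\<zeta> = T \<xi>"
      define \<chi> where "\<chi> j k = reduced (\<xi> (j, k))" for j k
      define v where "v \<sigma> j = (\<Sum>k\<in>carrier G. \<Theta> (\<sigma> k) (\<chi> j k))" for \<sigma> j
      define w where "w \<sigma> i = (\<Sum>g\<in>carrier G. \<Theta> (\<sigma> g) (\<zeta> i g))" for \<sigma> i
      define V where "V \<sigma> i = (\<Sum>j<n. \<pi> (s \<sigma> (y i j)) (v \<sigma> j))" for \<sigma> i
      define Z where "Z = (\<Sum>i<n. \<Sum>g\<in>carrier G. (hnorm \<K> (\<zeta> i g))\<^sup>2)"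
      define N where "N = (\<Sum>j<n. \<Sum>k\<in>carrier G. (hnorm \<K> (\<xi> (j, k)))\<^sup>2)"
      define M :: real where "M = of_nat (card \<Gamma>)"
      have M: "M > 0" using card_\<Gamma>_pos by (simp add: M_def)
      have \<chi>_mem: "\<chi> j k \<in> carrier \<K>" if "j < n" "k \<in> carrier G" for j k
        using that \<xi> by (simp add: \<chi>_def)
      have \<zeta>_mem: "\<zeta> i g \<in> carrier \<K>" if "i < n" "g \<in> carrier G" for i g
        unfolding \<zeta>_def T_def using that \<xi> \<phi> by (intro K.sum_mem) auto
      have v_mem: "v \<sigma> j \<in> carrier \<K>" if "\<sigma> \<in> \<Gamma>" "j < n" for \<sigma> j
        unfolding v_def using that \<chi>_mem by (intro K.sum_mem) auto
      have w_mem: "w \<sigma> i \<in> carrier \<K>" if "\<sigma> \<in> \<Gamma>" "i < n" for \<sigma> i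
        unfolding w_def using that \<zeta>_mem by (intro K.sum_mem) auto
      have V_mem: "V \<sigma> i \<in> carrier \<K>" if "\<sigma> \<in> \<Gamma>" "i < n" for \<sigma> i
        unfolding V_def using that v_mem y by (intro K.sum_mem) auto
      have inversion: "scl \<K> (of_nat (card \<Gamma>)) (\<zeta> i g) = (\<Sum>\<sigma>\<in>\<Gamma>. \<Theta> (inv (\<sigma> g)) (V \<sigma> i))"
        if i: "i < n" and g: "g \<in> carrier G" for i g
      proof -
        have "scl \<K> (of_nat (card \<Gamma>)) (\<pi> (\<phi> i j (g \<otimes> inv k)) (\<xi> (j, k)))
            = (\<Sum>\<sigma>\<in>\<Gamma>. \<Theta> (inv (\<sigma> g)) (\<pi> (s \<sigma> (y i j)) (\<Theta> (\<sigma> k) (\<chi> j k))))"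
          if j: "j < n" and k: "k \<in> carrier G" for j k
        proof -
          note \<phi>' = \<phi>[OF i j]
          have "scl \<K> (of_nat (card \<Gamma>)) (\<pi> (\<phi> i j (g \<otimes> inv k)) (\<xi> (j, k)))
              = \<pi> (scl Y (of_nat (card \<Gamma>)) (\<phi> i j (g \<otimes> inv k))) (\<chi> j k)"
            using \<phi>' g k \<xi> j by (simp add: \<pi>_scl \<chi>_def \<pi>_reduced)
          also have "\<dots> = \<pi> (\<Sum>\<sigma>\<in>\<Gamma>. l (inv (\<sigma> g)) (r (\<sigma> k) (s \<sigma> (y i j)))) (\<chi> j k)"
            by (simp only: orbit_average_assemble[OF \<phi>' g k] y_def)
          also have "\<dots> = (\<Sum>\<sigma>\<in>\<Gamma>. \<Theta> (inv (\<sigma> g)) (\<pi> (s \<sigma> (y i j)) (\<Theta> (\<sigma> k) (\<chi> j k))))"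
            using g k y[OF i j] by (simp add: \<pi>_sum \<pi>_l \<pi>_r)
          finally show ?thesis .
        qed
        hence "scl \<K> (of_nat (card \<Gamma>)) (\<zeta> i g)
            = (\<Sum>j<n. \<Sum>k\<in>carrier G. \<Sum>\<sigma>\<in>\<Gamma>.
                \<Theta> (inv (\<sigma> g)) (\<pi> (s \<sigma> (y i j)) (\<Theta> (\<sigma> k) (\<chi> j k))))"
          using g by (simp add: \<zeta>_def T_def K.vs.scale_sum_right)
        also have "\<dots> = (\<Sum>\<sigma>\<in>\<Gamma>. \<Sum>j<n. \<Sum>k\<in>carrier G.
                \<Theta> (inv (\<sigma> g)) (\<pi> (s \<sigma> (y i j)) (\<Theta> (\<sigma> k) (\<chi> j k))))"
          by (simp only: sum.swap[of _ \<Gamma>])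
        also have "\<dots> = (\<Sum>\<sigma>\<in>\<Gamma>. \<Theta> (inv (\<sigma> g)) (V \<sigma> i))"
        proof (rule sum.cong[OF refl])
          fix \<sigma> assume \<sigma>: "\<sigma> \<in> \<Gamma>"
          have "(\<Sum>k\<in>carrier G. \<Theta> (inv (\<sigma> g)) (\<pi> (s \<sigma> (y i j)) (\<Theta> (\<sigma> k) (\<chi> j k))))
              = \<Theta> (inv (\<sigma> g)) (\<pi> (s \<sigma> (y i j)) (v \<sigma> j))" if j: "j < n" for j
            using \<sigma> g j \<chi>_mem y[OF i j]
            by (simp add: v_def K.linear_map_sum[OF \<pi>_op_linear] \<Theta>_sum)
          thus "(\<Sum>j<n. \<Sum>k\<in>carrier G. \<Theta> (inv (\<sigma> g)) (\<pi> (s \<sigma> (y i j)) (\<Theta> (\<sigma> k) (\<chi> j k))))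
              = \<Theta> (inv (\<sigma> g)) (V \<sigma> i)"
            using \<sigma> g v_mem y i \<Theta>_sum[of "inv (\<sigma> g)" "{..<n}" "\<lambda>j. \<pi> (s \<sigma> (y i j)) (v \<sigma> j)"]
            by (simp add: V_def)
        qed
        finally show ?thesis .
      qed
      \<comment> \<open>Pairing \<open>\<zeta>\<close> with itself bounds it through \<open>V\<close> and \<open>w\<close>, so that no adjoint of the transform is needed.\<close>
      have pairing: "of_nat (card \<Gamma>) * ip \<K> (\<zeta> i g) (\<zeta> i g) = (\<Sum>\<sigma>\<in>\<Gamma>. ip \<K> (V \<sigma> i) (\<Theta> (\<sigma> g) (\<zeta> i g)))"
        if i: "i < n" and g: "g \<in> carrier G" for i g
      proof -
        have "of_nat (card \<Gamma>) * ip \<K> (\<zeta> i g) (\<zeta> i g) = ip \<K> (\<Sum>\<sigma>\<in>\<Gamma>. \<Theta> (inv (\<sigma> g)) (V \<sigma> i)) (\<zeta> i g)"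
          using \<zeta>_mem[OF i g] by (simp add: K.ip_scl flip: inversion[OF i g])
        also have "\<dots> = (\<Sum>\<sigma>\<in>\<Gamma>. ip \<K> (V \<sigma> i) (\<Theta> (\<sigma> g) (\<zeta> i g)))"
          using \<zeta>_mem[OF i g] V_mem i g by (simp add: K.ip_sum_left \<Theta>_adjoint)
        finally show ?thesis .
      qed
      have "(of_real (M * Z) :: 'f) = (\<Sum>i<n. \<Sum>g\<in>carrier G. of_nat (card \<Gamma>) * ip \<K> (\<zeta> i g) (\<zeta> i g))"
        using \<zeta>_mem by (simp add: M_def Z_def K.ip_self sum_distrib_left)
      also have "\<dots> = (\<Sum>i<n. \<Sum>\<sigma>\<in>\<Gamma>. \<Sum>g\<in>carrier G. ip \<K> (V \<sigma> i) (\<Theta> (\<sigma> g) (\<zeta> i g)))"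
        by (simp add: pairing sum.swap[of _ \<Gamma>])
      also have "\<dots> = (\<Sum>i<n. \<Sum>\<sigma>\<in>\<Gamma>. ip \<K> (V \<sigma> i) (w \<sigma> i))"
        using V_mem \<zeta>_mem by (simp add: w_def K.ip_sum_right)
      finally have eq: "(of_real (M * Z) :: 'f) = (\<Sum>i<n. \<Sum>\<sigma>\<in>\<Gamma>. ip \<K> (V \<sigma> i) (w \<sigma> i))" .
      have Z0: "0 \<le> Z" by (simp add: Z_def sum_nonneg)
      have N0: "0 \<le> N" by (simp add: N_def sum_nonneg)
      have "M * Z = norm (\<Sum>i<n. \<Sum>\<sigma>\<in>\<Gamma>. ip \<K> (V \<sigma> i) (w \<sigma> i))"
        using M Z0 unfolding eq[symmetric] norm_of_real by simp
      also have "\<dots> \<le> (\<Sum>i<n. \<Sum>\<sigma>\<in>\<Gamma>. hnorm \<K> (V \<sigma> i) * hnorm \<K> (w \<sigma> i))"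
        using V_mem w_mem by (intro sum_norm_le K.norm_ip_le) auto
      also have "\<dots> = (\<Sum>p\<in>{..<n} \<times> \<Gamma>. hnorm \<K> (V (snd p) (fst p)) * hnorm \<K> (w (snd p) (fst p)))"
        by (simp add: sum.cartesian_product')
      finally have "(M * Z)\<^sup>2 \<le> (\<Sum>p\<in>{..<n} \<times> \<Gamma>. hnorm \<K> (V (snd p) (fst p)) * hnorm \<K> (w (snd p) (fst p)))\<^sup>2"
        using M Z0 by (intro power_mono) auto
      also have "\<dots> \<le> (\<Sum>p\<in>{..<n} \<times> \<Gamma>. (hnorm \<K> (V (snd p) (fst p)))\<^sup>2)
          * (\<Sum>p\<in>{..<n} \<times> \<Gamma>. (hnorm \<K> (w (snd p) (fst p)))\<^sup>2)"
        by (rule sum_mult_sq_le)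
      also have "\<dots> \<le> (C\<^sup>2 * (M * m * N)) * (M * m * Z)"
      proof (rule mult_mono)
        have "(\<Sum>p\<in>{..<n} \<times> \<Gamma>. (hnorm \<K> (V (snd p) (fst p)))\<^sup>2) = (\<Sum>\<sigma>\<in>\<Gamma>. \<Sum>i<n. (hnorm \<K> (V \<sigma> i))\<^sup>2)"
          by (simp add: sum.cartesian_product' sum.swap[of _ \<Gamma>])
        also have "\<dots> \<le> (\<Sum>\<sigma>\<in>\<Gamma>. C\<^sup>2 * (\<Sum>j<n. (hnorm \<K> (v \<sigma> j))\<^sup>2))"
          using Rs v_mem unfolding bounded_by_def V_def by (intro sum_mono) auto
        also have "\<dots> = C\<^sup>2 * (\<Sum>j<n. \<Sum>\<sigma>\<in>\<Gamma>. (hnorm \<K> (v \<sigma> j))\<^sup>2)"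
          by (simp add: sum.swap[of _ \<Gamma>] flip: sum_distrib_left)
        also have "\<dots> \<le> C\<^sup>2 * (\<Sum>j<n. M * m * (\<Sum>k\<in>carrier G. (hnorm \<K> (\<chi> j k))\<^sup>2))"
          unfolding v_def M_def m_def using \<chi>_mem \<xi>
          by (intro mult_left_mono sum_mono orbit_transform_bound) (auto simp: \<chi>_def reduced_H_sum)
        also have "\<dots> \<le> C\<^sup>2 * (\<Sum>j<n. M * m * (\<Sum>k\<in>carrier G. (hnorm \<K> (\<xi> (j, k)))\<^sup>2))"
          unfolding \<chi>_def using \<xi> M m
          by (intro mult_left_mono sum_mono power_mono hnorm_reduced_le) auto
        finally show "(\<Sum>p\<in>{..<n} \<times> \<Gamma>. (hnorm \<K> (V (snd p) (fst p)))\<^sup>2) \<le> C\<^sup>2 * (M * m * N)"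
          by (simp add: N_def sum_distrib_left)
        have "(\<Sum>p\<in>{..<n} \<times> \<Gamma>. (hnorm \<K> (w (snd p) (fst p)))\<^sup>2) = (\<Sum>i<n. \<Sum>\<sigma>\<in>\<Gamma>. (hnorm \<K> (w \<sigma> i))\<^sup>2)"
          by (simp add: sum.cartesian_product')
        also have "\<dots> \<le> (\<Sum>i<n. M * m * (\<Sum>g\<in>carrier G. (hnorm \<K> (\<zeta> i g))\<^sup>2))"
        proof (rule sum_mono)
          fix i assume "i \<in> {..<n}"
          hence i: "i < n" by simp
          have "(\<Sum>h\<in>H. \<Theta> h (\<zeta> i g)) = 0" if g: "g \<in> carrier G" for g
          proof -
            have "(\<Sum>h\<in>H. \<Theta> h (\<zeta> i g))
                = (\<Sum>j<n. \<Sum>k\<in>carrier G. \<Sum>h\<in>H. \<Theta> h (\<pi> (\<phi> i j (g \<otimes> inv k)) (\<xi> (j, k))))"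
            proof -
              let ?z = "\<lambda>j k. \<pi> (\<phi> i j (g \<otimes> inv k)) (\<xi> (j, k))"
              have z: "?z j k \<in> carrier \<K>" if "j \<in> {..<n}" "k \<in> carrier G" for j k
                using that i g \<xi> \<phi> by auto
              have "\<Theta> h (\<zeta> i g) = (\<Sum>j<n. \<Sum>k\<in>carrier G. \<Theta> h (?z j k))" if h: "h \<in> H" for h
              proof -
                have "\<Theta> h (\<zeta> i g) = (\<Sum>j<n. \<Theta> h (\<Sum>k\<in>carrier G. ?z j k))"
                  unfolding \<zeta>_def T_def using h z by (intro \<Theta>_sum K.sum_mem) auto
                also have "\<dots> = (\<Sum>j<n. \<Sum>k\<in>carrier G. \<Theta> h (?z j k))"
                  using h z by (intro sum.cong refl \<Theta>_sum) auto
                finally show ?thesis .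
              qed
              thus ?thesis by (simp add: sum.swap[of _ H])
            qed
            also have "\<dots> = 0" using i g \<phi> by (simp add: \<pi>_H_sum)
            finally show ?thesis .
          qed
          with \<zeta>_mem[OF i]
          show "(\<Sum>\<sigma>\<in>\<Gamma>. (hnorm \<K> (w \<sigma> i))\<^sup>2) \<le> M * m * (\<Sum>g\<in>carrier G. (hnorm \<K> (\<zeta> i g))\<^sup>2)"
            unfolding w_def M_def m_def by (intro orbit_transform_bound)
        qed
        finally show "(\<Sum>p\<in>{..<n} \<times> \<Gamma>. (hnorm \<K> (w (snd p) (fst p)))\<^sup>2) \<le> M * m * Z"
          by (simp add: Z_def sum_distrib_left)
      qed (use N0 M m in \<open>simp_all add: sum_nonneg\<close>)
      finally have "(M\<^sup>2 * Z) * Z \<le> (M\<^sup>2 * Z) * ((m * C)\<^sup>2 * N)"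
        by (simp only: power_mult_distrib power2_eq_square mult_ac)
      hence "Z \<le> (m * C)\<^sup>2 * N"
      proof (cases "Z = 0")
        case False
        with Z0 M have "M\<^sup>2 * Z > 0" by simp
        with \<open>(M\<^sup>2 * Z) * Z \<le> (M\<^sup>2 * Z) * ((m * C)\<^sup>2 * N)\<close> show ?thesis
          by (simp only: mult_le_cancel_left_pos)
      qed (use N0 in simp)
      thus "(\<Sum>i<n. \<Sum>g\<in>carrier G. (hnorm \<K> (T \<xi> i g))\<^sup>2)
          \<le> (m * C)\<^sup>2 * (\<Sum>j<n. \<Sum>k\<in>carrier G. (hnorm \<K> (\<xi> (j, k)))\<^sup>2)"
        by (simp only: Z_def N_def \<zeta>_def)
    qed
  qed
qed

text \<open>
  The chain of equal norms, up to the factor \<open>card H\<close>: a matrix over the induced space, the block matrix over \<open>X\<close> that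
  computes its norm in the given representation, the same block matrix in the representation on
  \<open>\<K>\<close>, and the assembled matrix over \<open>Y\<close>.
\<close>

lemma complete_isometry_assemble:
  fixes \<H> :: "('f, 'i::ab_group_add) hilb"
  assumes rep: "central_representation (G\<lparr>carrier := H\<rparr>) fixed l \<H> \<rho> \<theta>"
  shows "complete_isometry (induced_space G H fixed l \<H> \<rho> \<theta>) Y assemble"
proof (rule complete_isometryI[OF linear_map_assemble])
  let ?XG = "induced_space G H fixed l \<H> \<rho> \<theta>"
  have hilb: "hilbert_space \<H>" and \<rho>: "complete_isometry fixed (bounded_ops \<H>) \<rho>"
    and \<theta>: "unitary_rep (G\<lparr>carrier := H\<rparr>) \<H> \<theta>"
    using rep unfolding central_representation_def by blast+
  have \<rho>_l: "\<rho> (l h x) = \<theta> h \<circ> \<rho> x" "\<theta> h \<circ> \<rho> x = \<rho> x \<circ> \<theta> h"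
    if "h \<in> H" "x \<in> carrier fixed" for h x
  proof -
    have "\<forall>h\<in>carrier (G\<lparr>carrier := H\<rparr>). \<forall>x\<in>carrier fixed.
        \<rho> (l h x) = \<theta> h \<circ> \<rho> x \<and> \<rho> (l h x) = \<rho> x \<circ> \<theta> h"
      using rep unfolding central_representation_def by blast
    hence "\<rho> (l h x) = \<theta> h \<circ> \<rho> x \<and> \<rho> (l h x) = \<rho> x \<circ> \<theta> h"
      using that by fastforce
    thus "\<rho> (l h x) = \<theta> h \<circ> \<rho> x" "\<theta> h \<circ> \<rho> x = \<rho> x \<circ> \<theta> h" by auto
  qed
  interpret R: induced_representation G H \<H> \<theta>
  proof (intro induced_representation.intro unitary_representation.intro
      unitary_representation_axioms.intro)
    show "central_subgroup G H" by (rule central_subgroup_axioms)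
    show "inner_space \<H>" using hilb by (rule hilbert_space_imp_inner_space)
    show "group (G\<lparr>carrier := H\<rparr>)" using subgroup_H is_group by (rule subgroup.subgroup_is_group)
  qed (fact \<theta>)
  interpret I: inner_space R.ind by (rule R.inner_space_ind)
  have \<rho>_op: "\<rho> x \<in> carrier (bounded_ops \<H>)" if "x \<in> carrier fixed" for x
    using that \<rho> by (auto simp: complete_isometry_def linear_map_def)
  have equivariant: "R.equivariant_ops (\<rho> \<circ> \<phi>)" if \<phi>: "\<phi> \<in> maps" for \<phi>
    unfolding R.equivariant_ops_def
  proof (intro conjI ballI)
    fix g assume g: "g \<in> carrier G"
    show "linear_map \<H> \<H> ((\<rho> \<circ> \<phi>) g)"
      using R.bounded_ops_linear[OF \<rho>_op[OF maps_fixed[OF \<phi> g]]] by simp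
    fix h \<xi> assume h: "h \<in> H"
    note * = \<rho>_l[OF H_inv[OF h] maps_fixed[OF \<phi> g], unfolded fun_eq_iff comp_apply, rule_format]
    show "(\<rho> \<circ> \<phi>) (g \<otimes> h) \<xi> = (\<rho> \<circ> \<phi>) g (\<theta> (inv h) \<xi>)"
      using *(1)[of \<xi>] *(2)[of \<xi>] by (simp add: maps_H[OF \<phi> g h])
    show "\<theta> (inv h) ((\<rho> \<circ> \<phi>) g \<xi>) = (\<rho> \<circ> \<phi>) g (\<theta> (inv h) \<xi>)"
      using *(2)[of \<xi>] by simp
  qed
  fix n A assume A: "A \<in> mats ?XG n"
  define \<phi> where "\<phi> i j = A $$ (i, j)" for i j
  have dim: "dim_row A = n" "dim_col A = n" using A by (auto simp: mats_iff)
  have \<phi>: "\<phi> i j \<in> maps" if "i < n" "j < n" for i j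
    using mats_entry[OF A that] by (simp add: \<phi>_def induced_space_def)
  define J where "J = {..<n} \<times> carrier G"
  define B where "B p q = \<phi> (fst p) (fst q) (snd p \<otimes> inv (snd q))" for p q
  have B: "B p q \<in> carrier fixed" if "p \<in> J" "q \<in> J" for p q
    using that \<phi> by (auto simp: B_def J_def intro!: maps_fixed)
  have "finite J" using finite_carrier by (simp add: J_def)
  then obtain b where b: "bij_betw b {..<card J} J"
    using ex_bij_betw_nat_finite by (metis atLeast0LessThan)
  \<comment> \<open>The block matrix \<open>B\<close>, flattened along an enumeration of its index set.\<close>
  define D where "D = mat (card J) (card J) (\<lambda>(p, q). B (b p) (b q))"
  have bJ: "b p \<in> J" if "p < card J" for p using b that by (auto simp: bij_betw_def)
  have D: "D \<in> mats fixed (card J)" using B bJ by (auto simp: D_def mats_iff)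
  have norm_D: "mnorm Y D \<le> C \<longleftrightarrow> 0 \<le> C \<and> bounded_by \<L> J J (\<lambda>p q. \<tau> (B p q)) C"
    if \<tau>: "complete_isometry fixed (bounded_ops \<L>) \<tau>" and \<L>: "inner_space \<L>"
    for \<L> :: "('f, 'z::ab_group_add) hilb" and \<tau> C
  proof -
    have "mnorm Y D \<le> C \<longleftrightarrow> 0 \<le> C \<and>
        bounded_by \<L> {..<card J} {..<card J} (\<lambda>p q. \<tau> (D $$ (p, q))) C"
      using inner_space.mnorm_le_iff[OF \<L> \<tau> D] by simp
    also have "bounded_by \<L> {..<card J} {..<card J} (\<lambda>p q. \<tau> (D $$ (p, q))) C \<longleftrightarrow>
        bounded_by \<L> {..<card J} {..<card J} (\<lambda>p q. \<tau> (B (b p) (b q))) C"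
      by (intro bounded_by_cong) (simp add: D_def)
    also have "\<dots> \<longleftrightarrow> bounded_by \<L> J J (\<lambda>p q. \<tau> (B p q)) C"
      by (rule bounded_by_reindex[OF b b])
    finally show ?thesis .
  qed
  have fixed_K: "complete_isometry fixed (bounded_ops \<K>) \<pi>"
    using complete_isometry_mnorm[OF \<pi> mats_fixed] \<pi>_linear
    by (intro complete_isometryI) (auto simp: linear_map_def fixed_mem)
  have conv_iff: "mnorm ?XG A \<le> C \<longleftrightarrow> 0 \<le> C \<and>
      bounded_by R.ind {..<n} {..<n} (\<lambda>i j. conv_op G H \<H> \<theta> (\<rho> \<circ> \<phi> i j)) C" for C
  proof -
    define M where "M = map_mat (\<lambda>\<phi>. conv_op G H \<H> \<theta> (\<rho> \<circ> \<phi>)) A"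
    have M: "dim_row M = n" "dim_col M = n"
      "\<And>i j. \<lbrakk>i < n; j < n\<rbrakk> \<Longrightarrow> M $$ (i, j) = conv_op G H \<H> \<theta> (\<rho> \<circ> \<phi> i j)"
      using dim by (simp_all add: M_def \<phi>_def)
    have cong: "bounded_by R.ind {..<n} {..<n} (\<lambda>i j. M $$ (i, j)) E \<longleftrightarrow>
        bounded_by R.ind {..<n} {..<n} (\<lambda>i j. conv_op G H \<H> \<theta> (\<rho> \<circ> \<phi> i j)) E" for E
      by (intro bounded_by_cong) (simp add: M)
    obtain E where E: "bounded_by \<H> J J (\<lambda>p q. \<rho> (B p q)) E"
      using R.bounded_ops_bounded_by[OF \<open>finite J\<close> \<open>finite J\<close>, of "\<lambda>p q. \<rho> (B p q)"] \<rho>_op B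
      by blast
    have "bounded_by R.ind {..<n} {..<n} (\<lambda>i j. M $$ (i, j)) (E / of_nat (card H))"
      unfolding cong using E card_H_pos equivariant \<phi>
      by (subst R.bounded_by_conv_op_iff) (simp_all add: B_def J_def)
    hence "opnorm R.ind M \<le> C \<longleftrightarrow> 0 \<le> C \<and> bounded_by R.ind {..<n} {..<n} (\<lambda>i j. M $$ (i, j)) C"
      using I.opnorm_le_iff[of M "E / of_nat (card H)" C] R.conv_op_linear[OF equivariant[OF \<phi>]]
      by (simp add: M)
    moreover have "mnorm ?XG A = opnorm R.ind M"
      by (simp add: induced_space_def bounded_ops_def M_def)
    ultimately show ?thesis by (simp add: cong)
  qed
  have scale: "0 \<le> of_nat (card H) * C \<longleftrightarrow> 0 \<le> C" for C :: real
    using card_H_pos by (simp add: zero_le_mult_iff)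
  have "mnorm Y (map_mat assemble A) \<le> C \<longleftrightarrow> mnorm ?XG A \<le> C" for C
  proof -
    have map_A: "map_mat assemble A \<in> mats Y n"
      using dim \<phi> by (auto simp: mats_iff \<phi>_def)
    have "mnorm ?XG A \<le> C \<longleftrightarrow>
        0 \<le> C \<and> bounded_by \<H> J J (\<lambda>p q. \<rho> (B p q)) (of_nat (card H) * C)"
      unfolding conv_iff using equivariant \<phi>
      by (subst R.bounded_by_conv_op_iff) (simp_all add: B_def J_def)
    also have "\<dots> \<longleftrightarrow> mnorm Y D \<le> of_nat (card H) * C"
      using norm_D[OF \<rho> R.inner_space_axioms] by (simp add: scale)
    also have "\<dots> \<longleftrightarrow> 0 \<le> C \<and> bounded_by \<K> J J (\<lambda>p q. \<pi> (B p q)) (of_nat (card H) * C)"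
      using norm_D[OF fixed_K K.inner_space_axioms] by (simp add: scale)
    also have "\<dots> \<longleftrightarrow> 0 \<le> C \<and> bounded_by \<K> {..<n} {..<n} (\<lambda>i j. \<pi> (assemble (\<phi> i j))) C"
      using bounded_by_assemble_iff[of n \<phi> C] \<phi> by (auto simp: B_def J_def)
    also have "\<dots> \<longleftrightarrow> mnorm Y (map_mat assemble A) \<le> C"
      unfolding K.mnorm_le_iff[OF \<pi> map_A] using dim
      by (intro conj_cong refl bounded_by_cong) (simp add: \<phi>_def)
    finally show ?thesis by blast
  qed
  \<comment> \<open>The two norms have the same upper bounds.\<close>
  thus "mnorm Y (map_mat assemble A) = mnorm ?XG A"
    by (intro antisym) (metis order_refl)+
qed

end

theorem theorem7p3:
  fixes G :: "('g, 'k) monoid_scheme" and H :: "'g set"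
    and Y :: "('f::real_or_complex, 'y::ab_group_add) opsp"
    and l r :: "'g \<Rightarrow> 'y \<Rightarrow> 'y"
  assumes "group G" and "finite (carrier G)"
    and "subgroup H G" and "H \<subseteq> group_center G"
    and "modular_operator_space TYPE('h::ab_group_add) G Y l r"
    and "\<exists>\<Gamma>. balanced G H \<Gamma> \<and> aligned G H \<Gamma> Y l r"
  shows "\<exists>(X :: ('f, 'y) opsp) a.
    central_modular_operator_space TYPE('h) (G\<lparr>carrier := H\<rparr>) X a \<and>
    (\<exists>j. \<forall>(\<H> :: ('f, 'h) hilb) \<rho> \<theta>.
       central_representation (G\<lparr>carrier := H\<rparr>) X a \<H> \<rho> \<theta> \<longrightarrow>
       (let XG = induced_space G H X a \<H> \<rho> \<theta>
        in complete_isometry XG Y j \<and> j ` carrier XG = carrier Y \<and>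
           (\<forall>g\<in>carrier G. \<forall>\<phi>\<in>carrier XG.
              j (induced_left G g \<phi>) = l g (j \<phi>) \<and> j (induced_right G g \<phi>) = r g (j \<phi>))))"
proof -
  from assms(6) obtain \<Gamma> where balanced: "balanced G H \<Gamma>" and aligned: "aligned G H \<Gamma> Y l r"
    by blast
  from assms(5) obtain \<K> :: "('f, 'h) hilb" and \<pi> \<Theta> where
    Y: "operator_space Y" "left_action G Y l" "right_action G Y r" and
    K: "hilbert_space \<K>" "complete_isometry Y (bounded_ops \<K>) \<pi>" "unitary_rep G \<K> \<Theta>" and
    \<pi>: "\<forall>g\<in>carrier G. \<forall>y\<in>carrier Y. \<pi> (l g y) = \<Theta> g \<circ> \<pi> y \<and> \<pi> (r g y) = \<pi> y \<circ> \<Theta> g"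
    unfolding modular_operator_space_def by blast
  from aligned obtain s where
    erg: "ergodic_on H Y l"
      "\<forall>\<sigma>\<in>\<Gamma>. \<sigma> \<noteq> \<one>\<^bsub>AutoGroup G\<^esub> \<longrightarrow> ergodic_on (displacement G \<sigma>) Y l" and
    s: "left_action (AutoGroup G\<lparr>carrier := \<Gamma>\<rparr>) Y s"
      "\<forall>\<sigma>\<in>\<Gamma>. \<forall>g\<in>carrier G. \<forall>y\<in>carrier Y. s \<sigma> (l g y) = l (\<sigma> g) (s \<sigma> y)"
      "\<forall>g\<in>carrier G. \<forall>y\<in>carrier Y. s (inner_auto G g) y = r (inv\<^bsub>G\<^esub> g) (l g y)"
    unfolding aligned_def by blast
  interpret aligned_space G H \<Gamma> \<K> \<Theta> Y l r \<pi> s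
  proof (intro aligned_space.intro balanced_pair.intro central_subgroup.intro
      unitary_representation.intro)
    show "inner_space \<K>" using K(1) by (rule hilbert_space_imp_inner_space)
    show "aligned_space_axioms G H \<Gamma> \<K> \<Theta> Y l r \<pi> s"
      by unfold_locales (use Y K \<pi> erg s in blast)+
  qed (use assms(1-4) balanced K(3) in \<open>simp_all add: central_subgroup_axioms_def
      balanced_pair_axioms_def unitary_representation_axioms_def\<close>)
  show ?thesis
  proof (intro exI conjI allI impI)
    show "central_modular_operator_space TYPE('h) (G\<lparr>carrier := H\<rparr>) fixed l"
      unfolding central_modular_operator_space_def
      using operator_space_fixed left_action_fixed central_representation_fixed[OF K(1)] by blast
    fix \<H> :: "('f, 'h) hilb" and \<rho> \<theta>
    assume rep: "central_representation (G\<lparr>carrier := H\<rparr>) fixed l \<H> \<rho> \<theta>"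
    have "carrier (induced_space G H fixed l \<H> \<rho> \<theta>) = maps"
      by (simp add: induced_space_def)
    thus "let XG = induced_space G H fixed l \<H> \<rho> \<theta>
      in complete_isometry XG Y assemble \<and> assemble ` carrier XG = carrier Y \<and>
         (\<forall>g\<in>carrier G. \<forall>\<phi>\<in>carrier XG.
            assemble (induced_left G g \<phi>) = l g (assemble \<phi>) \<and>
            assemble (induced_right G g \<phi>) = r g (assemble \<phi>))"
      using complete_isometry_assemble[OF rep] assemble_surj assemble_left assemble_right
      by (auto simp: Let_def)
  qed
qed

end
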